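(* The Banach space $\mathcal{X}_{(4)}$ is tight by range (with respect to its natural unit vector basis $(e_n)$).
   Context: Tightness by range. Subspaces are closed and infinite dimensional. Let $X$ be a Banach space with a basis $(e_n)$. The support of $x=\sum_i x_ie_i$ is $\operatorname{supp}x=\{i:x_i\ne0\}$; the support of a subspace is the union of the supports of its elements; the range of a finitely supported nonzero $x$, $\operatorname{range}(x)$, is the smallest interval of $\mathbb{N}$ containing $\operatorname{supp}x$. We write $x<y$ if $\max\operatorname{supp}x<\min\operatorname{supp}y$; a block sequence is a sequence of nonzero finitely supported vectors $x_1<x_2<\dots$. A subspace $Y$ of $X$ is tight in $X$, witnessed by a sequence $I_1<I_2<\dots$ of successive subsets of $\mathbb{N}$, if the support of any subspace of $X$ isomorphic to $Y$ intersects all but finitely many of the sets $I_n$. $X$ is tight by range if for every block sequence $(x_n)$ the closed span of $(x_n)$ is tight in $X$, witnessed by $I_n=\operatorname{range}(x_n)$. Notation. $c_{00}(\mathbb{N})$ is the space of finitely supported real sequences, with usual basis $(e_n)$ (written $(e_n^* )$ when its elements are viewed as functionals), and $f(x)=\sum_i f_ix_i$ for $f,x\in c_{00}(\mathbb{N})$. For $x=\sum_ix_ie_i$, $|x|=\sum_i|x_i|e_i$, and $Ex=\sum_{i\in E}x_ie_i$ for $E\subset\mathbb{N}$. Parameters. $m_1=2$, $m_{j+1}=m_j^5$; $n_1=4$, $n_{j+1}=(5n_j)^{s_j}$ with $s_j=\log_2(m_{j+1}^3)$. Fix a partition of $\mathbb{N}$ into two infinite sets $N_1,N_2$, and an injective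 coding function $\sigma$ from the set of finite sequences $\varphi_1<\dots<\varphi_i$ of nonzero vectors of $c_{00}(\mathbb{N})$ with nonnegative rational coordinates into $N_2$ such that $m_{2\sigma(\varphi_1,\dots,\varphi_i)}>\max\operatorname{supp}\varphi_i\cdot\max\{1/\varphi_i(e_l): l\in\operatorname{supp}\varphi_i\}$. The norming set. $W$ is the smallest subset of $c_{00}(\mathbb{N})$ (built inductively from the $\pm e_n^*$ by the operations below) such that: ($\alpha$) if $f\in W$, $g\in c_{00}(\mathbb{N})$ and $|g|=|f|$, then $g\in W$; ($\beta$) $\pm e_n^*\in W$ for all $n$; ($\gamma$) if $f\in W$ and $E$ is an interval of $\mathbb{N}$, then $Ef\in W$; ($\delta$) if $f_1<\dots<f_{n_{2j}}$ are in $W$, then $\frac1{m_{2j}}\sum_{i=1}^{n_{2j}}f_i\in W$; ($\varepsilon$) if $f_1<\dots<f_{n_{2j+1}}$ in $W$ is a $(2j+1)$-special sequence, then $\frac1{m_{2j+1}}\sum_{i=1}^{n_{2j+1}}f_i\in W$; ($\zeta$) if $f\in W$ and $F=\{k_1<\dots<k_{2q}\}\subset\mathbb{N}$ satisfies $2q\le k_1$, then $\frac12S_Ff\in W$, where $S_Ff=\chi_{\bigcup_{p=1}^q[k_{2p-1},k_{2p})}f$ is the restriction of $f$ to $\bigcup_{p=1}^q[k_{2p-1},k_{2p})$. A functional $f\in W$ has weight $w(f)=m_j$ if, up to changing signs of coordinates, it is of the form $f=E\frac1{m_j}\sum_{i=1}^{n_j}f_i$ with $E$ an interval and $\frac1{m_j}\sum_{i=1}^{n_j}f_i$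 obtained by ($\delta$) ($j$ even) or ($\varepsilon$) ($j$ odd); a functional may admit more than one weight, and a condition $w(f)=m$ means that $f$ admits the weight $m$. A sequence $f_1<\dots<f_{n_{2j+1}}$ in $W$ is $(2j+1)$-special if $w(f_i)=m_{2j_i}$ for every $i$ with $n_{2j+1}<m_{2j_1}<\dots<m_{2j_{n_{2j+1}}}$, $j_1\in N_1$, and $j_i=\sigma(|f_1|,\dots,|f_{i-1}|)$ for $1<i\le n_{2j+1}$ (so, $\sigma$ being injective, $w(f_i)$ determines $(|f_1|,\dots,|f_{i-1}|)$). The space $\mathcal{X}_{(4)}$ is the completion of $c_{00}(\mathbb{N})$ under the norm $\|x\|=\sup\{f(x):f\in W\}$. *)

theory Defs
  imports "HOL-Analysis.Analysis"
begin

text \<open>Throughout, the index set of all coordinates is {1, 2, 3, ...}.  A vector of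
  \<open>c\<^sub>0\<^sub>0\<close> is a function on \<open>nat\<close> whose (unused) value at 0 is 0.\<close>

text \<open>A Banach space \<open>X\<close> is given as a closed linear subspace of a type of class \<open>banach\<close>.\<close>

definition infinite_dimensional :: "'a::real_vector set \<Rightarrow> bool" where
  "infinite_dimensional Y \<longleftrightarrow> \<not> (\<exists>B. finite B \<and> Y \<subseteq> span B)"

definition banach_subspace :: "'a::banach set \<Rightarrow> 'a set \<Rightarrow> bool" where
  "banach_subspace X Y \<longleftrightarrow> subspace Y \<and> closed Y \<and> Y \<subseteq> X \<and> infinite_dimensional Y"

definition isomorphic :: "'a::banach set \<Rightarrow> 'a set \<Rightarrow> bool" where
  "isomorphic Y Z \<longleftrightarrow> (\<exists>T S. homeomorphism Y Z T S
      \<and> (\<forall>x\<in>Y. \<forall>y\<in>Y. T (x + y) = T x + T y)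
      \<and> (\<forall>c. \<forall>x\<in>Y. T (c *\<^sub>R x) = c *\<^sub>R T x))"

definition expansion :: "(nat \<Rightarrow> 'a::banach) \<Rightarrow> 'a \<Rightarrow> (nat \<Rightarrow> real) \<Rightarrow> bool" where
  "expansion e x a \<longleftrightarrow> a 0 = 0 \<and> (\<lambda>N. \<Sum>n=1..N. a n *\<^sub>R e n) \<longlonglongrightarrow> x"

definition schauder_basis :: "'a::banach set \<Rightarrow> (nat \<Rightarrow> 'a) \<Rightarrow> bool" where
  "schauder_basis X e \<longleftrightarrow> subspace X \<and> closed X \<and> (\<forall>n\<ge>1. e n \<in> X)
      \<and> (\<forall>x\<in>X. \<exists>!a. expansion e x a)"

definition coords :: "(nat \<Rightarrow> 'a::banach) \<Rightarrow> 'a \<Rightarrow> nat \<Rightarrow> real" where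
  "coords e x = (THE a. expansion e x a)"

definition supp :: "(nat \<Rightarrow> real) \<Rightarrow> nat set" where
  "supp x = {i. x i \<noteq> 0}"

definition support :: "(nat \<Rightarrow> 'a::banach) \<Rightarrow> 'a \<Rightarrow> nat set" where
  "support e x = supp (coords e x)"

definition range_of :: "(nat \<Rightarrow> 'a::banach) \<Rightarrow> 'a \<Rightarrow> nat set" where
  "range_of e x = {Min (support e x)..Max (support e x)}"

text \<open>Sequences that are only used up to their tails, such as block sequences, are indexed
  from 0.\<close>

definition block_sequence :: "'a::banach set \<Rightarrow> (nat \<Rightarrow> 'a) \<Rightarrow> (nat \<Rightarrow> 'a) \<Rightarrow> bool" where
  "block_sequence X e x \<longleftrightarrow>
      (\<forall>n. x n \<in> X \<and> x n \<noteq> 0 \<and> finite (support e (x n)))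
      \<and> (\<forall>n. Max (support e (x n)) < Min (support e (x (Suc n))))"

definition tight_witnessed ::
    "'a::banach set \<Rightarrow> (nat \<Rightarrow> 'a) \<Rightarrow> 'a set \<Rightarrow> (nat \<Rightarrow> nat set) \<Rightarrow> bool" where
  "tight_witnessed X e Y I \<longleftrightarrow> banach_subspace X Y
      \<and> (\<forall>n. I n \<noteq> {}) \<and> (\<forall>n. \<forall>i\<in>I n. \<forall>j\<in>I (Suc n). i < j)
      \<and> (\<forall>Z. banach_subspace X Z \<and> isomorphic Y Z \<longrightarrow>
            finite {n. (\<Union>z\<in>Z. support e z) \<inter> I n = {}})"

definition tight_by_range :: "'a::banach set \<Rightarrow> (nat \<Rightarrow> 'a) \<Rightarrow> bool" where
  "tight_by_range X e \<longleftrightarrow> schauder_basis X e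
      \<and> (\<forall>x. block_sequence X e x \<longrightarrow>
            tight_witnessed X e (closure (span (range x))) (\<lambda>n. range_of e (x n)))"

definition c00 :: "(nat \<Rightarrow> real) set" where
  "c00 = {x. finite (supp x) \<and> x 0 = 0}"

definition unit_vec :: "nat \<Rightarrow> nat \<Rightarrow> real" where
  "unit_vec n = (\<lambda>i. if i = n then 1 else 0)"

definition pairing :: "(nat \<Rightarrow> real) \<Rightarrow> (nat \<Rightarrow> real) \<Rightarrow> real" where
  "pairing f x = (\<Sum>i\<in>supp f. f i * x i)"

definition vabs :: "(nat \<Rightarrow> real) \<Rightarrow> nat \<Rightarrow> real" where
  "vabs x = (\<lambda>i. \<bar>x i\<bar>)"

definition restr :: "nat set \<Rightarrow> (nat \<Rightarrow> real) \<Rightarrow> nat \<Rightarrow> real" where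
  "restr E x = (\<lambda>i. if i \<in> E then x i else 0)"

text \<open>Intervals may be empty or unbounded.\<close>

definition nat_interval :: "nat set \<Rightarrow> bool" where
  "nat_interval E \<longleftrightarrow> (\<forall>i\<in>E. \<forall>j\<in>E. {i..j} \<subseteq> E)"

text \<open>\<open>x\<^sub>1 < x\<^sub>2 < \<dots>\<close>; as \<open>max supp\<close> and \<open>min supp\<close> only make sense for nonzero vectors, all
  terms are nonzero.\<close>

definition successive :: "(nat \<Rightarrow> real) list \<Rightarrow> bool" where
  "successive xs \<longleftrightarrow> (\<forall>x\<in>set xs. x \<in> c00 \<and> supp x \<noteq> {})
      \<and> sorted_wrt (\<lambda>x y. Max (supp x) < Min (supp y)) xs"

text \<open>Both parameter sequences start at index 1; their values at 0 are never used.\<close>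

fun m_seq :: "nat \<Rightarrow> nat" where
  "m_seq 0 = 1"
| "m_seq (Suc 0) = 2"
| "m_seq (Suc (Suc j)) = m_seq (Suc j) ^ 5"

text \<open>The logarithm is an integer, because every \<open>m\<^sub>j\<close> is a power of 2; the floor only
  changes the type.\<close>

definition s_seq :: "nat \<Rightarrow> nat" where
  "s_seq j = nat \<lfloor>log 2 (real (m_seq (Suc j)) ^ 3)\<rfloor>"

fun n_seq :: "nat \<Rightarrow> nat" where
  "n_seq 0 = 1"
| "n_seq (Suc 0) = 4"
| "n_seq (Suc (Suc j)) = (5 * n_seq (Suc j)) ^ s_seq (Suc j)"

definition coding_domain :: "(nat \<Rightarrow> real) list set" where
  "coding_domain = {\<phi>s. \<phi>s \<noteq> [] \<and> successive \<phi>s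
      \<and> (\<forall>\<phi>\<in>set \<phi>s. \<forall>i. \<phi> i \<in> \<rat> \<and> 0 \<le> \<phi> i)}"

definition coding_function :: "nat set \<Rightarrow> ((nat \<Rightarrow> real) list \<Rightarrow> nat) \<Rightarrow> bool" where
  "coding_function N2 \<sigma> \<longleftrightarrow> inj_on \<sigma> coding_domain \<and> \<sigma> ` coding_domain \<subseteq> N2
      \<and> (\<forall>\<phi>s\<in>coding_domain. real (m_seq (2 * \<sigma> \<phi>s)) >
            real (Max (supp (last \<phi>s))) * Max ((\<lambda>l. 1 / last \<phi>s l) ` supp (last \<phi>s)))"

definition average :: "nat \<Rightarrow> (nat \<Rightarrow> real) list \<Rightarrow> nat \<Rightarrow> real" where
  "average j fs = (\<lambda>i. (1 / real (m_seq j)) * (\<Sum>f\<leftarrow>fs. f i))"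

text \<open>The restriction to \<open>[k\<^sub>1, k\<^sub>2) \<union> [k\<^sub>3, k\<^sub>4) \<union> \<dots>\<close> for \<open>F = {k\<^sub>1 < k\<^sub>2 < \<dots>}\<close>; list positions
  count from 0.\<close>

definition S_op :: "nat set \<Rightarrow> (nat \<Rightarrow> real) \<Rightarrow> nat \<Rightarrow> real" where
  "S_op F f = restr (\<Union>p<card F div 2.
      {sorted_list_of_set F ! (2 * p)..<sorted_list_of_set F ! (2 * p + 1)}) f"

text \<open>Special sequences occur in the construction of the norming set, and their definition
  refers to weights of functionals of this set.  So weights and special sequences are defined
  relative to a predicate \<open>A\<close>, where \<open>A j g\<close> stands for: \<open>g\<close> is an average
  \<open>(1 / m\<^sub>j) (f\<^sub>1 + \<dots> + f\<^sub>k)\<close>, \<open>k = n\<^sub>j\<close>, obtained by operation (delta) (\<open>j\<close> even) or (epsilon)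
  (\<open>j\<close> odd).\<close>

definition admits_weight ::
    "(nat \<Rightarrow> (nat \<Rightarrow> real) \<Rightarrow> bool) \<Rightarrow> nat \<Rightarrow> (nat \<Rightarrow> real) \<Rightarrow> bool" where
  "admits_weight A j f \<longleftrightarrow> (\<exists>g E. A j g \<and> nat_interval E \<and> vabs f = vabs (restr E g))"

text \<open>The \<open>(2k+1)\<close>-special sequences.  The list \<open>js\<close> consists of \<open>j\<^sub>1, j\<^sub>2, \<dots>\<close>, so that
  position \<open>i\<close> holds \<open>j\<close> with index \<open>i + 1\<close>.\<close>

definition special :: "nat set \<Rightarrow> ((nat \<Rightarrow> real) list \<Rightarrow> nat) \<Rightarrow>
    (nat \<Rightarrow> (nat \<Rightarrow> real) \<Rightarrow> bool) \<Rightarrow> nat \<Rightarrow> (nat \<Rightarrow> real) list \<Rightarrow> bool" where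
  "special N1 \<sigma> A k fs \<longleftrightarrow> successive fs \<and> length fs = n_seq (2 * k + 1)
      \<and> (\<exists>js. length js = length fs
          \<and> (\<forall>i<length fs. admits_weight A (2 * js ! i) (fs ! i))
          \<and> n_seq (2 * k + 1) < m_seq (2 * js ! 0)
          \<and> sorted_wrt (\<lambda>i j. m_seq (2 * i) < m_seq (2 * j)) js
          \<and> js ! 0 \<in> N1
          \<and> (\<forall>i. 0 < i \<and> i < length fs \<longrightarrow> js ! i = \<sigma> (map vabs (take i fs))))"

lemma special_mono [mono]:
  assumes "\<And>j g. A j g \<longrightarrow> B j g"
  shows "special N1 \<sigma> A k fs \<longrightarrow> special N1 \<sigma> B k fs"
proof -
  have "admits_weight A j f \<Longrightarrow> admits_weight B j f" for j f
    unfolding admits_weight_def using assms by blast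
  then show ?thesis
    unfolding special_def by blast
qed

text \<open>\<open>W N1 \<sigma> f\<close>: \<open>f\<close> belongs to the norming set.  \<open>averaged N1 \<sigma> j g\<close> is the
  predicate \<open>A\<close> described above.\<close>

inductive W :: "nat set \<Rightarrow> ((nat \<Rightarrow> real) list \<Rightarrow> nat) \<Rightarrow> (nat \<Rightarrow> real) \<Rightarrow> bool"
  and averaged :: "nat set \<Rightarrow> ((nat \<Rightarrow> real) list \<Rightarrow> nat) \<Rightarrow> nat \<Rightarrow> (nat \<Rightarrow> real) \<Rightarrow> bool"
  for N1 \<sigma> where
  alpha: "W N1 \<sigma> f \<Longrightarrow> g \<in> c00 \<Longrightarrow> vabs g = vabs f \<Longrightarrow> W N1 \<sigma> g"
| beta_pos: "n \<ge> 1 \<Longrightarrow> W N1 \<sigma> (unit_vec n)"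
| beta_neg: "n \<ge> 1 \<Longrightarrow> W N1 \<sigma> (\<lambda>i. - unit_vec n i)"
| gamma: "W N1 \<sigma> f \<Longrightarrow> nat_interval E \<Longrightarrow> W N1 \<sigma> (restr E f)"
| delta: "j \<ge> 1 \<Longrightarrow> successive fs \<Longrightarrow> length fs = n_seq (2 * j) \<Longrightarrow> \<forall>f\<in>set fs. W N1 \<sigma> f
    \<Longrightarrow> averaged N1 \<sigma> (2 * j) (average (2 * j) fs)"
| epsilon: "j \<ge> 1 \<Longrightarrow> \<forall>f\<in>set fs. W N1 \<sigma> f \<Longrightarrow> special N1 \<sigma> (averaged N1 \<sigma>) j fs
    \<Longrightarrow> averaged N1 \<sigma> (2 * j + 1) (average (2 * j + 1) fs)"
| averaged_in_W: "averaged N1 \<sigma> j g \<Longrightarrow> W N1 \<sigma> g"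
| zeta: "W N1 \<sigma> f \<Longrightarrow> finite F \<Longrightarrow> F \<noteq> {} \<Longrightarrow> card F = 2 * q \<Longrightarrow> 2 * q \<le> Min F
    \<Longrightarrow> W N1 \<sigma> (\<lambda>i. 1 / 2 * S_op F f i)"

definition W_norm :: "nat set \<Rightarrow> ((nat \<Rightarrow> real) list \<Rightarrow> nat) \<Rightarrow> (nat \<Rightarrow> real) \<Rightarrow> real" where
  "W_norm N1 \<sigma> x = (SUP f\<in>Collect (W N1 \<sigma>). pairing f x)"

text \<open>\<open>X\<close>, with the canonical embedding \<open>\<iota>\<close>, is a completion of \<open>c\<^sub>0\<^sub>0\<close> under the norm
  \<open>\<nu>\<close>: a complete space in which \<open>\<iota>\<close> embeds \<open>c\<^sub>0\<^sub>0\<close> linearly, isometrically and densely.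
  Such an \<open>X\<close> is unique up to isometric isomorphism.\<close>

definition is_completion ::
    "((nat \<Rightarrow> real) \<Rightarrow> real) \<Rightarrow> ((nat \<Rightarrow> real) \<Rightarrow> 'a::banach) \<Rightarrow> 'a set \<Rightarrow> bool" where
  "is_completion \<nu> \<iota> X \<longleftrightarrow>
      (\<forall>x\<in>c00. \<forall>y\<in>c00. \<iota> (\<lambda>i. x i + y i) = \<iota> x + \<iota> y)
      \<and> (\<forall>c. \<forall>x\<in>c00. \<iota> (\<lambda>i. c * x i) = c *\<^sub>R \<iota> x)
      \<and> (\<forall>x\<in>c00. norm (\<iota> x) = \<nu> x)
      \<and> X = closure (\<iota> ` c00)"

end

theory Submission
  imports Defs
begin

text \<open>Suppose that \<open>T\<close> is an isomorphism from the closed span of a block sequence \<open>(x\<^sub>n)\<close> onto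
  a subspace whose support misses infinitely many of the ranges of the \<open>x\<^sub>n\<close>.  By a gliding
  hump argument, differences \<open>w\<^sub>n\<close> of normalized blocks with these ranges have images that are,
  up to a small perturbation, successive vectors \<open>t\<^sub>n\<close> with supports off all these ranges.
  James' argument gives \<open>\<ell>\<^sub>1\<close>-averages of the \<open>w\<^sub>n\<close>, and operation (zeta) lets functionals
  norming them be supported in the ranges.  Averages of \<open>n\<^sub>2\<^sub>j\<close> of these, normalized by
  \<open>m\<^sub>2\<^sub>j\<close>, carry functionals \<open>f\<^sub>i\<close> forming a special sequence, so that the sum \<open>u\<close> of
  \<open>n\<^sub>q\<close> of them, \<open>q = 2k + 1\<close>, has norm at least a constant times \<open>n\<^sub>q / m\<^sub>q\<close>.  The \<open>f\<^sub>i\<close>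
  vanish on the corresponding combination of the \<open>t\<^sub>n\<close>, and by injectivity of the coding every
  other special functional is small on it; its norm is therefore at most a constant times
  \<open>n\<^sub>q / m\<^sub>q\<^sup>2\<close>, which is impossible for large \<open>k\<close>.\<close>


section \<open>The parameters\<close>

text \<open>Closure of \<open>W\<close> under changes of sign makes the norm a function of the
  absolute values of the coordinates. So all estimates are made for \<open>ap\<close>, the pairing
  of |f| with |z|, which is monotone in both arguments. The obstacle is to keep the functionals off
  the images. Operation (gamma) restricts to a single interval, whereas an average involves many
  ranges, with coordinates of the images lying between them. (zeta) restricts to many intervals at
  once for a single factor 1/2, but only if they start late compared with their number. The length
  of the averages must therefore be bounded before their position is chosen, which James' argument
  allows. This is also why ranges occur and not supports: nothing bounds the number of intervals
  that make up the support of a block. Lower estimates are needed for combinations of the w_n, upper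
  estimates for those of the t_n with the same coefficients. The latter rest on the order of the
  t_n, their disjointness from the ranges and the comparison of norms; nothing else is known about
  the images.\<close>

lemma m_seq_Suc: "m_seq (Suc j) = 2 ^ 5 ^ j"
proof (induction j)
  case (Suc j)
  have "m_seq (Suc (Suc j)) = (2 ^ 5 ^ j) ^ 5"
    using Suc by simp
  also have "\<dots> = 2 ^ 5 ^ Suc j"
    by (simp only: power_mult [symmetric] power_Suc mult.commute)
  finally show ?case .
qed simp

lemma s_seq_eq: "s_seq j = 3 * 5 ^ j"
proof -
  have "real (m_seq (Suc j)) ^ 3 = 2 ^ (3 * 5 ^ j)"
    by (simp add: m_seq_Suc power_mult [symmetric] mult.commute)
  also have "log 2 \<dots> = real (3 * 5 ^ j)"
    by (simp add: log_nat_power)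
  finally show ?thesis
    unfolding s_seq_def by (simp only: floor_of_nat nat_int)
qed

lemma m_seq_ge_2: "1 \<le> p \<Longrightarrow> 2 \<le> m_seq p"
  by (cases p) (simp_all add: m_seq_Suc self_le_power)

lemma m_seq_pos: "0 < m_seq p"
  using m_seq_ge_2 [of p] by (cases "p = 0") auto

lemma m_seq_square_le: "1 \<le> p \<Longrightarrow> p < q \<Longrightarrow> m_seq p ^ 2 \<le> m_seq q"
proof -
  assume "1 \<le> p" "p < q"
  then obtain a b where p: "p = Suc a" and q: "q = Suc b" and "a < b"
    by (cases p; cases q) auto
  have "(2::nat) * 5 ^ a \<le> 5 ^ Suc a" by simp
  also have "\<dots> \<le> 5 ^ b"
    using \<open>a < b\<close> by (intro power_increasing) auto
  finally have "(2::nat) ^ (2 * 5 ^ a) \<le> 2 ^ 5 ^ b"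
    by (intro power_increasing) auto
  then show ?thesis
    by (simp add: p q m_seq_Suc power_mult [symmetric] mult.commute)
qed

lemma m_seq_less: "1 \<le> p \<Longrightarrow> p < q \<Longrightarrow> m_seq p < m_seq q"
proof -
  assume *: "1 \<le> p" "p < q"
  have "m_seq p < m_seq p ^ 2"
    using m_seq_ge_2 [OF *(1)] by (simp add: power2_eq_square)
  with m_seq_square_le [OF *] show ?thesis by linarith
qed

lemma m_seq_less_iff: "1 \<le> p \<Longrightarrow> 1 \<le> q \<Longrightarrow> m_seq p < m_seq q \<longleftrightarrow> p < q"
  using m_seq_less [of p q] m_seq_less [of q p] by (metis linorder_neqE_nat order_less_asym order_less_irrefl)

lemma m_seq_mono: "1 \<le> p \<Longrightarrow> p \<le> q \<Longrightarrow> m_seq p \<le> m_seq q"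
  using m_seq_less [of p q] by (cases "p = q") auto

lemma less_m_seq_Suc: "j < m_seq (Suc j)"
proof -
  have "j < 2 ^ j" by simp
  also have "\<dots> \<le> 2 ^ 5 ^ j"
    by (intro power_increasing) (auto intro: less_imp_le less_le_trans [OF less_exp] power_mono)
  finally show ?thesis by (simp add: m_seq_Suc)
qed

lemma n_seq_Suc_Suc: "n_seq (Suc (Suc j)) = (5 * n_seq (Suc j)) ^ (3 * 5 ^ Suc j)"
  by (simp add: s_seq_eq)

lemma n_seq_ge_4: "1 \<le> p \<Longrightarrow> 4 \<le> n_seq p"
proof (induction p rule: nat_induct_at_least)
  case (Suc p)
  then obtain j where p: "p = Suc j" by (cases p) auto
  have "5 * n_seq p \<le> (5 * n_seq p) ^ (3 * 5 ^ p)"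
    using Suc by (intro self_le_power) auto
  then show ?case
    using Suc n_seq_Suc_Suc [of j] by (simp add: p)
qed simp

lemma n_seq_mono:
  assumes "1 \<le> p" "p \<le> q"
  shows "n_seq p \<le> n_seq q"
  using assms(2)
proof (induction q rule: dec_induct)
  case (step q)
  then obtain j where q: "q = Suc j" using assms(1) by (cases q) auto
  have "n_seq q \<le> 5 * n_seq q" by simp
  also have "5 * n_seq q \<le> (5 * n_seq q) ^ (3 * 5 ^ q)"
    using n_seq_ge_4 [of q] q by (intro self_le_power) auto
  finally show ?case
    using step n_seq_Suc_Suc [of j] by (simp add: q)
qed auto

text \<open>The exponent \<open>d\<close> is twice log_2 of m_q, the number of halvings after which
  an error is 1/m_q^2. Each halving costs a factor n_{q-1}. Since n_q has the exponent 3 log_2 m_q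
  and a spare factor 5 in its base, \<open>d + 1\<close> such factors amount to at most n_q /
  m_q^3.\<close>

lemma n_seq_growth:
  assumes "2 \<le> q"
  obtains d where "2 ^ d = m_seq q ^ 2" "m_seq q ^ 3 * n_seq (q - 1) ^ (d + 1) \<le> n_seq q"
proof -
  obtain j where q: "q = Suc (Suc j)"
    using assms by (metis Suc_le_D numeral_2_eq_2 le_Suc_ex add_Suc)
  define d :: nat where "d = 2 * 5 ^ Suc j"
  let ?s = "3 * 5 ^ Suc j :: nat" and ?M = "n_seq (Suc j)"
  have d: "d + 1 \<le> ?s"
    unfolding d_def by (simp add: Suc_le_eq)
  have 1: "2 ^ d = m_seq q ^ 2"
    unfolding q m_seq_Suc d_def by (simp only: power_mult [symmetric] mult.commute)
  have "m_seq q ^ 3 = 2 ^ ?s"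
    unfolding q m_seq_Suc by (simp only: power_mult [symmetric] mult.commute)
  also have "\<dots> \<le> 5 ^ ?s"
    by (intro power_mono) auto
  finally have "m_seq q ^ 3 * ?M ^ (d + 1) \<le> 5 ^ ?s * ?M ^ ?s"
    using d n_seq_ge_4 [of "Suc j"] by (intro mult_mono power_increasing) auto
  also have "\<dots> = n_seq q"
    unfolding q n_seq_Suc_Suc by (simp only: power_mult_distrib)
  finally show ?thesis
    using that [of d] 1 by (simp add: q)
qed

lemma m_seq_cube_le_n_seq: "2 \<le> q \<Longrightarrow> m_seq q ^ 3 \<le> n_seq q"
proof -
  assume q: "2 \<le> q"
  then obtain d where "m_seq q ^ 3 * n_seq (q - 1) ^ (d + 1) \<le> n_seq q"
    by (rule n_seq_growth)
  moreover have "1 \<le> n_seq (q - 1) ^ (d + 1)"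
    using n_seq_ge_4 [of "q - 1"] q by (intro one_le_power) linarith
  then have "m_seq q ^ 3 * 1 \<le> m_seq q ^ 3 * n_seq (q - 1) ^ (d + 1)"
    by (intro mult_le_mono2)
  ultimately show ?thesis by linarith
qed

section \<open>Successive families\<close>

definition ap :: "(nat \<Rightarrow> real) \<Rightarrow> (nat \<Rightarrow> real) \<Rightarrow> real" where
  "ap f z = (\<Sum>i\<in>supp f. \<bar>f i * z i\<bar>)"

definition vsum :: "(nat \<Rightarrow> nat \<Rightarrow> real) \<Rightarrow> nat set \<Rightarrow> nat \<Rightarrow> real" where
  "vsum z J = (\<lambda>i. \<Sum>k\<in>J. z k i)"

lemma ap_eq_sum: "finite S \<Longrightarrow> supp f \<subseteq> S \<Longrightarrow> ap f z = (\<Sum>i\<in>S. \<bar>f i * z i\<bar>)"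
  unfolding ap_def by (rule sum.mono_neutral_left) (auto simp: supp_def)

lemma ap_nonneg: "0 \<le> ap f z"
  unfolding ap_def by (simp add: sum_nonneg)

lemma ap_mono:
  assumes "finite (supp g)" "\<And>i. \<bar>f i\<bar> \<le> \<bar>g i\<bar>" "\<And>i. i \<in> supp f \<Longrightarrow> \<bar>z i\<bar> \<le> \<bar>z' i\<bar>"
  shows "ap f z \<le> ap g z'"
proof -
  have sub: "supp f \<subseteq> supp g"
    using assms(2) by (auto simp: supp_def) (metis abs_0_eq abs_le_zero_iff)
  have "ap f z = (\<Sum>i\<in>supp g. \<bar>f i * z i\<bar>)"
    by (rule ap_eq_sum [OF assms(1) sub])
  also have "\<dots> \<le> ap g z'"
    unfolding ap_def
  proof (rule sum_mono)
    fix i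
    show "\<bar>f i * z i\<bar> \<le> \<bar>g i * z' i\<bar>"
      using assms(2) [of i] assms(3) [of i]
      by (cases "i \<in> supp f") (auto simp: abs_mult supp_def intro!: mult_mono)
  qed
  finally show ?thesis .
qed

lemma ap_vsum_le: "ap f (vsum z J) \<le> (\<Sum>k\<in>J. ap f (z k))"
proof -
  have "ap f (vsum z J) \<le> (\<Sum>i\<in>supp f. \<Sum>k\<in>J. \<bar>f i * z k i\<bar>)"
    unfolding ap_def vsum_def by (intro sum_mono) (simp add: sum_distrib_left sum_abs)
  also have "\<dots> = (\<Sum>k\<in>J. ap f (z k))"
    unfolding ap_def by (rule sum.swap)
  finally show ?thesis .
qed

lemma ap_add_le: "ap f (\<lambda>i. x i + y i) \<le> ap f x + ap f y"
  unfolding ap_def sum.distrib [symmetric]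
  by (intro sum_mono) (metis abs_triangle_ineq distrib_left)

lemma ap_scale: "ap f (\<lambda>i. c * z i) = \<bar>c\<bar> * ap f z"
  unfolding ap_def by (simp add: sum_distrib_left abs_mult mult_ac)

lemma ap_disjoint: "supp f \<inter> supp z = {} \<Longrightarrow> ap f z = 0"
  unfolding ap_def by (intro sum.neutral) (auto simp: supp_def)

lemma ap_cong: "(\<And>i. i \<in> supp f \<Longrightarrow> z i = z' i) \<Longrightarrow> ap f z = ap f z'"
  unfolding ap_def by (rule sum.cong) auto

lemma successive_nth:
  assumes "successive fs" "s < length fs"
  shows "fs ! s \<in> c00" "supp (fs ! s) \<noteq> {}"
  using assms by (auto simp: successive_def)

lemma successive_less:
  assumes "successive fs" "s < s'" "s' < length fs" "a \<in> supp (fs ! s)" "b \<in> supp (fs ! s')"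
  shows "a < b"
proof -
  have "a \<le> Max (supp (fs ! s))"
    using assms successive_nth [of fs s] by (intro Max_ge) (auto simp: c00_def)
  also have "\<dots> < Min (supp (fs ! s'))"
    using assms unfolding successive_def by (auto simp: sorted_wrt_iff_nth_less)
  also have "\<dots> \<le> b"
    using assms successive_nth [of fs s'] by (intro Min_le) (auto simp: c00_def)
  finally show ?thesis .
qed

lemma successiveI:
  assumes "\<And>s. s < length fs \<Longrightarrow> fs ! s \<in> c00" "\<And>s. s < length fs \<Longrightarrow> supp (fs ! s) \<noteq> {}"
    and "\<And>s s' a b. s < s' \<Longrightarrow> s' < length fs \<Longrightarrow> a \<in> supp (fs ! s) \<Longrightarrow> b \<in> supp (fs ! s') \<Longrightarrow> a < b"
  shows "successive fs"
  unfolding successive_def sorted_wrt_iff_nth_less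
proof (intro conjI ballI allI impI)
  fix x assume "x \<in> set fs"
  then show "x \<in> c00" "supp x \<noteq> {}"
    using assms(1,2) by (metis in_set_conv_nth)+
next
  fix s s' assume s: "s < s'" "s' < length fs"
  show "Max (supp (fs ! s)) < Min (supp (fs ! s'))"
    using s assms(1,2) [of s] assms(1,2) [of s']
    by (intro assms(3) [OF s] Max_in Min_in) (auto simp: c00_def)
qed

lemma average_eq: "average j fs i = (1 / real (m_seq j)) * (\<Sum>s<length fs. (fs ! s) i)"
  unfolding average_def
  by (simp add: sum_list_sum_nth atLeast0LessThan)

lemma abs_sum_at_most_one:
  fixes a :: "'i \<Rightarrow> real"
  assumes "finite S" "\<And>s s'. s \<in> S \<Longrightarrow> s' \<in> S \<Longrightarrow> a s \<noteq> 0 \<Longrightarrow> a s' \<noteq> 0 \<Longrightarrow> s = s'"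
  shows "\<bar>\<Sum>s\<in>S. a s\<bar> = (\<Sum>s\<in>S. \<bar>a s\<bar>)"
proof (cases "\<exists>s\<in>S. a s \<noteq> 0")
  case True
  then obtain s where s: "s \<in> S" "a s \<noteq> 0" by blast
  have 0: "a s' = 0" if "s' \<in> S - {s}" for s'
    using assms(2) [of s s'] s that by auto
  show ?thesis
    using assms(1) s by (simp add: sum.remove 0)
qed auto

lemma abs_average:
  assumes "successive fs"
  shows "\<bar>average j fs i\<bar> = (1 / real (m_seq j)) * (\<Sum>s<length fs. \<bar>(fs ! s) i\<bar>)"
proof -
  have "\<bar>\<Sum>s<length fs. (fs ! s) i\<bar> = (\<Sum>s<length fs. \<bar>(fs ! s) i\<bar>)"
  proof (rule abs_sum_at_most_one)
    fix s s' assume "s \<in> {..<length fs}" "s' \<in> {..<length fs}" "(fs ! s) i \<noteq> 0" "(fs ! s') i \<noteq> 0"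
    then show "s = s'"
      using successive_less [OF assms, of s s' i i] successive_less [OF assms, of s' s i i]
      by (auto simp: supp_def) (metis less_irrefl linorder_neqE_nat)
  qed auto
  then show ?thesis
    by (simp add: average_eq abs_mult)
qed

lemma supp_average:
  assumes "successive fs"
  shows "supp (average j fs) = (\<Union>s<length fs. supp (fs ! s))"
proof -
  have "average j fs i \<noteq> 0 \<longleftrightarrow> (\<exists>s<length fs. (fs ! s) i \<noteq> 0)" for i
  proof -
    have "average j fs i \<noteq> 0 \<longleftrightarrow> (\<Sum>s<length fs. \<bar>(fs ! s) i\<bar>) \<noteq> 0"
      using abs_average [OF assms, of j i] m_seq_pos [of j] by auto
    then show ?thesis by (subst (asm) sum_nonneg_eq_0_iff) auto
  qed
  then show ?thesis by (auto simp: supp_def)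
qed

lemma average_c00: "successive fs \<Longrightarrow> average j fs \<in> c00"
  using successive_nth [of fs] unfolding c00_def
  by (simp add: supp_average) (simp add: average_eq)

lemma ap_average:
  assumes "successive fs"
  shows "ap (average j fs) z = (1 / real (m_seq j)) * (\<Sum>s<length fs. ap (fs ! s) z)"
proof -
  let ?S = "\<Union>s<length fs. supp (fs ! s)"
  have fin: "finite ?S"
    using successive_nth [OF assms] by (auto simp: c00_def)
  have "ap (average j fs) z = (\<Sum>i\<in>?S. \<bar>average j fs i * z i\<bar>)"
    by (rule ap_eq_sum [OF fin]) (simp add: supp_average [OF assms])
  also have "\<dots> = (\<Sum>i\<in>?S. (1 / real (m_seq j)) * (\<Sum>s<length fs. \<bar>(fs ! s) i * z i\<bar>))"
    by (simp add: abs_mult abs_average [OF assms] sum_distrib_right mult.assoc)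
  also have "\<dots> = (1 / real (m_seq j)) * (\<Sum>i\<in>?S. \<Sum>s<length fs. \<bar>(fs ! s) i * z i\<bar>)"
    by (simp only: sum_distrib_left)
  also have "(\<Sum>i\<in>?S. \<Sum>s<length fs. \<bar>(fs ! s) i * z i\<bar>) =
      (\<Sum>s<length fs. \<Sum>i\<in>?S. \<bar>(fs ! s) i * z i\<bar>)"
    by (rule sum.swap)
  also have "(\<Sum>s<length fs. \<Sum>i\<in>?S. \<bar>(fs ! s) i * z i\<bar>) = (\<Sum>s<length fs. ap (fs ! s) z)"
    by (intro sum.cong refl ap_eq_sum [symmetric] fin) auto
  finally show ?thesis .
qed

text \<open>Two successive families of sets meet in a staircase pattern: apart from the first
  \<open>F s\<close> meeting it, each \<open>Z i\<close> only meets sets \<open>F s\<close> of which it is the leftmost partner.\<close>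

lemma staircase:
  fixes F :: "nat \<Rightarrow> nat set" and Z :: "nat \<Rightarrow> nat set"
  assumes F: "\<And>s s' a b. s < s' \<Longrightarrow> s' < n \<Longrightarrow> a \<in> F s \<Longrightarrow> b \<in> F s' \<Longrightarrow> a < b"
    and Z: "\<And>i i' a b. i \<in> J \<Longrightarrow> i' \<in> J \<Longrightarrow> i < i' \<Longrightarrow> a \<in> Z i \<Longrightarrow> b \<in> Z i' \<Longrightarrow> a < b"
  obtains Js where "\<And>s. Js s \<subseteq> J" "disjoint_family_on Js {..<n}"
    "\<And>s. s < n \<Longrightarrow> \<exists>m. \<forall>i\<in>J. F s \<inter> Z i \<noteq> {} \<longrightarrow> i \<in> Js s \<or> i = m"
proof -
  define Js where "Js s = {i \<in> J. F s \<inter> Z i \<noteq> {} \<and> (\<forall>s'<s. F s' \<inter> Z i = {})}" for s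
  \<comment> \<open>The two orders collide: an earlier \<open>F s'\<close> meeting
    \<open>Z i'\<close> gives a point b that lies before a by the order of the F and after a by that
    of the Z. Hence only the smallest index whose set meets \<open>F s\<close> can fail to lie in
    \<open>Js s\<close>.\<close>
  have later: False
    if s: "s < n" and i: "i \<in> J" "i' \<in> J" "i < i'" "F s \<inter> Z i \<noteq> {}" "F s \<inter> Z i' \<noteq> {}" "i' \<notin> Js s"
    for s i i'
  proof -
    obtain s' where s': "s' < s" "F s' \<inter> Z i' \<noteq> {}"
      using i s unfolding Js_def by blast
    then obtain a b where "a \<in> F s" "a \<in> Z i" "b \<in> F s'" "b \<in> Z i'"
      using i by blast
    then show False
      using F [of s' s b a] Z [of i i' a b] s s' i by auto
  qed
  have "\<exists>m. \<forall>i\<in>J. F s \<inter> Z i \<noteq> {} \<longrightarrow> i \<in> Js s \<or> i = m" if "s < n" for s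
  proof (cases "\<exists>m\<in>J. F s \<inter> Z m \<noteq> {} \<and> m \<notin> Js s")
    case True
    then obtain m where "m \<in> J" "F s \<inter> Z m \<noteq> {}" "m \<notin> Js s" by blast
    then show ?thesis
      using later [OF that, of m] later [OF that, of _ m]
      by (metis linorder_neqE_nat)
  qed auto
  moreover have "disjoint_family_on Js {..<n}"
    unfolding disjoint_family_on_def
  proof (intro ballI impI)
    fix s s' :: nat assume "s \<noteq> s'"
    then consider "s < s'" | "s' < s" by linarith
    then show "Js s \<inter> Js s' = {}"
      by cases (auto simp: Js_def)
  qed
  ultimately show ?thesis
    by (intro that [of Js]) (auto simp: Js_def)
qed

text \<open>The step down from an average to its constituents in every upper estimate. Each
  constituent pays \<open>C\<close> for at most one stray vector and otherwise acts on its own share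
  \<open>Js s\<close>. The shares are disjoint, so the total number of vectors does not grow from
  one level to the next.\<close>

lemma split_successive:
  assumes fs: "successive fs"
    and z: "\<And>i i' a b. i \<in> J \<Longrightarrow> i' \<in> J \<Longrightarrow> i < i' \<Longrightarrow> a \<in> supp (z i) \<Longrightarrow> b \<in> supp (z i') \<Longrightarrow> a < b"
    and C: "\<And>s i. s < length fs \<Longrightarrow> i \<in> J \<Longrightarrow> ap (fs ! s) (z i) \<le> C" "0 \<le> C"
    and J: "finite J"
  obtains Js where "\<And>s. Js s \<subseteq> J" "(\<Sum>s<length fs. card (Js s)) \<le> card J"
    "\<And>s. s < length fs \<Longrightarrow> ap (fs ! s) (vsum z J) \<le> C + ap (fs ! s) (vsum z (Js s))"
proof -
  obtain Js where Js: "\<And>s. Js s \<subseteq> J" "disjoint_family_on Js {..<length fs}"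
    "\<And>s. s < length fs \<Longrightarrow> \<exists>m. \<forall>i\<in>J. supp (fs ! s) \<inter> supp (z i) \<noteq> {} \<longrightarrow> i \<in> Js s \<or> i = m"
  proof (rule staircase [of "length fs" "\<lambda>s. supp (fs ! s)" J "\<lambda>i. supp (z i)"])
    fix s s' a b assume "s < s'" "s' < length fs" "a \<in> supp (fs ! s)" "b \<in> supp (fs ! s')"
    then show "a < b" by (rule successive_less [OF fs])
  next
    fix i i' a b assume "i \<in> J" "i' \<in> J" "i < i'" "a \<in> supp (z i)" "b \<in> supp (z i')"
    then show "a < b" by (rule z)
  qed (rule that)
  have fin: "finite (Js s)" for s
    using Js(1) J finite_subset by blast
  have "(\<Sum>s<length fs. card (Js s)) = card (\<Union>s<length fs. Js s)"
    using Js(2) fin unfolding disjoint_family_on_def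
    by (intro card_UN_disjoint [symmetric]) auto
  also have "\<dots> \<le> card J"
    using Js(1) J by (intro card_mono) auto
  finally have card: "(\<Sum>s<length fs. card (Js s)) \<le> card J" .
  have "ap (fs ! s) (vsum z J) \<le> C + ap (fs ! s) (vsum z (Js s))" if s: "s < length fs" for s
  proof -
    obtain m where m: "\<forall>i\<in>J. supp (fs ! s) \<inter> supp (z i) \<noteq> {} \<longrightarrow> i \<in> Js s \<or> i = m"
      using Js(3) [OF s] by blast
    \<comment> \<open>\<open>D\<close> holds the stray index, or is empty if \<open>m\<close> lies
      outside \<open>J\<close> or already belongs to the share.\<close>
    define D where "D = {m} \<inter> (J - Js s)"
    have sub: "Js s \<union> D \<subseteq> J" "Js s \<inter> D = {}"
      using Js(1) by (auto simp: D_def)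
    have "ap (fs ! s) (vsum z J) = ap (fs ! s) (vsum z (Js s \<union> D))"
    proof (rule ap_cong)
      fix i assume i: "i \<in> supp (fs ! s)"
      have "z k i = 0" if "k \<in> J - (Js s \<union> D)" for k
        using m that i by (auto simp: D_def supp_def)
      then show "vsum z J i = vsum z (Js s \<union> D) i"
        unfolding vsum_def using J sub by (intro sum.mono_neutral_right) auto
    qed
    also have "vsum z (Js s \<union> D) = (\<lambda>i. vsum z D i + vsum z (Js s) i)"
      unfolding vsum_def using sub fin by (simp add: sum.union_disjoint D_def Int_commute add.commute)
    also have "ap (fs ! s) \<dots> \<le> ap (fs ! s) (vsum z D) + ap (fs ! s) (vsum z (Js s))"
      by (rule ap_add_le)
    also have "ap (fs ! s) (vsum z D) \<le> (\<Sum>k\<in>D. ap (fs ! s) (z k))"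
      by (rule ap_vsum_le)
    also have "\<dots> \<le> C"
      using C s by (cases "m \<in> J - Js s") (auto simp: D_def)
    finally show ?thesis by simp
  qed
  with Js(1) card that show ?thesis by blast
qed

section \<open>The norming set\<close>

lemma c00_subset: "f \<in> c00 \<Longrightarrow> (\<And>i. f i = 0 \<Longrightarrow> g i = 0) \<Longrightarrow> g \<in> c00"
  unfolding c00_def supp_def by (auto elim: rev_finite_subset)

lemma abs_average_le:
  assumes fs: "successive fs" and 1: "\<And>f. f \<in> set fs \<Longrightarrow> \<bar>f i\<bar> \<le> 1"
  shows "\<bar>average p fs i\<bar> \<le> 1 / m_seq p"
proof -
  have "(\<Sum>s<length fs. \<bar>(fs ! s) i\<bar>) \<le> 1"
  proof (cases "\<exists>s<length fs. (fs ! s) i \<noteq> 0")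
    case True
    then obtain s where s: "s < length fs" "(fs ! s) i \<noteq> 0" by blast
    have "(fs ! s') i = 0" if "s' \<in> {..<length fs} - {s}" for s'
      using successive_less [OF fs, of s s' i i] successive_less [OF fs, of s' s i i] s that
      by (cases s s' rule: linorder_cases) (auto simp: supp_def)
    then show ?thesis
      using s 1 by (simp add: sum.remove [of _ s])
  qed simp
  then show ?thesis
    unfolding abs_average [OF fs] by (simp add: divide_right_mono)
qed

text \<open>Rationality places the moduli of special sequences in the domain of the coding. The
  bound 1, divided by the weight, keeps the coordinates of an average of weight m_p below
  1/m_p.\<close>

lemma W_basic:
  shows "W N1 \<sigma> f \<Longrightarrow> f \<in> c00 \<and> (\<forall>i. f i \<in> \<rat> \<and> \<bar>f i\<bar> \<le> 1)"
    and "averaged N1 \<sigma> j g \<Longrightarrow> g \<in> c00 \<and> (\<forall>i. g i \<in> \<rat> \<and> \<bar>g i\<bar> \<le> 1)"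
proof (induction rule: W_averaged.inducts)
  have avg: "average p fs \<in> c00 \<and> (\<forall>i. average p fs i \<in> \<rat> \<and> \<bar>average p fs i\<bar> \<le> 1)"
    if fs: "successive fs" and IH: "\<forall>f\<in>set fs. f \<in> c00 \<and> (\<forall>i. f i \<in> \<rat> \<and> \<bar>f i\<bar> \<le> 1)" for p fs
  proof (intro conjI allI)
    show "average p fs \<in> c00" by (rule average_c00 [OF fs])
    fix i
    show "average p fs i \<in> \<rat>"
      using IH by (auto simp: average_eq intro!: Rats_mult Rats_divide Rats_sum)
    have "\<bar>average p fs i\<bar> \<le> 1 / m_seq p"
      using IH by (intro abs_average_le fs) auto
    also have "\<dots> \<le> 1" using m_seq_pos [of p] by simp
    finally show "\<bar>average p fs i\<bar> \<le> 1" .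
  qed
  show "average (2 * j) fs \<in> c00 \<and> (\<forall>i. average (2 * j) fs i \<in> \<rat> \<and> \<bar>average (2 * j) fs i\<bar> \<le> 1)"
    if "successive fs" "\<forall>f\<in>set fs. W N1 \<sigma> f \<and> f \<in> c00 \<and> (\<forall>i. f i \<in> \<rat> \<and> \<bar>f i\<bar> \<le> 1)" for j fs
    using avg that by blast
  show "average (2 * j + 1) fs \<in> c00 \<and>
      (\<forall>i. average (2 * j + 1) fs i \<in> \<rat> \<and> \<bar>average (2 * j + 1) fs i\<bar> \<le> 1)"
    if "\<forall>f\<in>set fs. W N1 \<sigma> f \<and> f \<in> c00 \<and> (\<forall>i. f i \<in> \<rat> \<and> \<bar>f i\<bar> \<le> 1)"
      "special N1 \<sigma> (\<lambda>j g. averaged N1 \<sigma> j g \<and> g \<in> c00 \<and> (\<forall>i. g i \<in> \<rat> \<and> \<bar>g i\<bar> \<le> 1)) j fs" for j fs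
    using avg that unfolding special_def by blast
next
  fix f g assume f: "f \<in> c00 \<and> (\<forall>i. f i \<in> \<rat> \<and> \<bar>f i\<bar> \<le> 1)" and g: "g \<in> c00" "vabs g = vabs f"
  have "g i \<in> \<rat> \<and> \<bar>g i\<bar> \<le> 1" for i
    using f fun_cong [OF g(2), of i] by (auto simp: vabs_def abs_eq_iff)
  then show "g \<in> c00 \<and> (\<forall>i. g i \<in> \<rat> \<and> \<bar>g i\<bar> \<le> 1)" using g by blast
next
  fix f E assume f: "f \<in> c00 \<and> (\<forall>i. f i \<in> \<rat> \<and> \<bar>f i\<bar> \<le> 1)"
  then show "restr E f \<in> c00 \<and> (\<forall>i. restr E f i \<in> \<rat> \<and> \<bar>restr E f i\<bar> \<le> 1)"
    using c00_subset [of f "restr E f"] by (simp add: restr_def)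
next
  fix f F assume f: "f \<in> c00 \<and> (\<forall>i. f i \<in> \<rat> \<and> \<bar>f i\<bar> \<le> 1)"
  have "\<bar>f i\<bar> \<le> 2" for i
    using f by (metis order_trans one_le_numeral)
  with f show "(\<lambda>i. 1 / 2 * S_op F f i) \<in> c00 \<and>
      (\<forall>i. 1 / 2 * S_op F f i \<in> \<rat> \<and> \<bar>1 / 2 * S_op F f i\<bar> \<le> 1)"
    using c00_subset [of f "\<lambda>i. 1 / 2 * S_op F f i"] by (simp add: restr_def S_op_def)
qed (auto simp: unit_vec_def c00_def supp_def)

lemma W_c00: "W N1 \<sigma> f \<Longrightarrow> f \<in> c00"
  using W_basic(1) by blast

lemma averaged_imp:
  assumes "averaged N1 \<sigma> p g"
  obtains fs where "successive fs" "length fs = n_seq p" "2 \<le> p" "\<forall>f\<in>set fs. W N1 \<sigma> f"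
    "g = average p fs" "odd p \<Longrightarrow> special N1 \<sigma> (averaged N1 \<sigma>) (p div 2) fs"
  using assms
proof (cases rule: averaged.cases)
  case (delta j fs)
  then show ?thesis by (intro that [of fs]) auto
next
  case (epsilon j fs)
  then have "successive fs" "length fs = n_seq (2 * j + 1)"
    unfolding special_def by blast+
  with epsilon show ?thesis by (intro that [of fs]) auto
qed

text \<open>Sign changes, restrictions and the operation (zeta) never increase \<open>\<bar>f\<bar>\<close>, so only unit
  vectors and averages matter for upper bounds.\<close>

lemma W_dominated:
  shows "W N1 \<sigma> f \<Longrightarrow> (\<exists>n\<ge>1. \<forall>i. \<bar>f i\<bar> \<le> \<bar>unit_vec n i\<bar>) \<or>
      (\<exists>p g. averaged N1 \<sigma> p g \<and> (\<forall>i. \<bar>f i\<bar> \<le> \<bar>g i\<bar>))"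
    and "averaged N1 \<sigma> j g \<Longrightarrow> True"
proof (induction rule: W_averaged.inducts)
  case (alpha f g)
  have "\<bar>g i\<bar> = \<bar>f i\<bar>" for i
    using fun_cong [OF \<open>vabs g = vabs f\<close>, of i] by (simp add: vabs_def)
  then show ?case using alpha by simp
next
  case (gamma f E)
  have "\<bar>restr E f i\<bar> \<le> \<bar>f i\<bar>" for i
    by (simp add: restr_def)
  then show ?case using gamma by (meson order_trans)
next
  case (zeta f F q)
  have "\<bar>1 / 2 * S_op F f i\<bar> \<le> \<bar>f i\<bar>" for i
    by (simp add: restr_def S_op_def)
  then show ?case using zeta by (meson order_trans)
next
  case (averaged_in_W j g)
  then show ?case by blast
qed (auto)

lemma ap_unit_vec: "ap (unit_vec n) z = \<bar>z n\<bar>"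
proof -
  have "supp (unit_vec n) = {n}" by (auto simp: supp_def unit_vec_def)
  then show ?thesis by (simp add: ap_def unit_vec_def)
qed

lemma W_ap_cases [consumes 1]:
  assumes "W N1 \<sigma> f"
  obtains (unit) n where "1 \<le> n" "\<And>z. ap f z \<le> ap (unit_vec n) z"
  | (avg) p g where "averaged N1 \<sigma> p g" "\<And>z. ap f z \<le> ap g z"
proof -
  have fin: "finite (supp (unit_vec n))" for n
    by (auto simp: supp_def unit_vec_def)
  from W_dominated(1) [OF assms] show ?thesis
  proof (elim disjE exE conjE)
    fix n assume "1 \<le> n" "\<forall>i. \<bar>f i\<bar> \<le> \<bar>unit_vec n i\<bar>"
    then show ?thesis
      by (intro unit [of n] ap_mono fin) auto
  next
    fix p g assume g: "averaged N1 \<sigma> p g" "\<forall>i. \<bar>f i\<bar> \<le> \<bar>g i\<bar>"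
    then have "finite (supp g)"
      using W_basic(2) [OF g(1)] by (simp add: c00_def)
    with g show ?thesis
      by (intro avg [of p g] ap_mono) auto
  qed
qed

lemma admits_weight_ap:
  assumes "admits_weight (averaged N1 \<sigma>) p f"
  obtains g where "averaged N1 \<sigma> p g" "\<And>z. ap f z \<le> ap g z"
proof -
  obtain g E where g: "averaged N1 \<sigma> p g" "vabs f = vabs (restr E g)"
    using assms unfolding admits_weight_def by blast
  have "\<bar>f i\<bar> \<le> \<bar>g i\<bar>" for i
    using fun_cong [OF g(2), of i] by (auto simp: vabs_def restr_def split: if_splits)
  moreover have "finite (supp g)"
    using W_basic(2) [OF g(1)] by (simp add: c00_def)
  ultimately show ?thesis
    by (intro that [OF g(1)] ap_mono) auto
qed

text \<open>Zero vectors are allowed, unlike in \<open>successive\<close>, since the truncated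
  images to which this is applied may vanish.\<close>

definition blocks :: "nat set \<Rightarrow> (nat \<Rightarrow> nat \<Rightarrow> real) \<Rightarrow> bool" where
  "blocks J z \<longleftrightarrow> (\<forall>i\<in>J. \<forall>i'\<in>J. i < i' \<longrightarrow> (\<forall>a\<in>supp (z i). \<forall>b\<in>supp (z i'). a < b))"

lemma blocks_subset: "blocks J z \<Longrightarrow> J' \<subseteq> J \<Longrightarrow> blocks J' z"
  unfolding blocks_def by blast

lemma averaged_split:
  assumes g: "averaged N1 \<sigma> p g" and J: "finite J" and z: "blocks J z"
    and C: "\<And>f i. W N1 \<sigma> f \<Longrightarrow> i \<in> J \<Longrightarrow> ap f (z i) \<le> C" "0 \<le> C"
  obtains h Js where "\<And>s. s < n_seq p \<Longrightarrow> W N1 \<sigma> (h s)" "\<And>s. Js s \<subseteq> J"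
    "(\<Sum>s<n_seq p. card (Js s)) \<le> card J"
    "ap g (vsum z J) \<le> (1 / real (m_seq p)) * (\<Sum>s<n_seq p. C + ap (h s) (vsum z (Js s)))"
proof -
  obtain fs where fs: "successive fs" "length fs = n_seq p" "\<forall>f\<in>set fs. W N1 \<sigma> f" "g = average p fs"
    using g by (rule averaged_imp)
  obtain Js where Js: "\<And>s. Js s \<subseteq> J" "(\<Sum>s<length fs. card (Js s)) \<le> card J"
    "\<And>s. s < length fs \<Longrightarrow> ap (fs ! s) (vsum z J) \<le> C + ap (fs ! s) (vsum z (Js s))"
  proof (rule split_successive [OF fs(1), of J z C])
    show "a < b" if "i \<in> J" "i' \<in> J" "i < i'" "a \<in> supp (z i)" "b \<in> supp (z i')" for i i' a b
      using z that unfolding blocks_def by blast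
    show "ap (fs ! s) (z i) \<le> C" if "s < length fs" "i \<in> J" for s i
      using C(1) fs(3) that by simp
  qed (use C J in auto)
  have "ap g (vsum z J) \<le> (1 / real (m_seq p)) * (\<Sum>s<n_seq p. C + ap (fs ! s) (vsum z (Js s)))"
    unfolding fs(4) ap_average [OF fs(1)] fs(2) [symmetric]
    using Js(3) by (intro mult_left_mono sum_mono) auto
  with Js fs(2,3) show ?thesis
    by (intro that [of "\<lambda>s. fs ! s" Js]) auto
qed

lemma unit_vec_vsum:
  assumes "finite J" "blocks J z" "\<And>i. i \<in> J \<Longrightarrow> ap (unit_vec n) (z i) \<le> C" "0 \<le> C"
  shows "ap (unit_vec n) (vsum z J) \<le> C"
proof (cases "\<exists>i\<in>J. z i n \<noteq> 0")
  case True
  then obtain i where i: "i \<in> J" "z i n \<noteq> 0" by blast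
  have "z i' n = 0" if "i' \<in> J - {i}" for i'
    using assms(2) i that unfolding blocks_def supp_def
    by (cases i i' rule: linorder_cases) blast+
  then have "vsum z J n = z i n"
    unfolding vsum_def using assms(1) i by (simp add: sum.remove)
  then show ?thesis
    using assms(3) [OF i(1)] by (simp add: ap_unit_vec)
qed (use assms(4) in \<open>simp add: ap_unit_vec vsum_def\<close>)

text \<open>An average of weight less than \<open>m\<^sub>q\<close> halves the sum at least, at the cost of splitting at
  most \<open>n\<^bsub>q-1\<^esub>\<close> of the vectors.  Iterating this \<open>d\<close> times replaces the
  usual tree analysis of functionals.\<close>

lemma tree_estimate:
  fixes C \<kappa> \<delta> :: real
  assumes q: "2 \<le> q" and J: "finite J" and z: "blocks J z"
    and C: "0 \<le> C" and \<kappa>: "1 \<le> \<kappa>" and \<delta>: "0 \<le> \<delta>"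
    and bound: "\<And>f i. W N1 \<sigma> f \<Longrightarrow> i \<in> J \<Longrightarrow> ap f (z i) \<le> C"
    and heavy: "\<And>p g J'. q \<le> p \<Longrightarrow> averaged N1 \<sigma> p g \<Longrightarrow> J' \<subseteq> J \<Longrightarrow>
      ap g (vsum z J') \<le> C * (\<kappa> + \<delta> * card J')"
    and f: "W N1 \<sigma> f" and J': "J' \<subseteq> J"
  shows "ap f (vsum z J') \<le> C * (real (n_seq (q - 1)) ^ d * \<kappa> + ((1 / 2) ^ d + \<delta>) * card J')"
  using f J'
proof (induction d arbitrary: f J')
  case 0
  have "ap f (vsum z J') \<le> (\<Sum>k\<in>J'. ap f (z k))"
    by (rule ap_vsum_le)
  also have "\<dots> \<le> (\<Sum>k\<in>J'. C)"
    using bound 0 by (intro sum_mono) auto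
  also have "\<dots> = C * card J'" by simp
  also have "\<dots> \<le> C * (\<kappa> + (1 + \<delta>) * card J')"
    using C \<kappa> mult_nonneg_nonneg [OF \<delta> of_nat_0_le_iff [of "card J'"]]
    by (intro mult_left_mono) (simp_all add: distrib_right)
  finally show ?case by simp
next
  case (Suc d)
  let ?M = "real (n_seq (q - 1))"
  have M: "4 \<le> ?M"
    using n_seq_ge_4 [of "q - 1"] q by simp
  have fin: "finite J'"
    using Suc.prems J finite_subset by blast
  have blk: "blocks J' z"
    using blocks_subset [OF z Suc.prems(2)] .
  have M1: "1 \<le> ?M ^ Suc d" "1 \<le> ?M ^ d"
    using M by (intro one_le_power; simp)+
  have Mk: "\<kappa> \<le> ?M ^ Suc d * \<kappa>" "1 \<le> ?M ^ d * \<kappa>"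
    using mult_mono [OF M1(1) order_refl [of \<kappa>]] mult_mono [OF M1(2) \<kappa>] \<kappa> M by simp_all
  have base: "C * (\<kappa> + \<delta> * card J') \<le> C * (?M ^ Suc d * \<kappa> + ((1 / 2) ^ Suc d + \<delta>) * card J')"
    using C Mk by (intro mult_left_mono add_mono mult_right_mono) auto
  show ?case
    using \<open>W N1 \<sigma> f\<close>
  proof (cases rule: W_ap_cases)
    case (unit n)
    have "ap (unit_vec n) (vsum z J') \<le> C"
      using unit(1) Suc.prems(2) by (intro unit_vec_vsum fin blk C bound beta_pos) auto
    also have "\<dots> \<le> C * (\<kappa> + \<delta> * card J')"
      using C \<kappa> \<delta> mult_left_mono [of 1 "\<kappa> + \<delta> * card J'" C] by (simp add: add_increasing2)
    finally show ?thesis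
      using unit(2) [of "vsum z J'"] base by linarith
  next
    case (avg p g)
    show ?thesis
    proof (cases "q \<le> p")
      case True
      then show ?thesis
        using heavy [OF True avg(1) Suc.prems(2)] avg(2) [of "vsum z J'"] base by linarith
    next
      case False
      have p: "2 \<le> p" using avg(1) by (rule averaged_imp)
      obtain h Js where h: "\<And>s. s < n_seq p \<Longrightarrow> W N1 \<sigma> (h s)" "\<And>s. Js s \<subseteq> J'"
        "(\<Sum>s<n_seq p. card (Js s)) \<le> card J'"
        "ap g (vsum z J') \<le> (1 / real (m_seq p)) * (\<Sum>s<n_seq p. C + ap (h s) (vsum z (Js s)))"
        using averaged_split [OF avg(1) fin blk, of C] bound C Suc.prems(2) by blast
      have np: "real (n_seq p) \<le> ?M"
        using n_seq_mono [of p "q - 1"] p False by simp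
      have "(\<Sum>s<n_seq p. C + ap (h s) (vsum z (Js s))) \<le>
          (\<Sum>s<n_seq p. C + C * (?M ^ d * \<kappa> + ((1 / 2) ^ d + \<delta>) * card (Js s)))"
      proof (intro sum_mono add_left_mono Suc.IH)
        fix s assume "s \<in> {..<n_seq p}"
        then show "W N1 \<sigma> (h s)" using h(1) by simp
        show "Js s \<subseteq> J" using h(2) [of s] Suc.prems(2) by blast
      qed
      also have "\<dots> = C * (real (n_seq p) * (1 + ?M ^ d * \<kappa>) +
          ((1 / 2) ^ d + \<delta>) * (\<Sum>s<n_seq p. card (Js s)))"
        by (simp add: sum.distrib sum_distrib_left algebra_simps)
      \<comment> \<open>The 1 for the stray vector is absorbed by n_{q-1}^d \<kappa> \<ge> 1, which
        doubles that term. The factor 1/m_p \<le> 1/2 of the average undoes the doubling and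
        supplies the next power of 1/2.\<close>
      also have "\<dots> \<le> C * (?M * (?M ^ d * \<kappa> + ?M ^ d * \<kappa>) + ((1 / 2) ^ d + \<delta>) * card J')"
        using C \<delta> np h(3) Mk(2) \<kappa> M of_nat_mono [OF h(3), where 'a = real]
        by (intro mult_left_mono add_mono mult_mono) (auto simp del: of_nat_sum)
      finally have 1: "(\<Sum>s<n_seq p. C + ap (h s) (vsum z (Js s))) \<le>
          C * (2 * ?M ^ Suc d * \<kappa> + ((1 / 2) ^ d + \<delta>) * card J')" (is "?L \<le> ?R")
        by (simp add: algebra_simps)
      have "ap g (vsum z J') \<le> (1 / real (m_seq p)) * ?L" by (rule h(4))
      also have "\<dots> \<le> (1 / 2) * ?L"
        using m_seq_ge_2 [of p] p C by (intro mult_right_mono sum_nonneg add_nonneg_nonneg ap_nonneg)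
          (auto simp: divide_simps)
      also have "\<dots> \<le> (1 / 2) * ?R" using 1 by simp
      also have "\<dots> = C * (?M ^ Suc d * \<kappa> + ((1 / 2) ^ Suc d + \<delta> / 2) * card J')"
        by (simp add: algebra_simps)
      also have "\<dots> \<le> C * (?M ^ Suc d * \<kappa> + ((1 / 2) ^ Suc d + \<delta>) * card J')"
        using C \<delta> by (intro mult_left_mono add_mono mult_right_mono) auto
      finally show ?thesis
        using avg(2) [of "vsum z J'"] by linarith
    qed
  qed
qed

section \<open>Rapidly increasing sequences\<close>

text \<open>The numbers \<open>r i\<close> place the vectors relative to the weight m_p: those with
  \<open>p < r i\<close> get 1/m_p, and those followed by some \<open>i'\<close> with
  \<open>r i' \<le> p\<close> are too flat for it and get \<epsilon>. Only the last index with
  \<open>r i \<le> p\<close> escapes both and costs \<open>C\<close>.\<close>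

lemma ris_heavy:
  fixes C \<epsilon> :: real and r :: "nat \<Rightarrow> nat"
  assumes J: "finite J" and C: "0 \<le> C" and \<epsilon>: "0 \<le> \<epsilon>"
    and bound: "\<And>f i. W N1 \<sigma> f \<Longrightarrow> i \<in> J \<Longrightarrow> ap f (z i) \<le> C"
    and light: "\<And>p g i. averaged N1 \<sigma> p g \<Longrightarrow> i \<in> J \<Longrightarrow> p < r i \<Longrightarrow> ap g (z i) \<le> C / m_seq p"
    and small: "\<And>p g i i'. averaged N1 \<sigma> p g \<Longrightarrow> i \<in> J \<Longrightarrow> i' \<in> J \<Longrightarrow> i < i' \<Longrightarrow> r i' \<le> p \<Longrightarrow>
      ap g (z i) \<le> C * \<epsilon>"
    and g: "averaged N1 \<sigma> p g" and J': "J' \<subseteq> J"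
  shows "ap g (vsum z J') \<le> C * (1 + (1 / m_seq p + \<epsilon>) * card J')"
proof -
  let ?b = "C * (1 / m_seq p + \<epsilon>)"
  have fin: "finite J'" using J J' finite_subset by blast
  have b: "0 \<le> ?b" "C / m_seq p \<le> ?b" "C * \<epsilon> \<le> ?b"
    using C \<epsilon> by (simp_all add: distrib_left)
  have "ap g (vsum z J') \<le> (\<Sum>i\<in>J'. ap g (z i))"
    by (rule ap_vsum_le)
  also have "\<dots> \<le> C + (\<Sum>i\<in>J'. ?b)"
  proof (cases "{i \<in> J'. r i \<le> p} = {}")
    case True
    have "ap g (z i) \<le> ?b" if "i \<in> J'" for i
      using light [OF g, of i] that True J' b(2) by force
    then have "(\<Sum>i\<in>J'. ap g (z i)) \<le> (\<Sum>i\<in>J'. ?b)"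
      by (rule sum_mono)
    with C show ?thesis by linarith
  next
    case False
    define i0 where "i0 = Max {i \<in> J'. r i \<le> p}"
    have i0: "i0 \<in> J'" "r i0 \<le> p"
      using Max_in [of "{i \<in> J'. r i \<le> p}"] fin False unfolding i0_def by auto
    have "ap g (z i) \<le> ?b" if i: "i \<in> J' - {i0}" for i
    proof (cases "r i \<le> p")
      case True
      then have "i \<le> i0"
        unfolding i0_def using i fin by (intro Max_ge) auto
      then have "i < i0" using i by simp
      then have "ap g (z i) \<le> C * \<epsilon>"
        using small [OF g, of i i0] i i0 J' by auto
      with b(3) show ?thesis by linarith
    next
      case False
      then have "ap g (z i) \<le> C / m_seq p"
        using light [OF g, of i] i J' by auto
      with b(2) show ?thesis by linarith
    qed
    then have "(\<Sum>i\<in>J' - {i0}. ap g (z i)) \<le> (\<Sum>i\<in>J' - {i0}. ?b)"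
      by (rule sum_mono)
    also have "\<dots> \<le> (\<Sum>i\<in>J'. ?b)"
      using fin b(1) by (intro sum_mono2) auto
    moreover have "ap g (z i0) \<le> C"
      using bound [OF averaged_in_W [OF g]] i0 J' by auto
    ultimately show ?thesis
      using i0 fin by (simp add: sum.remove [of J' i0])
  qed
  also have "\<dots> = C * (1 + (1 / m_seq p + \<epsilon>) * card J')"
    by (simp add: algebra_simps)
  finally show ?thesis .
qed

text \<open>If n_p is at most \<open>card J\<close>, the stray vectors cost no more than the shares:
  both contribute at most \<open>C * card J\<close>, whence the 2. The gain over an arbitrary
  bounded vector is the factor 1/m_p for all these weights.\<close>

lemma l1_average_estimate:
  fixes C :: real
  assumes J: "finite J" "J \<noteq> {}" and z: "blocks J z" and C: "0 \<le> C"
    and bound: "\<And>f i. W N1 \<sigma> f \<Longrightarrow> i \<in> J \<Longrightarrow> ap f (z i) \<le> C"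
  shows "W N1 \<sigma> f \<Longrightarrow> ap f (\<lambda>i. 1 / card J * vsum z J i) \<le> C"
    and "averaged N1 \<sigma> p g \<Longrightarrow> n_seq p \<le> card J \<Longrightarrow>
      ap g (\<lambda>i. 1 / card J * vsum z J i) \<le> 2 * C / m_seq p"
proof -
  have N: "0 < card J" using J by (simp add: card_gt_0_iff)
  have sum: "ap f (vsum z J') \<le> C * card J'" if "W N1 \<sigma> f" "J' \<subseteq> J" for f J'
  proof -
    have "(\<Sum>i\<in>J'. ap f (z i)) \<le> (\<Sum>i\<in>J'. C)"
      using bound that by (intro sum_mono) auto
    with ap_vsum_le [of f z J'] show ?thesis by (simp add: mult.commute)
  qed
  show "ap f (\<lambda>i. 1 / card J * vsum z J i) \<le> C" if "W N1 \<sigma> f"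
    unfolding ap_scale using sum [OF that order_refl] N by (simp add: divide_simps)
  assume g: "averaged N1 \<sigma> p g" and p: "n_seq p \<le> card J"
  obtain h Js where h: "\<And>s. s < n_seq p \<Longrightarrow> W N1 \<sigma> (h s)" "\<And>s. Js s \<subseteq> J"
    "(\<Sum>s<n_seq p. card (Js s)) \<le> card J"
    "ap g (vsum z J) \<le> (1 / real (m_seq p)) * (\<Sum>s<n_seq p. C + ap (h s) (vsum z (Js s)))"
    using averaged_split [OF g J(1) z bound C] by blast
  have "(\<Sum>s<n_seq p. C + ap (h s) (vsum z (Js s))) \<le> (\<Sum>s<n_seq p. C + C * card (Js s))"
  proof (intro sum_mono add_left_mono sum)
    fix s assume "s \<in> {..<n_seq p}"
    then show "W N1 \<sigma> (h s)" "Js s \<subseteq> J" using h by auto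
  qed
  also have "\<dots> = C * n_seq p + C * (\<Sum>s<n_seq p. card (Js s))"
    by (simp add: sum.distrib sum_distrib_left)
  also have "\<dots> \<le> C * card J + C * card J"
    using h(3) p C by (intro add_mono mult_left_mono of_nat_mono)
  finally have "(1 / real (m_seq p)) * (\<Sum>s<n_seq p. C + ap (h s) (vsum z (Js s))) \<le>
      (1 / real (m_seq p)) * (2 * C * card J)"
    by (intro mult_left_mono) auto
  with h(4) have "ap g (vsum z J) \<le> (1 / real (m_seq p)) * (2 * C * card J)" by linarith
  then have "1 / card J * ap g (vsum z J) \<le> 1 / card J * ((1 / real (m_seq p)) * (2 * C * card J))"
    by (intro mult_left_mono) auto
  then show "ap g (\<lambda>i. 1 / card J * vsum z J i) \<le> 2 * C / m_seq p"
    unfolding ap_scale using N by (simp add: abs_of_nonneg)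
qed

text \<open>The basic inequality. With the scaling m_j / n_j, functionals of weight m_j can be of
  order 1 on \<open>v\<close>, and all other weights see much less: lighter ones gain their own
  factor 1/m_p, heavier ones gain 1/m_j because m_p \<ge> m_j^2.\<close>

lemma ris_average:
  fixes C :: real and r :: "nat \<Rightarrow> nat"
  assumes j: "2 \<le> j" and J: "finite J" "card J \<le> n_seq j" and z: "blocks J z" and C: "0 \<le> C"
    and bound: "\<And>f i. W N1 \<sigma> f \<Longrightarrow> i \<in> J \<Longrightarrow> ap f (z i) \<le> C"
    and light: "\<And>p g i. averaged N1 \<sigma> p g \<Longrightarrow> i \<in> J \<Longrightarrow> p < r i \<Longrightarrow> ap g (z i) \<le> C / m_seq p"
    and small: "\<And>p g i i'. averaged N1 \<sigma> p g \<Longrightarrow> i \<in> J \<Longrightarrow> i' \<in> J \<Longrightarrow> i < i' \<Longrightarrow> r i' \<le> p \<Longrightarrow>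
      ap g (z i) \<le> C * (1 / m_seq j ^ 2)"
  defines "v \<equiv> \<lambda>i. real (m_seq j) / n_seq j * vsum z J i"
  shows "averaged N1 \<sigma> p g \<Longrightarrow> p < j \<Longrightarrow> ap g v \<le> 5 * C / m_seq p"
    and "averaged N1 \<sigma> p g \<Longrightarrow> j < p \<Longrightarrow> ap g v \<le> 5 * C / m_seq j"
    and "W N1 \<sigma> f \<Longrightarrow> ap f v \<le> 5 * C"
proof -
  let ?m = "real (m_seq j)" and ?n = "real (n_seq j)" and ?M = "real (n_seq (j - 1))"
  have m: "2 \<le> ?m" using m_seq_ge_2 [of j] j by simp
  have mn: "?m ^ 3 \<le> ?n"
    using m_seq_cube_le_n_seq [OF j] by (metis of_nat_mono of_nat_power)
  have "?m * 1 \<le> ?m * ?m" using m by (intro mult_left_mono) auto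
  moreover have "?m * ?m * 1 \<le> ?m * ?m * ?m" using m by (intro mult_left_mono) auto
  ultimately have m2: "?m \<le> ?m\<^sup>2" "?m\<^sup>2 \<le> ?m ^ 3" by (simp_all add: power2_eq_square power3_eq_cube)
  have n: "0 < ?n" using mn m2 m by linarith
  have ap_v: "ap f v = ?m / ?n * ap f (vsum z J)" for f
    unfolding v_def ap_scale by simp
  have heavy: "ap g (vsum z J') \<le> C * (1 + (1 / m_seq p + 1 / ?m\<^sup>2) * card J')"
    if "averaged N1 \<sigma> p g" "J' \<subseteq> J" for p g J'
    using ris_heavy [of J C "1 / ?m\<^sup>2" N1 \<sigma> z r] J(1) C bound light small that by force
  have heavy_v: "ap g v \<le> C * (?m / ?n + ?m / m_seq p + 1 / ?m)" if g: "averaged N1 \<sigma> p g" for p g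
  proof -
    have "ap g (vsum z J) \<le> C * (1 + (1 / m_seq p + 1 / ?m\<^sup>2) * card J)"
      by (rule heavy [OF g order_refl])
    also have "\<dots> \<le> C * (1 + (1 / m_seq p + 1 / ?m\<^sup>2) * ?n)"
      using C J(2) by (intro mult_left_mono add_left_mono) auto
    finally have "ap g v \<le> ?m / ?n * (C * (1 + (1 / m_seq p + 1 / ?m\<^sup>2) * ?n))"
      unfolding ap_v by (intro mult_left_mono) auto
    also have "\<dots> = C * (?m / ?n + ?m / m_seq p + 1 / ?m)"
      using n m by (simp add: field_simps power2_eq_square)
    finally show ?thesis .
  qed
  have m_n: "?m / ?n \<le> 1 / ?m"
  proof -
    have "?m * ?m \<le> ?n"
      using order_trans [OF m2(2) mn] by (simp only: power2_eq_square)
    then show ?thesis using n m by (simp add: field_simps)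
  qed
  \<comment> \<open>Splitting \<open>g\<close> once yields the factor 1/m_p; the tree estimate then
    bounds the constituents. The 5 is 2 + 3: the powers of n_{j-1} give 2, and 3/m_j comes from the
    halving error 1/m_j^2 and the 2/m_j for weights from m_j on.\<close>
  have light_v: "ap g v \<le> 5 * C / m_seq p" if g: "averaged N1 \<sigma> p g" and p: "p < j" for p g
  proof -
    obtain d where d: "2 ^ d = m_seq j ^ 2" "m_seq j ^ 3 * n_seq (j - 1) ^ (d + 1) \<le> n_seq j"
      using j by (rule n_seq_growth)
    have "(2::real) ^ d = real (2 ^ d)" by simp
    also have "\<dots> = ?m\<^sup>2" using d(1) by simp
    finally have d1: "(1 / 2) ^ d = 1 / ?m\<^sup>2"
      by (simp add: power_one_over)
    have d2: "?m ^ 3 * ?M ^ (d + 1) \<le> ?n"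
      using d(2) by (metis of_nat_mono of_nat_power of_nat_mult)
    have 1: "1 / ?m\<^sup>2 \<le> 1 / ?m"
      using m m2 by (intro divide_left_mono) auto
    have heavy': "ap g (vsum z J') \<le> C * (1 + (2 / ?m) * card J')"
      if q: "j \<le> q" and g: "averaged N1 \<sigma> q g" and J': "J' \<subseteq> J" for q g J'
    proof -
      have "?m \<le> m_seq q"
        using m_seq_mono [of j q] q j by simp
      then have "1 / m_seq q \<le> 1 / ?m"
        using m by (intro divide_left_mono) auto
      then have "1 / m_seq q + 1 / ?m\<^sup>2 \<le> 2 / ?m" using 1 by simp
      then have "C * (1 + (1 / m_seq q + 1 / ?m\<^sup>2) * card J') \<le> C * (1 + (2 / ?m) * card J')"
        using C by (intro mult_left_mono add_left_mono mult_right_mono) auto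
      with heavy [OF g J'] show ?thesis by linarith
    qed
    have tree: "ap f (vsum z J') \<le> C * (?M ^ d + (3 / ?m) * card J')" if "W N1 \<sigma> f" "J' \<subseteq> J" for f J'
    proof -
      have "ap f (vsum z J') \<le> C * (?M ^ d * 1 + ((1 / 2) ^ d + 2 / ?m) * card J')"
        using m by (intro tree_estimate [OF j J(1) z C _ _ bound heavy' that]) auto
      also have "\<dots> \<le> C * (?M ^ d + (3 / ?m) * card J')"
        unfolding d1 using 1 C by (intro mult_left_mono add_mono mult_right_mono) auto
      finally show ?thesis .
    qed
    have p2: "2 \<le> p" using g by (rule averaged_imp)
    obtain h Js where h: "\<And>s. s < n_seq p \<Longrightarrow> W N1 \<sigma> (h s)" "\<And>s. Js s \<subseteq> J"
      "(\<Sum>s<n_seq p. card (Js s)) \<le> card J"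
      "ap g (vsum z J) \<le> (1 / real (m_seq p)) * (\<Sum>s<n_seq p. C + ap (h s) (vsum z (Js s)))"
      using averaged_split [OF g J(1) z bound C] by blast
    have np: "real (n_seq p) \<le> ?M"
      using n_seq_mono [of p "j - 1"] p p2 by simp
    have M: "1 \<le> ?M ^ d"
      using n_seq_ge_4 [of "j - 1"] j by (intro one_le_power) linarith
    have "(\<Sum>s<n_seq p. C + ap (h s) (vsum z (Js s))) \<le>
        (\<Sum>s<n_seq p. C + C * (?M ^ d + (3 / ?m) * card (Js s)))"
    proof (intro sum_mono add_left_mono tree)
      fix s assume "s \<in> {..<n_seq p}"
      then show "W N1 \<sigma> (h s)" "Js s \<subseteq> J" using h by auto
    qed
    also have "\<dots> = C * (n_seq p * (1 + ?M ^ d) + (3 / ?m) * (\<Sum>s<n_seq p. card (Js s)))"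
      by (simp add: sum.distrib sum_distrib_left algebra_simps)
    also have "\<dots> \<le> C * (?M * (?M ^ d + ?M ^ d) + (3 / ?m) * ?n)"
    proof (intro mult_left_mono add_mono mult_mono C)
      show "real (\<Sum>s<n_seq p. card (Js s)) \<le> ?n"
        using h(3) J(2) by (meson of_nat_mono order_trans)
    qed (use np M m in auto)
    also have "?M * (?M ^ d + ?M ^ d) = 2 * ?M ^ (d + 1)" by simp
    also have "\<dots> \<le> 2 * (?n / ?m)"
    proof -
      have "?m * ?M ^ (d + 1) \<le> ?m ^ 3 * ?M ^ (d + 1)"
        by (intro mult_right_mono order_trans [OF m2]) simp
      with d2 have "?m * ?M ^ (d + 1) \<le> ?n" by linarith
      then show ?thesis using m by (simp add: field_simps)
    qed
    finally have "(\<Sum>s<n_seq p. C + ap (h s) (vsum z (Js s))) \<le> C * (2 * (?n / ?m) + (3 / ?m) * ?n)"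
      using C by (simp add: mult_left_mono)
    also have "\<dots> = 5 * C * (?n / ?m)" by (simp add: algebra_simps)
    finally have "(1 / real (m_seq p)) * (\<Sum>s<n_seq p. C + ap (h s) (vsum z (Js s))) \<le>
        (1 / real (m_seq p)) * (5 * C * (?n / ?m))"
      by (intro mult_left_mono) auto
    with h(4) have "ap g (vsum z J) \<le> (1 / real (m_seq p)) * (5 * C * (?n / ?m))" by linarith
    then have "ap g v \<le> ?m / ?n * ((1 / real (m_seq p)) * (5 * C * (?n / ?m)))"
      unfolding ap_v by (intro mult_left_mono) auto
    also have "\<dots> = 5 * C / m_seq p"
      using n m by (simp add: field_simps)
    finally show ?thesis .
  qed
  have heavy_v': "ap g v \<le> 5 * C / m_seq j" if g: "averaged N1 \<sigma> p g" and p: "j < p" for p g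
  proof -
    have "?m * ?m \<le> m_seq p"
      using m_seq_square_le [of j p] p j by (metis of_nat_mono of_nat_mult power2_eq_square le_trans one_le_numeral)
    then have "?m / m_seq p \<le> 1 / ?m"
      using m m_seq_pos [of p] by (simp add: field_simps)
    moreover have "0 \<le> 1 / ?m" "5 / ?m = 5 * (1 / ?m)" by simp_all
    ultimately have "?m / ?n + ?m / m_seq p + 1 / ?m \<le> 5 / ?m"
      using m_n by linarith
    then have "C * (?m / ?n + ?m / m_seq p + 1 / ?m) \<le> C * (5 / ?m)"
      using C by (rule mult_left_mono)
    with heavy_v [OF g] show ?thesis by (simp add: mult.commute)
  qed
  have eq_v: "ap g v \<le> 5 * C" if g: "averaged N1 \<sigma> j g" for g
  proof -
    have "1 / ?m \<le> 1" "?m / m_seq j = 1" using m by simp_all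
    then have "?m / ?n + ?m / m_seq j + 1 / ?m \<le> 5"
      using m_n by linarith
    then have "C * (?m / ?n + ?m / m_seq j + 1 / ?m) \<le> C * 5"
      using C by (rule mult_left_mono)
    with heavy_v [OF g] show ?thesis by simp
  qed
  have div: "5 * C / m_seq p \<le> 5 * C" for p
  proof -
    have "5 * C / m_seq p \<le> 5 * C / 1"
      using C m_seq_pos [of p] by (intro divide_left_mono) auto
    then show ?thesis by simp
  qed
  show "averaged N1 \<sigma> p g \<Longrightarrow> p < j \<Longrightarrow> ap g v \<le> 5 * C / m_seq p"
    and "averaged N1 \<sigma> p g \<Longrightarrow> j < p \<Longrightarrow> ap g v \<le> 5 * C / m_seq j"
    by (fact light_v heavy_v')+
  assume "W N1 \<sigma> f"
  then show "ap f v \<le> 5 * C"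
  proof (cases rule: W_ap_cases)
    case (unit n)
    have "ap (unit_vec n) (vsum z J) \<le> C"
      using unit(1) by (intro unit_vec_vsum J z C bound beta_pos) auto
    then have "ap f (vsum z J) \<le> C"
      using unit(2) [of "vsum z J"] by linarith
    moreover have "?m / ?n \<le> 1"
      using order_trans [OF m2(1) order_trans [OF m2(2) mn]] n by (subst divide_le_eq_1) simp
    ultimately have "?m / ?n * ap f (vsum z J) \<le> 1 * C"
      by (intro mult_mono ap_nonneg) auto
    then show ?thesis unfolding ap_v using C by simp
  next
    case (avg p g)
    have "ap g v \<le> 5 * C"
      using light_v [OF avg(1)] heavy_v' [OF avg(1)] eq_v [of g] avg(1) div [of p] div [of j]
      by (cases p j rule: linorder_cases) force+
    with avg(2) [of v] show ?thesis by linarith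
  qed
qed

section \<open>Special sequences\<close>

lemma supp_vabs: "supp (vabs f) = supp f"
  by (simp add: supp_def vabs_def)

lemma supp_imp_pos: "f \<in> c00 \<Longrightarrow> i \<in> supp f \<Longrightarrow> 1 \<le> i"
  by (cases i) (auto simp: c00_def supp_def)

lemma coding_domain_take:
  assumes fs: "successive fs" "\<forall>f\<in>set fs. W N1 \<sigma> f" and i: "0 < i" "i \<le> length fs"
  shows "map vabs (take i fs) \<in> coding_domain"
proof -
  have "successive (map vabs (take i fs))"
  proof (rule successiveI)
    fix s assume s: "s < length (map vabs (take i fs))"
    then show "map vabs (take i fs) ! s \<in> c00" "supp (map vabs (take i fs) ! s) \<noteq> {}"
      using successive_nth [OF fs(1), of s] by (auto simp: supp_vabs c00_def) (simp add: vabs_def)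
  next
    fix s s' a b assume "s < s'" "s' < length (map vabs (take i fs))"
      "a \<in> supp (map vabs (take i fs) ! s)" "b \<in> supp (map vabs (take i fs) ! s')"
    then show "a < b"
      using successive_less [OF fs(1), of s s' a b] by (simp add: supp_vabs)
  qed
  moreover have "\<forall>\<phi>\<in>set (map vabs (take i fs)). \<forall>l. \<phi> l \<in> \<rat> \<and> 0 \<le> \<phi> l"
  proof (intro ballI)
    fix \<phi> assume "\<phi> \<in> set (map vabs (take i fs))"
    then obtain f where "f \<in> set fs" "\<phi> = vabs f" by (auto dest: in_set_takeD)
    then show "\<forall>l. \<phi> l \<in> \<rat> \<and> 0 \<le> \<phi> l"
      using W_basic(1) [of N1 \<sigma> f] fs(2) by (auto simp: vabs_def abs_if)
  qed
  ultimately show ?thesis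
    using i unfolding coding_domain_def by auto
qed

text \<open>Coordinates of an average of weight m_p are at most 1/m_p, so the reciprocals in the
  growth condition on \<sigma> are at least m_p. Consequently the weights of a sequence built by the
  coding increase by themselves.\<close>

lemma coding_growth:
  assumes \<sigma>: "coding_function N2 \<sigma>" and \<phi>s: "\<phi>s \<in> coding_domain" "last \<phi>s = vabs f"
    and f: "averaged N1 \<sigma> p f"
  shows "m_seq p < m_seq (2 * \<sigma> \<phi>s)"
proof -
  obtain fs where fs: "successive fs" "\<forall>f\<in>set fs. W N1 \<sigma> f" "f = average p fs"
    using f by (rule averaged_imp)
  have le: "\<bar>f i\<bar> \<le> 1 / m_seq p" for i
    unfolding fs(3) using fs(2) W_basic(1) by (intro abs_average_le fs(1)) blast
  have ne: "supp (last \<phi>s) \<noteq> {}" and fin: "finite (supp (last \<phi>s))"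
    using \<phi>s(1) unfolding coding_domain_def successive_def c00_def by auto
  then obtain l where l: "l \<in> supp (last \<phi>s)" by blast
  have l1: "1 \<le> l"
    using l \<phi>s(1) by (intro supp_imp_pos [of "last \<phi>s"]) (auto simp: coding_domain_def successive_def)
  have fl: "0 < \<bar>f l\<bar>"
    using l unfolding \<phi>s(2) by (simp add: supp_def vabs_def)
  have "real (m_seq p) \<le> 1 / \<bar>f l\<bar>"
    using le [of l] fl m_seq_pos [of p] by (simp add: field_simps)
  also have "\<dots> \<le> Max ((\<lambda>l. 1 / last \<phi>s l) ` supp (last \<phi>s))"
    using l fin by (intro Max_ge) (auto simp: \<phi>s(2) vabs_def)
  finally have p: "real (m_seq p) \<le> Max ((\<lambda>l. 1 / last \<phi>s l) ` supp (last \<phi>s))" .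
  also have "\<dots> \<le> real (Max (supp (last \<phi>s))) * Max ((\<lambda>l. 1 / last \<phi>s l) ` supp (last \<phi>s))"
  proof -
    have "l \<le> Max (supp (last \<phi>s))" using l fin by simp
    then have "1 \<le> real (Max (supp (last \<phi>s)))" using l1 by linarith
    moreover have "0 \<le> Max ((\<lambda>l. 1 / last \<phi>s l) ` supp (last \<phi>s))"
      by (rule order_trans [OF of_nat_0_le_iff p])
    ultimately show ?thesis by (simp add: mult_le_cancel_right1)
  qed
  also have "\<dots> < real (m_seq (2 * \<sigma> \<phi>s))"
    using \<sigma> \<phi>s(1) unfolding coding_function_def by blast
  finally show ?thesis by simp
qed

text \<open>The bound \<open>n_seq q ^ 2\<close> on the first weight is stronger than the n_q in the
  definition of special sequences. It lets every mismatched pair of a vector and a constituent after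
  the split contribute only C / n_q^2, so that all these pairs together stay within
  \<open>C\<close>.\<close>

locale special_family =
  fixes N1 N2 :: "nat set" and \<sigma> :: "(nat \<Rightarrow> real) list \<Rightarrow> nat"
    and k q :: nat and fs :: "(nat \<Rightarrow> real) list" and js :: "nat list"
  assumes N: "N1 \<union> N2 = {1..}" "N1 \<inter> N2 = {}" and \<sigma>: "coding_function N2 \<sigma>"
    and k: "1 \<le> k" and q: "q = 2 * k + 1"
    and fs: "successive fs" "length fs = n_seq q" "length js = n_seq q"
    and wt: "\<And>i. i < n_seq q \<Longrightarrow> averaged N1 \<sigma> (2 * js ! i) (fs ! i)"
    and js0: "js ! 0 \<in> N1" "n_seq q ^ 2 < m_seq (2 * js ! 0)"
    and js\<sigma>: "\<And>i. 0 < i \<Longrightarrow> i < n_seq q \<Longrightarrow> js ! i = \<sigma> (map vabs (take i fs))"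
begin

lemma n_q: "4 \<le> n_seq q"
  using n_seq_ge_4 [of q] q by simp

lemma fs_W: "\<forall>f\<in>set fs. W N1 \<sigma> f"
  using wt fs by (metis averaged_in_W in_set_conv_nth)

lemma js_pos: "i < n_seq q \<Longrightarrow> 1 \<le> js ! i"
  using wt [of i] by (rule averaged_imp) auto

lemma js_Suc: "Suc i < n_seq q \<Longrightarrow> js ! i < js ! Suc i"
proof -
  assume i: "Suc i < n_seq q"
  have "map vabs (take (Suc i) fs) \<in> coding_domain"
    using i fs by (intro coding_domain_take [OF fs(1) fs_W]) auto
  moreover have "last (map vabs (take (Suc i) fs)) = vabs (fs ! i)"
    using i fs by (simp add: take_Suc_conv_app_nth)
  ultimately have "m_seq (2 * js ! i) < m_seq (2 * \<sigma> (map vabs (take (Suc i) fs)))"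
    using wt [of i] i by (intro coding_growth [OF \<sigma>]) auto
  then have "m_seq (2 * js ! i) < m_seq (2 * js ! Suc i)"
    using js\<sigma> [of "Suc i"] i by simp
  then show ?thesis
    using m_seq_less_iff [of "2 * js ! i" "2 * js ! Suc i"] js_pos [of i] js_pos [of "Suc i"] i by simp
qed

lemma js_less: "i < i' \<Longrightarrow> i' < n_seq q \<Longrightarrow> js ! i < js ! i'"
proof (induction i' rule: less_induct)
  case (less i')
  then obtain l where l: "i' = Suc l" by (cases i') auto
  show ?case
    using less.IH [of l] js_Suc [of l] less.prems l by (cases "i = l") auto
qed

lemma js_big: "i < n_seq q \<Longrightarrow> n_seq q ^ 2 < m_seq (2 * js ! i)"
proof -
  assume i: "i < n_seq q"
  have "js ! 0 \<le> js ! i" using js_less [of 0 i] i by (cases "i = 0") auto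
  then have "m_seq (2 * js ! 0) \<le> m_seq (2 * js ! i)"
    using js_pos [of 0] i by (intro m_seq_mono) auto
  with js0(2) show ?thesis by linarith
qed

lemma special: "special N1 \<sigma> (averaged N1 \<sigma>) k fs"
proof -
  have "admits_weight (averaged N1 \<sigma>) (2 * js ! i) (fs ! i)" if "i < length fs" for i
    unfolding admits_weight_def
    using wt [of i] that fs by (intro exI [of _ "fs ! i"] exI [of _ UNIV]) (auto simp: nat_interval_def restr_def)
  moreover have "sorted_wrt (\<lambda>i j. m_seq (2 * i) < m_seq (2 * j)) js"
    unfolding sorted_wrt_iff_nth_less
    using js_less js_pos fs by (auto simp: m_seq_less_iff)
  moreover have "n_seq (2 * k + 1) < m_seq (2 * js ! 0)"
    using js0(2) n_q self_le_power [of "n_seq q" 2] unfolding q by linarith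
  ultimately show ?thesis
    unfolding special_def using fs js0(1) js\<sigma> q
    by (intro conjI exI [of _ js]) auto
qed

lemma average_W: "W N1 \<sigma> (average q fs)"
  using epsilon [OF k fs_W special] averaged_in_W q by metis

context
  fixes v :: "nat \<Rightarrow> nat \<Rightarrow> real" and C :: real
  assumes C: "0 \<le> C"
    and v: "blocks {..<n_seq q} v"
    and bound: "\<And>f i. W N1 \<sigma> f \<Longrightarrow> i < n_seq q \<Longrightarrow> ap f (v i) \<le> C"
    and light: "\<And>p g i. averaged N1 \<sigma> p g \<Longrightarrow> i < n_seq q \<Longrightarrow> p < 2 * js ! i \<Longrightarrow>
      ap g (v i) \<le> C / m_seq p"
    and heavy: "\<And>p g i. averaged N1 \<sigma> p g \<Longrightarrow> i < n_seq q \<Longrightarrow> 2 * js ! i < p \<Longrightarrow>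
      ap g (v i) \<le> C / m_seq (2 * js ! i)"
    and disj: "\<And>i i'. i < n_seq q \<Longrightarrow> i' < n_seq q \<Longrightarrow> supp (fs ! i) \<inter> supp (v i') = {}"
begin

text \<open>A special functional \<open>g\<close> agrees up to signs with the special sequence \<open>fs\<close> until they
  split; before the split it vanishes on the \<open>v i\<close>, and after it, by injectivity of the
  coding, its weights differ from all those of \<open>fs\<close>.\<close>

lemma special_estimate:
  assumes g: "averaged N1 \<sigma> q g" and J: "J \<subseteq> {..<n_seq q}"
  shows "ap g (vsum v J) \<le> 3 * C"
proof -
  let ?n = "real (n_seq q)"
  have n: "4 \<le> ?n" using n_q by simp
  have fin: "finite J" and cardJ: "card J \<le> n_seq q"
    using J finite_subset card_mono [OF _ J] by auto
  obtain gs where gs: "successive gs" "length gs = n_seq q" "\<forall>f\<in>set gs. W N1 \<sigma> f"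
    "g = average q gs" "special N1 \<sigma> (averaged N1 \<sigma>) k gs"
    using g by (rule averaged_imp) (auto simp: q)
  then obtain ls where ls: "length ls = n_seq q"
    "\<And>s. s < n_seq q \<Longrightarrow> admits_weight (averaged N1 \<sigma>) (2 * ls ! s) (gs ! s)"
    "n_seq q < m_seq (2 * ls ! 0)" "sorted_wrt (\<lambda>i j. m_seq (2 * i) < m_seq (2 * j)) ls"
    "ls ! 0 \<in> N1" "\<And>s. 0 < s \<Longrightarrow> s < n_seq q \<Longrightarrow> ls ! s = \<sigma> (map vabs (take s gs))"
    unfolding special_def q by auto
  have ls_pos: "1 \<le> ls ! s" if "s < n_seq q" for s
    using ls(2) [OF that] by (rule admits_weight_ap) (auto elim: averaged_imp)
  have ls_big: "n_seq q < m_seq (2 * ls ! s)" if "s < n_seq q" for s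
    using ls(3,4) ls(1) that unfolding sorted_wrt_iff_nth_less
    by (cases "s = 0") (auto dest: less_trans)
  \<comment> \<open>An arbitrary special sequence is only known to start above n_q. From its second
    term on, the relation m_p^2 \<le> m_p' for p < p' supplies the square.\<close>
  have ls_huge: "n_seq q ^ 2 < m_seq (2 * ls ! s)" if "0 < s" "s < n_seq q" for s
  proof -
    have "m_seq (2 * ls ! 0) < m_seq (2 * ls ! s)"
      using ls(1,4) that unfolding sorted_wrt_iff_nth_less by auto
    then have "2 * ls ! 0 < 2 * ls ! s"
      using ls_pos [of 0] ls_pos [of s] that by (subst (asm) m_seq_less_iff) auto
    then have "m_seq (2 * ls ! 0) ^ 2 \<le> m_seq (2 * ls ! s)"
      using ls_pos [of 0] that by (intro m_seq_square_le) auto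
    moreover have "n_seq q ^ 2 < m_seq (2 * ls ! 0) ^ 2"
      using ls(3) by (intro power_strict_mono) auto
    ultimately show ?thesis by linarith
  qed
  have div: "C / m \<le> C / l" if "0 < l" "l \<le> m" for l m :: real
    using that C by (intro divide_left_mono) auto
  have off: "ap (gs ! s) (v i) \<le> C / B"
    if s: "s < n_seq q" and i: "i < n_seq q" and ne: "ls ! s \<noteq> js ! i"
      and B: "0 < B" "B \<le> m_seq (2 * ls ! s)" "B \<le> m_seq (2 * js ! i)" for s i and B :: real
  proof -
    obtain h where h: "averaged N1 \<sigma> (2 * ls ! s) h" "\<And>z. ap (gs ! s) z \<le> ap h z"
      using ls(2) [OF s] by (rule admits_weight_ap) blast
    have "ap h (v i) \<le> C / m_seq (2 * ls ! s) \<or> ap h (v i) \<le> C / m_seq (2 * js ! i)"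
      using light [OF h(1) i] heavy [OF h(1) i] ne by (cases "ls ! s < js ! i") auto
    then show ?thesis
      using div [OF B(1,2)] div [OF B(1,3)] h(2) [of "v i"] by linarith
  qed
  \<comment> \<open>The first disagreement in modulus; the alternative \<open>s = n_seq q\<close>
    makes it exist when there is none.\<close>
  define s0 where "s0 = (LEAST s. s = n_seq q \<or> vabs (gs ! s) \<noteq> vabs (fs ! s))"
  have s0: "s0 = n_seq q \<or> vabs (gs ! s0) \<noteq> vabs (fs ! s0)"
    unfolding s0_def by (rule LeastI [of _ "n_seq q"]) simp
  have s0': "vabs (gs ! s) = vabs (fs ! s)" if "s < s0" for s
    using not_less_Least [of s "\<lambda>s. s = n_seq q \<or> vabs (gs ! s) \<noteq> vabs (fs ! s)"] that
    unfolding s0_def by blast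
  have before: "ap (gs ! s) (vsum v J) = 0" if s: "s < s0" "s < n_seq q" for s
  proof -
    have "supp (gs ! s) = supp (fs ! s)"
      using s0' [OF s(1)] supp_vabs by metis
    then have "ap (gs ! s) (v i) = 0" if "i \<in> J" for i
      using disj [of s i] s J that by (intro ap_disjoint) auto
    then show ?thesis
      using ap_vsum_le [of "gs ! s" v J] ap_nonneg [of "gs ! s" "vsum v J"] by simp
  qed
  have after: "ap (gs ! s) (vsum v J) \<le> C / ?n" if s: "s0 < s" "s < n_seq q" for s
  proof -
    \<comment> \<open>Equal codes come from equal initial segments, and these reach beyond
      \<open>s0\<close>, against the choice of \<open>s0\<close>. For \<open>i = 0\<close> there is
      no code to compare, but \<open>js ! 0\<close> lies in \<open>N1\<close> and all codes lie in
      \<open>N2\<close>.\<close>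
    have ne: "ls ! s \<noteq> js ! i" if i: "i < n_seq q" for i
    proof
      assume eq: "ls ! s = js ! i"
      have s\<sigma>: "ls ! s = \<sigma> (map vabs (take s gs))" "map vabs (take s gs) \<in> coding_domain"
        using ls(6) [of s] s gs(2) by (auto intro!: coding_domain_take [OF gs(1,3)])
      show False
      proof (cases "i = 0")
        case True
        have "ls ! s \<in> \<sigma> ` coding_domain" using s\<sigma> by simp
        then have "ls ! s \<in> N2" using \<sigma> unfolding coding_function_def by blast
        then show False
          using eq True js0(1) N(2) by auto
      next
        case False
        then have i\<sigma>: "js ! i = \<sigma> (map vabs (take i fs))" "map vabs (take i fs) \<in> coding_domain"
          using js\<sigma> [of i] i fs(2) by (auto intro!: coding_domain_take [OF fs(1) fs_W])
        then have same: "map vabs (take s gs) = map vabs (take i fs)"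
          using eq s\<sigma> \<sigma> unfolding coding_function_def by (metis inj_onD)
        have len: "s = i"
          using arg_cong [OF same, of length] s i gs(2) fs(2) by simp
        have "vabs (gs ! s0) = vabs (fs ! s0)"
          using arg_cong [OF same, of "\<lambda>xs. xs ! s0"] len s i gs(2) fs(2) by simp
        with s0 s show False by auto
      qed
    qed
    have "ap (gs ! s) (v i) \<le> C / ?n\<^sup>2" if "i \<in> J" for i
    proof (rule off [OF s(2) _ ne])
      show "i < n_seq q" "i < n_seq q" using J that by auto
      then show "?n\<^sup>2 \<le> m_seq (2 * js ! i)"
        using js_big [of i] by (metis less_imp_le of_nat_mono of_nat_power)
      show "?n\<^sup>2 \<le> m_seq (2 * ls ! s)"
        using ls_huge [of s] s by (metis less_imp_le of_nat_mono of_nat_power less_nat_zero_code neq0_conv)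
    qed (use n in auto)
    then have "(\<Sum>i\<in>J. ap (gs ! s) (v i)) \<le> (\<Sum>i\<in>J. C / ?n\<^sup>2)"
      by (rule sum_mono)
    also have "\<dots> = card J * (C / ?n\<^sup>2)" by simp
    also have "\<dots> \<le> ?n * (C / ?n\<^sup>2)"
      using cardJ C by (intro mult_right_mono) auto
    also have "\<dots> = C / ?n" using n by (simp add: power2_eq_square)
    finally show ?thesis using ap_vsum_le [of "gs ! s" v J] by linarith
  qed
  have at: "ap (gs ! s0) (vsum v J) \<le> 2 * C" if s: "s0 < n_seq q"
  proof -
    let ?D = "{i \<in> J. js ! i = ls ! s0}"
    have "card ?D \<le> 1"
    proof (rule ccontr)
      assume "\<not> ?thesis"
      then obtain i i' where "i \<in> ?D" "i' \<in> ?D" "i \<noteq> i'"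
        using fin by (metis (no_types, lifting) card_le_Suc0_iff_eq finite_Collect_conjI finite_subset mem_Collect_eq One_nat_def subsetI)
      then show False
        using js_less [of i i'] js_less [of i' i] J by (cases i i' rule: linorder_cases) auto
    qed
    then have D: "real (card ?D) * C \<le> 1 * C" using C by (intro mult_right_mono) auto
    have "ap (gs ! s0) (v i) \<le> (if i \<in> ?D then C else 0) + C / ?n" if i: "i \<in> J" for i
    proof (cases "i \<in> ?D")
      case True
      have "0 \<le> C / ?n" using C by simp
      then show ?thesis
        using True bound [of "gs ! s0" i] gs(2,3) s i J by auto
    next
      case False
      have "ap (gs ! s0) (v i) \<le> C / ?n"
      proof (rule off [OF s])
        show i': "i < n_seq q" "ls ! s0 \<noteq> js ! i" using i J False by auto
        show "?n \<le> m_seq (2 * ls ! s0)" using ls_big [OF s] by simp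
        have "n_seq q \<le> n_seq q ^ 2" using n_q by (intro self_le_power) auto
        then show "?n \<le> m_seq (2 * js ! i)" using js_big [OF i'(1)] by linarith
      qed (use n in auto)
      with False show ?thesis by auto
    qed
    then have "(\<Sum>i\<in>J. ap (gs ! s0) (v i)) \<le> (\<Sum>i\<in>J. (if i \<in> ?D then C else 0) + C / ?n)"
      by (rule sum_mono)
    also have "\<dots> = card ?D * C + card J * (C / ?n)"
      using fin by (simp add: sum.distrib sum.If_cases Int_def)
    also have "\<dots> \<le> C + ?n * (C / ?n)"
      using cardJ C D by (intro add_mono mult_right_mono) auto
    also have "\<dots> = 2 * C" using n by simp
    finally show ?thesis using ap_vsum_le [of "gs ! s0" v J] by linarith
  qed
  have Cn: "0 \<le> C / ?n" using C by simp
  have "(\<Sum>s<n_seq q. ap (gs ! s) (vsum v J)) \<le>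
      (\<Sum>s<n_seq q. (if s = s0 then 2 * C else 0) + C / ?n)"
  proof (rule sum_mono)
    fix s assume "s \<in> {..<n_seq q}"
    then show "ap (gs ! s) (vsum v J) \<le> (if s = s0 then 2 * C else 0) + C / ?n"
      using before [of s] after [of s] at Cn by (cases s s0 rule: linorder_cases) auto
  qed
  also have "\<dots> \<le> 2 * C + C"
    using n C by (simp add: sum.distrib)
  finally have "(1 / real (m_seq q)) * (\<Sum>s<n_seq q. ap (gs ! s) (vsum v J)) \<le> 1 * (3 * C)"
    using m_seq_pos [of q] C by (intro mult_mono sum_nonneg ap_nonneg) auto
  then show ?thesis
    unfolding gs(4) ap_average [OF gs(1)] gs(2) by simp
qed

text \<open>The tree estimate with \<kappa> = 3 and \<delta> = 1/m_q^2:
  \<open>special_estimate\<close> handles the weight m_q, while heavier weights are at least m_q^2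
  and meet a rapidly increasing sequence. The constants add up to 3 + 1 + 1. Treating m_q like the
  heavier weights would only give the order n_q / m_q.\<close>

lemma special_sum_estimate:
  assumes f: "W N1 \<sigma> f"
  shows "ap f (vsum v {..<n_seq q}) \<le> 5 * C * n_seq q / m_seq q ^ 2"
proof -
  let ?n = "real (n_seq q)" and ?m = "real (m_seq q)" and ?M = "real (n_seq (q - 1))"
  have q2: "2 \<le> q" using k q by simp
  have m: "2 \<le> ?m" using m_seq_ge_2 [of q] q by simp
  have n: "4 \<le> ?n" using n_q by simp
  have heavy_sum: "ap g (vsum v J) \<le> C * (3 + 1 / ?m\<^sup>2 * card J)"
    if p: "q \<le> p" and g: "averaged N1 \<sigma> p g" and J: "J \<subseteq> {..<n_seq q}" for p g J
  proof (cases "p = q")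
    case True
    have "3 * C \<le> C * (3 + 1 / ?m\<^sup>2 * card J)"
      using C by (simp add: algebra_simps)
    then show ?thesis
      using special_estimate [of g J] g J True by simp
  next
    case False
    have sm: "ap g (v i) \<le> C * (1 / ?n)"
      if g: "averaged N1 \<sigma> p g" and i: "i < n_seq q" "i' < n_seq q" "i < i'" "2 * js ! i' \<le> p" for p g i i'
    proof -
      have "2 * js ! i < p" using js_less [of i i'] i by simp
      then have "ap g (v i) \<le> C / m_seq (2 * js ! i)" by (rule heavy [OF g i(1)])
      also have "\<dots> \<le> C / ?n"
      proof (rule divide_left_mono)
        have "n_seq q \<le> n_seq q ^ 2" using n_q by (intro self_le_power) auto
        then show "?n \<le> m_seq (2 * js ! i)" using js_big [OF i(1)] by linarith
      qed (use C n m_seq_pos in auto)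
      finally show ?thesis by simp
    qed
    have "ap g (vsum v J) \<le> C * (1 + (1 / m_seq p + 1 / ?n) * card J)"
      using ris_heavy [of "{..<n_seq q}" C "1 / ?n" N1 \<sigma> v "\<lambda>i. 2 * js ! i" p g J]
        C bound light sm g J by force
    also have "\<dots> = C * (1 + (1 / m_seq p * card J + card J / ?n))"
      by (simp add: distrib_right)
    also have "\<dots> \<le> C * (3 + 1 / ?m\<^sup>2 * card J)"
    proof (rule mult_left_mono [OF _ C])
      have "m_seq q ^ 2 \<le> m_seq p"
        using m_seq_square_le [of q p] False p q by simp
      then have "?m\<^sup>2 \<le> m_seq p"
        by (metis of_nat_mono of_nat_power)
      then have "1 / m_seq p \<le> 1 / ?m\<^sup>2"
        using m m_seq_pos [of p] by (intro divide_left_mono mult_pos_pos) auto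
      then have "1 / m_seq p * card J \<le> 1 / ?m\<^sup>2 * card J"
        by (rule mult_right_mono) simp
      moreover have "card J / ?n \<le> 1"
        using card_mono [OF _ J] n by simp
      ultimately show "1 + (1 / m_seq p * card J + card J / ?n) \<le> 3 + 1 / ?m\<^sup>2 * card J"
        by linarith
    qed
    finally show ?thesis .
  qed
  obtain d where d: "2 ^ d = m_seq q ^ 2" "m_seq q ^ 3 * n_seq (q - 1) ^ (d + 1) \<le> n_seq q"
    using q2 by (rule n_seq_growth)
  have "(2::real) ^ d = real (2 ^ d)" by simp
  also have "\<dots> = ?m\<^sup>2" using d(1) by simp
  finally have d1: "(1 / 2) ^ d = 1 / ?m\<^sup>2"
    by (simp add: power_one_over)
  have "?m\<^sup>2 * ?M ^ d \<le> ?m ^ 3 * ?M ^ (d + 1)"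
    using m n_seq_ge_4 [of "q - 1", THEN order_trans [OF one_le_numeral]] q2
    by (intro mult_mono power_increasing) auto
  also have "\<dots> \<le> ?n"
    using d(2) by (metis of_nat_mono of_nat_power of_nat_mult)
  finally have d2: "?M ^ d \<le> ?n / ?m\<^sup>2"
    using m by (simp add: field_simps)
  have "ap f (vsum v {..<n_seq q}) \<le>
      C * (?M ^ d * 3 + ((1 / 2) ^ d + 1 / ?m\<^sup>2) * card {..<n_seq q})"
    by (rule tree_estimate [OF q2 _ v C _ _ bound heavy_sum f]) auto
  also have "\<dots> \<le> C * (?n / ?m\<^sup>2 * 3 + (1 / ?m\<^sup>2 + 1 / ?m\<^sup>2) * ?n)"
    unfolding d1 using C d2 by (intro mult_left_mono add_mono mult_right_mono) auto
  also have "\<dots> = 5 * C * ?n / ?m\<^sup>2" by (simp add: algebra_simps)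
  finally show ?thesis by simp
qed

end

end

section \<open>The norm and linear combinations\<close>

lemma pairing_le_ap: "pairing f z \<le> ap f z"
  unfolding pairing_def ap_def by (intro sum_mono) simp

lemma ap_eq_pairing:
  assumes "W N1 \<sigma> f"
  obtains g where "W N1 \<sigma> g" "pairing g z = ap f z"
proof -
  define g where "g i = (if f i * z i < 0 then - f i else f i)" for i
  have "vabs g = vabs f" by (auto simp: vabs_def g_def)
  moreover from this have supp: "supp g = supp f" by (metis supp_vabs)
  moreover have "g \<in> c00"
    using W_c00 [OF assms] supp by (auto simp: c00_def g_def)
  ultimately have "W N1 \<sigma> g" using alpha [OF assms] by blast
  moreover have "pairing g z = ap f z"
    unfolding pairing_def ap_def supp by (rule sum.cong) (auto simp: g_def)
  ultimately show ?thesis by (rule that)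
qed

lemma ap_le_l1:
  assumes "finite (supp z)" "\<And>i. \<bar>f i\<bar> \<le> B" "f \<in> c00"
  shows "ap f z \<le> B * (\<Sum>i\<in>supp z. \<bar>z i\<bar>)"
proof -
  have "ap f z = (\<Sum>i\<in>supp f \<inter> supp z. \<bar>f i * z i\<bar>)"
    unfolding ap_def using assms(3)
    by (intro sum.mono_neutral_right) (auto simp: c00_def supp_def)
  also have "\<dots> \<le> (\<Sum>i\<in>supp f \<inter> supp z. B * \<bar>z i\<bar>)"
    using assms(2) by (intro sum_mono) (simp add: abs_mult mult_right_mono)
  also have "\<dots> \<le> (\<Sum>i\<in>supp z. B * \<bar>z i\<bar>)"
    using assms(1,2) order_trans [OF abs_ge_zero assms(2)] by (intro sum_mono2) auto
  finally show ?thesis by (simp add: sum_distrib_left)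
qed

lemma W_ap_le_l1: "z \<in> c00 \<Longrightarrow> W N1 \<sigma> f \<Longrightarrow> ap f z \<le> (\<Sum>i\<in>supp z. \<bar>z i\<bar>)"
  using ap_le_l1 [of z f 1] W_basic(1) [of N1 \<sigma> f] by (simp add: c00_def)

lemma averaged_ap_le_l1:
  assumes "z \<in> c00" "averaged N1 \<sigma> p g"
  shows "ap g z \<le> (\<Sum>i\<in>supp z. \<bar>z i\<bar>) / m_seq p"
proof -
  obtain fs where fs: "successive fs" "\<forall>f\<in>set fs. W N1 \<sigma> f" "g = average p fs"
    using assms(2) by (rule averaged_imp)
  have "\<bar>g i\<bar> \<le> 1 / m_seq p" for i
    unfolding fs(3) using fs(2) W_basic(1) by (intro abs_average_le fs(1)) blast
  then show ?thesis
    using ap_le_l1 [of z g "1 / m_seq p"] assms W_basic(2) by (auto simp: c00_def)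
qed

lemma W_norm_bdd: "z \<in> c00 \<Longrightarrow> bdd_above ((\<lambda>f. pairing f z) ` Collect (W N1 \<sigma>))"
  using W_ap_le_l1 [of z N1 \<sigma>] pairing_le_ap order_trans by (intro bdd_aboveI2) blast

lemma ap_le_W_norm:
  assumes "z \<in> c00" "W N1 \<sigma> f"
  shows "ap f z \<le> W_norm N1 \<sigma> z"
proof -
  obtain g where g: "W N1 \<sigma> g" "pairing g z = ap f z"
    using assms(2) by (rule ap_eq_pairing)
  have "pairing g z \<le> W_norm N1 \<sigma> z"
    unfolding W_norm_def using g(1) by (intro cSUP_upper W_norm_bdd assms(1)) auto
  with g(2) show ?thesis by simp
qed

lemma W_norm_le:
  assumes "\<And>f. W N1 \<sigma> f \<Longrightarrow> ap f z \<le> B"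
  shows "W_norm N1 \<sigma> z \<le> B"
  unfolding W_norm_def
  using beta_pos [of 1 N1 \<sigma>] assms pairing_le_ap order_trans by (intro cSUP_least) blast+

lemma less_W_norm:
  assumes "c < W_norm N1 \<sigma> z"
  obtains f where "W N1 \<sigma> f" "c < ap f z"
  using W_norm_le [of N1 \<sigma> z c] assms that by (metis linorder_not_le)

lemma W_norm_nonneg: "z \<in> c00 \<Longrightarrow> 0 \<le> W_norm N1 \<sigma> z"
  using ap_le_W_norm [of z N1 \<sigma> "unit_vec 1"] beta_pos [of 1 N1 \<sigma>] ap_nonneg order_trans by blast

lemma W_norm_scale_le:
  assumes "z \<in> c00" shows "W_norm N1 \<sigma> (\<lambda>i. c * z i) \<le> \<bar>c\<bar> * W_norm N1 \<sigma> z"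
  using assms by (auto simp: ap_scale intro!: W_norm_le mult_left_mono ap_le_W_norm)

lemma W_norm_mono:
  assumes "z' \<in> c00" "\<And>i. \<bar>z i\<bar> \<le> \<bar>z' i\<bar>"
  shows "W_norm N1 \<sigma> z \<le> W_norm N1 \<sigma> z'"
proof (rule W_norm_le)
  fix f assume f: "W N1 \<sigma> f"
  have "ap f z \<le> ap f z'"
    using assms(2) W_c00 [OF f] by (intro ap_mono) (auto simp: c00_def)
  with ap_le_W_norm [OF assms(1) f] show "ap f z \<le> W_norm N1 \<sigma> z'" by linarith
qed

section \<open>Sums of blocks and combinations with finitely supported coefficients\<close>

lemma c00_scale: "z \<in> c00 \<Longrightarrow> (\<lambda>i. c * z i) \<in> c00"
  by (rule c00_subset) auto

lemma c00_vsum: "(\<And>k. k \<in> J \<Longrightarrow> z k \<in> c00) \<Longrightarrow> vsum z J \<in> c00"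
proof (cases "finite J")
  case True
  assume z: "\<And>k. k \<in> J \<Longrightarrow> z k \<in> c00"
  have "supp (vsum z J) \<subseteq> (\<Union>k\<in>J. supp (z k))"
    by (auto simp: supp_def vsum_def elim: sum.not_neutral_contains_not_neutral)
  moreover have "finite (\<Union>k\<in>J. supp (z k))"
    using True z by (auto simp: c00_def)
  ultimately show ?thesis
    using z by (auto simp: c00_def vsum_def intro: finite_subset)
qed (simp add: vsum_def c00_def supp_def)

lemma abs_le_abs_vsum:
  assumes "finite J" "blocks J z" "k \<in> J"
  shows "\<bar>z k i\<bar> \<le> \<bar>vsum z J i\<bar>"
proof (cases "z k i = 0")
  case False
  have "z k' i = 0" if "k' \<in> J - {k}" for k'
    using assms(2,3) False that unfolding blocks_def supp_def
    by (cases k k' rule: linorder_cases) blast+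
  then have "vsum z J i = z k i"
    unfolding vsum_def using assms by (simp add: sum.remove)
  then show ?thesis by simp
qed simp

text \<open>Coefficient vectors have the type of the vectors themselves, so \<open>supp\<close>,
  \<open>vsum\<close> and \<open>blocks\<close> apply to them as well. They may be nonzero at index
  0, hence only \<open>finite (supp a)\<close> is asked of them and not membership in
  \<open>c00\<close>.\<close>

definition lin :: "(nat \<Rightarrow> real) \<Rightarrow> (nat \<Rightarrow> nat \<Rightarrow> real) \<Rightarrow> nat \<Rightarrow> real" where
  "lin a w = vsum (\<lambda>n i. a n * w n i) (supp a)"

lemma lin_eq: "finite S \<Longrightarrow> supp a \<subseteq> S \<Longrightarrow> lin a w i = (\<Sum>n\<in>S. a n * w n i)"
  unfolding lin_def vsum_def by (rule sum.mono_neutral_left) (auto simp: supp_def)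

lemma supp_vsum: "supp (vsum z J) \<subseteq> (\<Union>k\<in>J. supp (z k))"
proof
  fix i assume "i \<in> supp (vsum z J)"
  then obtain k where "k \<in> J" "z k i \<noteq> 0"
    by (auto simp: supp_def vsum_def elim: sum.not_neutral_contains_not_neutral)
  then show "i \<in> (\<Union>k\<in>J. supp (z k))" by (auto simp: supp_def)
qed

lemma supp_lin: "supp (lin a w) \<subseteq> (\<Union>n\<in>supp a. supp (w n))"
  using supp_vsum [of "\<lambda>n i. a n * w n i" "supp a"] unfolding lin_def by (auto simp: supp_def)

lemma supp_scale: "supp (\<lambda>i. c * z i) \<subseteq> supp z"
  by (auto simp: supp_def)

lemma lin_c00: "(\<And>n. w n \<in> c00) \<Longrightarrow> lin a w \<in> c00"
  unfolding lin_def by (intro c00_vsum c00_scale)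

lemma lin_vsum:
  assumes "finite J" "\<And>k. k \<in> J \<Longrightarrow> finite (supp (a k))"
  shows "lin (\<lambda>n. c * vsum a J n) w = (\<lambda>i. c * vsum (\<lambda>k. lin (a k) w) J i)"
proof
  fix i
  let ?S = "\<Union>k\<in>J. supp (a k)"
  have fin: "finite ?S" using assms by auto
  have "supp (\<lambda>n. c * vsum a J n) \<subseteq> ?S"
    using supp_scale supp_vsum by blast
  then have "lin (\<lambda>n. c * vsum a J n) w i = (\<Sum>n\<in>?S. c * vsum a J n * w n i)"
    by (rule lin_eq [OF fin])
  also have "\<dots> = c * (\<Sum>n\<in>?S. \<Sum>k\<in>J. a k n * w n i)"
    unfolding vsum_def by (simp add: sum_distrib_left sum_distrib_right mult.assoc)
  also have "\<dots> = c * (\<Sum>k\<in>J. \<Sum>n\<in>?S. a k n * w n i)"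
    by (subst sum.swap) simp
  also have "\<dots> = c * vsum (\<lambda>k. lin (a k) w) J i"
    unfolding vsum_def by (intro arg_cong [of _ _ "\<lambda>x. c * x"] sum.cong refl lin_eq [OF fin, symmetric]) auto
  finally show "lin (\<lambda>n. c * vsum a J n) w i = c * vsum (\<lambda>k. lin (a k) w) J i" .
qed

lemma lin_blocks:
  assumes w: "\<And>n n' a b. n < n' \<Longrightarrow> a \<in> supp (w n) \<Longrightarrow> b \<in> supp (w n') \<Longrightarrow> a < b"
    and a: "\<And>i i' n n'. i \<in> J \<Longrightarrow> i' \<in> J \<Longrightarrow> i < i' \<Longrightarrow> n \<in> supp (a i) \<Longrightarrow> n' \<in> supp (a i') \<Longrightarrow> n < n'"
  shows "blocks J (\<lambda>i. lin (a i) w)"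
  unfolding blocks_def
proof (intro ballI impI)
  fix i i' x y
  assume i: "i \<in> J" "i' \<in> J" "i < i'" and "x \<in> supp (lin (a i) w)" "y \<in> supp (lin (a i') w)"
  then obtain n n' where "n \<in> supp (a i)" "x \<in> supp (w n)" "n' \<in> supp (a i')" "y \<in> supp (w n')"
    using supp_lin by blast
  then show "x < y" using w a i by blast
qed

definition flat :: "real \<Rightarrow> nat \<Rightarrow> nat \<Rightarrow> nat \<Rightarrow> real" where
  "flat c b L = (\<lambda>n. if n \<in> {b..<b + L} then c else 0)"

lemma supp_flat: "supp (flat c b L) \<subseteq> {b..<b + L}"
  by (auto simp: supp_def flat_def)

lemma finite_supp_flat: "finite (supp (flat c b L))"
  using finite_subset [OF supp_flat] by blast

text \<open>The self-similarity that drives James' argument: a flat sum of length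
  \<open>N * L\<close> consists of \<open>N\<close> flat sums of length \<open>L\<close>, and for
  \<open>c = 1 / N\<close> it is their average.\<close>

lemma flat_split: "flat (c * d) b (N * L) = (\<lambda>n. c * vsum (\<lambda>k. flat d (b + k * L) L) {..<N} n)"
proof
  fix n
  show "flat (c * d) b (N * L) n = c * vsum (\<lambda>k. flat d (b + k * L) L) {..<N} n"
  proof (cases "n \<in> {b..<b + N * L}")
    case True
    then have L: "0 < L" by (cases L) auto
    define k where "k = (n - b) div L"
    have "n - b < N * L" using True by auto
    then have kN: "k < N"
      unfolding k_def by (rule less_mult_imp_div_less)
    have iff: "n \<in> {b + k' * L..<b + k' * L + L} \<longleftrightarrow> k' = k" for k'
    proof
      assume "n \<in> {b + k' * L..<b + k' * L + L}"
      then have "k' * L \<le> n - b" "n - b < Suc k' * L" by auto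
      then show "k' = k" unfolding k_def by (metis div_nat_eqI mult.commute)
    next
      assume "k' = k"
      moreover have "k * L \<le> n - b" "n - b < k * L + L"
        unfolding k_def using L dividend_less_div_times [OF L, of "n - b"] by (auto simp: add.commute)
      ultimately show "n \<in> {b + k' * L..<b + k' * L + L}" using True by auto
    qed
    have "(\<Sum>k'<N. flat d (b + k' * L) L n) = (\<Sum>k'<N. if k' = k then d else 0)"
      unfolding flat_def iff ..
    then show ?thesis
      using True kN by (simp add: vsum_def flat_def)
  next
    case False
    have "flat d (b + k * L) L n = 0" if "k < N" for k
    proof -
      have "Suc k * L \<le> N * L" using that by (intro mult_le_mono1) simp
      then show ?thesis using False by (auto simp: flat_def)
    qed
    then have "vsum (\<lambda>k. flat d (b + k * L) L) {..<N} n = 0"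
      by (simp add: vsum_def)
    then show ?thesis using False by (auto simp: flat_def)
  qed
qed

section \<open>Equivalent block sequences with disjoint ranges\<close>

text \<open>In the application \<open>w n\<close> is half the difference of two normalized blocks, \<open>R n\<close> is the union
  of their ranges, and \<open>t n\<close> is a truncation of the image of \<open>w n\<close> under an isomorphism.\<close>

locale block_pair =
  fixes N1 :: "nat set" and \<sigma> :: "(nat \<Rightarrow> real) list \<Rightarrow> nat"
    and w t :: "nat \<Rightarrow> nat \<Rightarrow> real" and R :: "nat \<Rightarrow> nat set" and D :: real
  assumes w: "\<And>n. w n \<in> c00" "\<And>n. supp (w n) \<subseteq> R n"
    and R: "\<And>n n' a b. n < n' \<Longrightarrow> a \<in> R n \<Longrightarrow> b \<in> R n' \<Longrightarrow> a < b"
    and norm_w: "\<And>n. 1 / 2 \<le> W_norm N1 \<sigma> (w n)" "\<And>n. W_norm N1 \<sigma> (w n) \<le> 1"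
    and t: "\<And>n. t n \<in> c00"
      "\<And>n n' a b. n < n' \<Longrightarrow> a \<in> supp (t n) \<Longrightarrow> b \<in> supp (t n') \<Longrightarrow> a < b"
    and disjoint: "\<And>n n'. supp (t n) \<inter> R n' = {}"
    and restriction: "\<And>K. \<exists>n0. \<forall>A f. finite A \<and> card A \<le> K \<and> A \<subseteq> {n0..} \<and> W N1 \<sigma> f \<longrightarrow>
      W N1 \<sigma> (\<lambda>i. 1 / 2 * restr (\<Union>n\<in>A. R n) f i)"
    and D: "0 < D"
    and upper: "\<And>a. finite (supp a) \<Longrightarrow> W_norm N1 \<sigma> (lin a t) \<le> D * W_norm N1 \<sigma> (lin a w)"
    and lower: "\<And>a. finite (supp a) \<Longrightarrow> W_norm N1 \<sigma> (lin a w) \<le> D * W_norm N1 \<sigma> (lin a t)"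
begin

abbreviation "nrm \<equiv> W_norm N1 \<sigma>"

lemma w_less: "n < n' \<Longrightarrow> a \<in> supp (w n) \<Longrightarrow> b \<in> supp (w n') \<Longrightarrow> a < b"
  using R w(2) by blast

lemma abs_le_lin:
  assumes "finite (supp a)" "n \<in> supp a"
  shows "\<bar>a n * w n i\<bar> \<le> \<bar>lin a w i\<bar>"
  unfolding lin_def
  using abs_le_abs_vsum [of "supp a" "\<lambda>n i. a n * w n i" n i] assms w_less
  by (auto simp: blocks_def supp_def)

text \<open>Operation (delta) joins n_{2j} functionals, each of them large on one
  \<open>w n\<close>. The 1/4 in place of 1/2 leaves room for choosing them below the supremum. They
  are cut to the interval spanned by the support of \<open>w n\<close>, because (gamma) allows
  intervals only and \<open>R n\<close> need not be one.\<close>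

lemma flat_lower:
  assumes j: "1 \<le> j" and L: "L = n_seq (2 * j)"
  shows "L / (4 * m_seq (2 * j)) \<le> nrm (lin (flat 1 b L) w)"
proof -
  have "\<exists>\<phi>. W N1 \<sigma> \<phi> \<and> supp \<phi> \<subseteq> {Min (supp (w n))..Max (supp (w n))} \<and> 1 / 4 < ap \<phi> (w n)" for n
  proof -
    let ?I = "{Min (supp (w n))..Max (supp (w n))}"
    have "1 / 4 < nrm (w n)" using norm_w(1) [of n] by simp
    then obtain \<phi> where \<phi>: "W N1 \<sigma> \<phi>" "1 / 4 < ap \<phi> (w n)" by (rule less_W_norm)
    have "ap \<phi> (w n) = ap (restr ?I \<phi>) (w n)"
      unfolding ap_def
    proof (rule sum.mono_neutral_cong_right)
      show "finite (supp \<phi>)" using W_c00 [OF \<phi>(1)] by (simp add: c00_def)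
      show "\<forall>i\<in>supp \<phi> - supp (restr ?I \<phi>). \<bar>\<phi> i * w n i\<bar> = 0"
        using w(1) [of n] by (auto simp: supp_def restr_def c00_def)
    qed (auto simp: supp_def restr_def)
    moreover have "W N1 \<sigma> (restr ?I \<phi>)"
      by (intro gamma \<phi>) (auto simp: nat_interval_def)
    moreover have "supp (restr ?I \<phi>) \<subseteq> ?I"
      by (auto simp: supp_def restr_def)
    ultimately show ?thesis using \<phi>(2) by metis
  qed
  then obtain \<phi> where \<phi>: "\<And>n. W N1 \<sigma> (\<phi> n)"
    "\<And>n. supp (\<phi> n) \<subseteq> {Min (supp (w n))..Max (supp (w n))}" "\<And>n. 1 / 4 < ap (\<phi> n) (w n)"
    by metis
  define fs where "fs = map \<phi> [b..<b + L]"
  have fin: "finite (supp (w n))" "supp (w n) \<noteq> {}" for n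
  proof -
    show "finite (supp (w n))" using w(1) by (simp add: c00_def)
    show "supp (w n) \<noteq> {}"
    proof
      assume "supp (w n) = {}"
      then have "ap (\<phi> n) (w n) = 0" by (intro ap_disjoint) simp
      with \<phi>(3) [of n] show False by simp
    qed
  qed
  have fs: "successive fs"
  proof (rule successiveI)
    fix s assume s: "s < length fs"
    show "fs ! s \<in> c00" using s W_c00 [OF \<phi>(1)] by (simp add: fs_def)
    show "supp (fs ! s) \<noteq> {}"
    proof
      assume "supp (fs ! s) = {}"
      then have "ap (\<phi> (b + s)) (w (b + s)) = 0" using s by (intro ap_disjoint) (simp add: fs_def)
      with \<phi>(3) [of "b + s"] show False by simp
    qed
  next
    fix s s' x y assume s: "s < s'" "s' < length fs" "x \<in> supp (fs ! s)" "y \<in> supp (fs ! s')"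
    then have "x \<le> Max (supp (w (b + s)))" "Min (supp (w (b + s'))) \<le> y"
      using \<phi>(2) by (auto simp: fs_def dest!: subsetD [OF \<phi>(2)])
    moreover have "Max (supp (w (b + s))) < Min (supp (w (b + s')))"
      using s(1) by (intro w_less [OF _ Max_in Min_in] fin) simp
    ultimately show "x < y" by linarith
  qed
  have "averaged N1 \<sigma> (2 * j) (average (2 * j) fs)"
    using \<phi>(1) by (intro delta j fs) (auto simp: fs_def L)
  then have W: "W N1 \<sigma> (average (2 * j) fs)" by (rule averaged_in_W)
  let ?u = "lin (flat 1 b L) w"
  have "1 / 4 \<le> ap (fs ! s) ?u" if "s < length fs" for s
  proof -
    have s: "s < L" "fs ! s = \<phi> (b + s)" using that by (simp_all add: fs_def)
    have "ap (\<phi> (b + s)) (w (b + s)) \<le> ap (\<phi> (b + s)) ?u"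
    proof (rule ap_mono)
      show "finite (supp (\<phi> (b + s)))" using W_c00 [OF \<phi>(1)] by (simp add: c00_def)
      show "\<bar>w (b + s) i\<bar> \<le> \<bar>?u i\<bar>" for i
        using abs_le_lin [OF finite_supp_flat, of "b + s" 1 b L i] s(1) by (simp add: flat_def supp_def)
    qed simp
    with \<phi>(3) [of "b + s"] s(2) show ?thesis by simp
  qed
  then have "(\<Sum>s<length fs. 1 / 4) \<le> (\<Sum>s<length fs. ap (fs ! s) ?u)"
    by (intro sum_mono) auto
  then have "(1 / real (m_seq (2 * j))) * (L / 4) \<le> (1 / real (m_seq (2 * j))) * (\<Sum>s<length fs. ap (fs ! s) ?u)"
    by (intro mult_left_mono) (auto simp: fs_def)
  also have "\<dots> = ap (average (2 * j) fs) ?u"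
    by (rule ap_average [OF fs, symmetric])
  also have "\<dots> \<le> nrm ?u"
    by (intro ap_le_W_norm W lin_c00 w)
  finally show ?thesis by (simp add: mult.commute)
qed

text \<open>James' argument: if no flat average of \<open>N\<close> normalized flat blocks were almost
  normalized, the norms of flat sums of length \<open>N\<^sup>r\<close> would be too small.\<close>

lemma james:
  assumes j: "1 \<le> j"
  defines "N \<equiv> 5 * n_seq (2 * j - 1)"
  obtains c L b where "n0 \<le> b" "N * L \<le> n_seq (2 * j)" "\<And>b'. n0 \<le> b' \<Longrightarrow> nrm (lin (flat c b' L) w) \<le> 1"
    "1 / 2 < nrm (lin (flat (1 / N * c) b (N * L)) w)"
proof -
  obtain l where l: "2 * j = Suc (Suc l)" using j by (cases j) auto
  let ?s = "3 * 5 ^ Suc l :: nat"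
  have nN: "n_seq (2 * j) = N ^ ?s"
    unfolding N_def l n_seq_Suc_Suc by simp
  have N: "20 \<le> N" using n_seq_ge_4 [of "2 * j - 1"] j unfolding N_def by simp
  \<comment> \<open>\<open>P r\<close> expresses the loss of a factor 2 at each of \<open>r\<close>
    levels. At the last level N^s = n_{2j}, where 2^s = m_{2j}^3, it would bound a norm by n_{2j} /
    m_{2j}^3, against the n_{2j} / (4 m_{2j}) of \<open>flat_lower\<close>. So \<open>P\<close>
    breaks at some level in between.\<close>
  define P where "P r \<longleftrightarrow> (\<forall>b\<ge>n0. nrm (lin (flat 1 b (N ^ r)) w) \<le> (real N / 2) ^ r)" for r
  have P0: "P 0"
  proof -
    have "lin (flat 1 b (N ^ 0)) w = w b" for b
    proof
      fix i show "lin (flat 1 b (N ^ 0)) w i = w b i"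
        by (subst lin_eq [of "{b}"]) (auto simp: flat_def supp_def)
    qed
    then show ?thesis unfolding P_def using norm_w(2) by simp
  qed
  have Ps: "\<not> P ?s"
  proof
    assume "P ?s"
    then have "N ^ ?s / (4 * m_seq (2 * j)) \<le> (real N / 2) ^ ?s"
      using flat_lower [OF j refl, of n0] order_trans unfolding P_def nN by blast
    then have "real N ^ ?s * (1 / (4 * m_seq (2 * j))) \<le> real N ^ ?s * (1 / 2) ^ ?s"
      by (simp add: power_divide power_one_over)
    then have "1 / (4 * real (m_seq (2 * j))) \<le> (1 / 2) ^ ?s"
      using N by (subst (asm) mult_le_cancel_left_pos) auto
    then have "(2::real) ^ ?s \<le> 4 * m_seq (2 * j)"
      using m_seq_pos [of "2 * j"] by (simp add: power_one_over field_simps)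
    moreover have "m_seq (2 * j) ^ 3 = 2 ^ ?s"
      unfolding l m_seq_Suc by (simp only: power_mult [symmetric] mult.commute)
    ultimately have "m_seq (2 * j) ^ 3 \<le> 4 * m_seq (2 * j)"
      by (metis of_nat_le_iff of_nat_mult of_nat_numeral of_nat_power)
    moreover
    have "2 ^ 5 \<le> m_seq (2 * j)"
    proof -
      have "(5::nat) ^ 1 \<le> 5 ^ Suc l" by (intro power_increasing) auto
      then show ?thesis unfolding l m_seq_Suc by (intro power_increasing) auto
    qed
    then have "32 \<le> m_seq (2 * j)" by simp
    then have "4 * m_seq (2 * j) < m_seq (2 * j) * m_seq (2 * j) * m_seq (2 * j)"
      using mult_le_mono [of 32 "m_seq (2 * j)" 1 "m_seq (2 * j)"] by (intro mult_strict_right_mono) auto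
    ultimately show False by (simp add: power3_eq_cube)
  qed
  obtain r where r: "r < ?s" "P r" "\<not> P (Suc r)"
  proof -
    have "\<exists>r<?s. P r \<and> \<not> P (Suc r)"
    proof (rule ccontr)
      assume *: "\<not> ?thesis"
      have "r \<le> ?s \<Longrightarrow> P r" for r
        using * P0 by (induction r) auto
      with Ps show False by blast
    qed
    with that show thesis by blast
  qed
  from r(3) obtain b where b: "n0 \<le> b" "(real N / 2) ^ Suc r < nrm (lin (flat 1 b (N ^ Suc r)) w)"
    unfolding P_def by (meson linorder_not_le)
  \<comment> \<open>Scaled by \<open>c\<close>, the flat sums of length N^r have norm at most 1,
    while the failure of \<open>P (Suc r)\<close> puts some average of \<open>N\<close> consecutive
    ones above 1/2.\<close>
  define c where "c = (2 / real N) ^ r"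
  have c: "0 < c" "c * (real N / 2) ^ r = 1"
    using N by (simp_all add: c_def power_mult_distrib [symmetric])
  have scale: "lin (flat (d * e) b L) w = (\<lambda>i. d * lin (flat e b L) w i)" for d e b L
  proof
    fix i
    have "lin (flat (d * e) b L) w i = (\<Sum>n = b..<b + L. flat (d * e) b L n * w n i)"
      by (rule lin_eq [OF _ supp_flat]) simp
    also have "\<dots> = d * (\<Sum>n = b..<b + L. flat e b L n * w n i)"
      unfolding sum_distrib_left by (rule sum.cong) (auto simp: flat_def)
    also have "(\<Sum>n = b..<b + L. flat e b L n * w n i) = lin (flat e b L) w i"
      by (rule lin_eq [OF _ supp_flat, symmetric]) simp
    finally show "lin (flat (d * e) b L) w i = d * lin (flat e b L) w i" .
  qed
  show ?thesis
  proof (rule that [of b "N ^ r" c])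
    have "N ^ Suc r \<le> N ^ ?s" using r(1) N by (intro power_increasing) auto
    then show "N * N ^ r \<le> n_seq (2 * j)" unfolding nN by simp
  next
    fix b' assume "n0 \<le> b'"
    have "nrm (lin (flat (c * 1) b' (N ^ r)) w) \<le> \<bar>c\<bar> * nrm (lin (flat 1 b' (N ^ r)) w)"
      unfolding scale by (intro W_norm_scale_le lin_c00 w)
    also have "\<dots> \<le> c * (real N / 2) ^ r"
      using r(2) \<open>n0 \<le> b'\<close> c(1) unfolding P_def by (intro mult_mono) (auto intro!: W_norm_nonneg lin_c00 w)
    finally show "nrm (lin (flat c b' (N ^ r)) w) \<le> 1" using c(2) by simp
  next
    let ?u = "lin (flat (1 / N * c) b (N * N ^ r)) w"
    have "(\<lambda>i. N / c * ?u i) = lin (flat (N / c * (1 / N * c)) b (N * N ^ r)) w"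
      by (rule scale [symmetric])
    also have "N / c * (1 / N * c) = 1" using c(1) N by simp
    finally have "(real N / 2) ^ Suc r < nrm (\<lambda>i. N / c * ?u i)" using b(2) by simp
    also have "\<dots> \<le> \<bar>N / c\<bar> * nrm ?u" by (intro W_norm_scale_le lin_c00 w)
    finally have "c / N * (real N / 2) ^ Suc r < c / N * (\<bar>N / c\<bar> * nrm ?u)"
      using c(1) N by (intro mult_strict_left_mono) auto
    moreover have "c / N * (real N / 2) ^ Suc r = 1 / 2"
      using c(2) N by simp
    ultimately show "1 / 2 < nrm ?u" using c(1) N by simp
  qed (rule b(1))
qed

text \<open>The functional norming the James average is cut to the sets \<open>R n\<close> with n in
  \<open>supp a\<close>. Apart from the factor 1/2 this changes nothing on \<open>lin a w\<close>,
  but it makes the functional vanish on every \<open>t n\<close>. On the side of \<open>t\<close>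
  the comparison of norms leaves pieces bounded by \<open>D\<close>, which is all that
  \<open>l1_average_estimate\<close> asks for.\<close>

lemma l1_average:
  obtains a \<phi> where "finite (supp a)" "supp a \<noteq> {}" "supp a \<subseteq> {n0..}"
    "W N1 \<sigma> \<phi>" "supp \<phi> \<subseteq> (\<Union>n\<in>supp a. R n)" "1 / 8 < ap \<phi> (lin a w)"
    "\<And>f. W N1 \<sigma> f \<Longrightarrow> ap f (lin a t) \<le> D"
    "\<And>p g. averaged N1 \<sigma> p g \<Longrightarrow> p \<le> r \<Longrightarrow> ap g (lin a t) \<le> 2 * D / m_seq p"
proof -
  \<comment> \<open>With this \<open>j\<close>, each p \<le> r satisfies p \<le> 2j - 1, so that n_p
    does not exceed the number \<open>N\<close> of pieces.\<close>
  define j where "j = Suc r"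
  define N where "N = 5 * n_seq (2 * j - 1)"
  have j: "1 \<le> j" by (simp add: j_def)
  have N: "0 < N" using n_seq_ge_4 [of "2 * j - 1"] j unfolding N_def by linarith
  obtain n1 where n1: "\<And>A f. finite A \<Longrightarrow> card A \<le> n_seq (2 * j) \<Longrightarrow> A \<subseteq> {n1..} \<Longrightarrow> W N1 \<sigma> f \<Longrightarrow>
      W N1 \<sigma> (\<lambda>i. 1 / 2 * restr (\<Union>n\<in>A. R n) f i)"
    using restriction by metis
  obtain c L b where b: "max n0 n1 \<le> b" "N * L \<le> n_seq (2 * j)"
    "\<And>b'. max n0 n1 \<le> b' \<Longrightarrow> nrm (lin (flat c b' L) w) \<le> 1"
    "1 / 2 < nrm (lin (flat (1 / N * c) b (N * L)) w)"
    using james [OF j, of "max n0 n1"] unfolding N_def by metis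
  define a where "a = flat (1 / N * c) b (N * L)"
  define z where "z k = lin (flat c (b + k * L) L) t" for k
  have fin: "finite (supp a)" unfolding a_def by (rule finite_supp_flat)
  have sub: "supp a \<subseteq> {b..<b + N * L}" unfolding a_def by (rule supp_flat)
  have card: "card (supp a) \<le> n_seq (2 * j)"
    using card_mono [OF _ sub] b(2) by simp
  from b(4) obtain f where f: "W N1 \<sigma> f" "1 / 2 < ap f (lin a w)"
    unfolding a_def by (rule less_W_norm)
  define \<phi> where "\<phi> = (\<lambda>i. 1 / 2 * restr (\<Union>n\<in>supp a. R n) f i)"
  have "ap \<phi> (lin a w) = 1 / 2 * ap f (lin a w)"
  proof -
    have "ap \<phi> (lin a w) = (\<Sum>i\<in>supp f. \<bar>\<phi> i * lin a w i\<bar>)"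
      using W_c00 [OF f(1)] by (intro ap_eq_sum) (auto simp: c00_def \<phi>_def supp_def restr_def)
    also have "\<dots> = (\<Sum>i\<in>supp f. 1 / 2 * \<bar>f i * lin a w i\<bar>)"
    proof (rule sum.cong)
      fix i
      show "\<bar>\<phi> i * lin a w i\<bar> = 1 / 2 * \<bar>f i * lin a w i\<bar>"
      proof (cases "i \<in> (\<Union>n\<in>supp a. R n)")
        case True
        then show ?thesis by (simp add: \<phi>_def restr_def abs_mult)
      next
        case False
        then have "i \<notin> supp (lin a w)" using supp_lin [of a w] w(2) by blast
        then have "lin a w i = 0" by (simp add: supp_def)
        then show ?thesis by simp
      qed
    qed simp
    finally show ?thesis by (simp add: ap_def sum_distrib_left)
  qed
  with f(2) have big: "1 / 8 < ap \<phi> (lin a w)" by simp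
  have t_eq: "lin a t = (\<lambda>i. 1 / card {..<N} * vsum z {..<N} i)"
    unfolding a_def flat_split z_def by (subst lin_vsum) (auto intro: finite_supp_flat)
  have z_blocks: "blocks {..<N} z"
    unfolding z_def
  proof (rule lin_blocks)
    fix i i' n n' assume "i < i'" "n \<in> supp (flat c (b + i * L) L)" "n' \<in> supp (flat c (b + i' * L) L)"
    then have "n < b + Suc i * L" "b + i' * L \<le> n'"
      using supp_flat [of c "b + i * L" L] supp_flat [of c "b + i' * L" L]
      by (auto simp: add.commute dest!: subsetD)
    moreover have "Suc i * L \<le> i' * L"
      using \<open>i < i'\<close> by (intro mult_le_mono1) simp
    ultimately show "n < n'" by linarith
  qed (rule t(2))
  have z_bound: "ap f (z k) \<le> D" if "W N1 \<sigma> f" "k \<in> {..<N}" for f k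
  proof -
    have "ap f (z k) \<le> nrm (z k)"
      unfolding z_def by (intro ap_le_W_norm lin_c00 t that)
    also have "\<dots> \<le> D * nrm (lin (flat c (b + k * L) L) w)"
      unfolding z_def by (intro upper finite_supp_flat)
    also have "\<dots> \<le> D * 1"
      using b(1) D by (intro mult_left_mono b(3)) auto
    finally show ?thesis by simp
  qed
  show ?thesis
  proof (rule that [of a \<phi>])
    show "supp a \<noteq> {}"
    proof
      assume "supp a = {}"
      then have "ap \<phi> (lin a w) = 0" using supp_lin [of a w] by (intro ap_disjoint) auto
      with big show False by simp
    qed
    show "supp a \<subseteq> {n0..}" using sub b(1) by auto
    show "W N1 \<sigma> \<phi>"
      unfolding \<phi>_def using sub b(1) by (intro n1 fin card f(1)) auto
    show "supp \<phi> \<subseteq> (\<Union>n\<in>supp a. R n)"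
      by (auto simp: \<phi>_def restr_def supp_def split: if_splits)
  next
    fix f assume "W N1 \<sigma> f"
    then show "ap f (lin a t) \<le> D"
      unfolding t_eq using N D z_bound z_blocks by (intro l1_average_estimate) auto
  next
    fix p g assume g: "averaged N1 \<sigma> p g" "p \<le> r"
    have "2 \<le> p" using g(1) by (rule averaged_imp)
    then have "n_seq p \<le> N"
      using n_seq_mono [of p "2 * j - 1"] g(2) unfolding N_def j_def by simp
    then show "ap g (lin a t) \<le> 2 * D / m_seq p"
      unfolding t_eq using N D z_bound z_blocks g(1) by (intro l1_average_estimate) auto
  qed (fact fin big)+
qed

end

section \<open>Rapidly increasing sequences of averages and exact pairs\<close>

lemma ap_pos_imp_supp_nonempty: "0 < ap f z \<Longrightarrow> supp f \<noteq> {}"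
  by (auto simp: ap_def)

lemma Max_less_Min_chain:
  fixes A :: "nat \<Rightarrow> nat set"
  assumes "\<And>l. finite (A l)" "\<And>l. A l \<noteq> {}" "\<And>l. Max (A l) < Min (A (Suc l))"
    and "i < i'" "n \<in> A i" "n' \<in> A i'"
  shows "n < n'"
proof -
  have "Min (A l) \<le> Max (A l)" for l
    using assms(1,2) by simp
  then have mono: "Max (A l) < Max (A (Suc l))" for l
    using assms(3) [of l] less_le_trans by blast
  have "Max (A i) < Min (A i')"
    using \<open>i < i'\<close>
  proof (induction i' rule: less_induct)
    case (less i')
    then obtain l where l: "i' = Suc l" "i = l \<or> i < l"
      by (metis less_Suc_eq lessE)
    then have "Max (A i) \<le> Max (A l)"
      using lift_Suc_mono_less [of "\<lambda>l. Max (A l)", OF mono] by (auto intro: less_imp_le)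
    with assms(3) [of l] l(1) show ?case by simp
  qed
  moreover have "n \<le> Max (A i)" "Min (A i') \<le> n'"
    using assms by simp_all
  ultimately show ?thesis by linarith
qed

context block_pair
begin

lemma R_Un_less:
  assumes "\<And>n n'. n \<in> A \<Longrightarrow> n' \<in> A' \<Longrightarrow> n < n'" "x \<in> (\<Union>n\<in>A. R n)" "y \<in> (\<Union>n\<in>A'. R n)"
  shows "x < y"
  using assms R by blast

text \<open>An exact pair in the sense of constructions with special functionals, but spread over
  two sequences: \<open>\<phi>\<close> norms the combination of \<open>w\<close>, while the upper
  bounds concern that of \<open>t\<close>. The constant 10 D is 5 C in \<open>ris_average\<close>
  for C = 2 D.\<close>

definition exact :: "nat \<Rightarrow> (nat \<Rightarrow> real) \<Rightarrow> (nat \<Rightarrow> real) \<Rightarrow> bool" where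
  "exact j a \<phi> \<longleftrightarrow> finite (supp a) \<and> supp a \<noteq> {} \<and> averaged N1 \<sigma> j \<phi>
      \<and> supp \<phi> \<subseteq> (\<Union>n\<in>supp a. R n) \<and> 1 / 8 \<le> ap \<phi> (lin a w)
      \<and> (\<forall>f. W N1 \<sigma> f \<longrightarrow> ap f (lin a t) \<le> 10 * D)
      \<and> (\<forall>p g. averaged N1 \<sigma> p g \<longrightarrow> p < j \<longrightarrow> ap g (lin a t) \<le> 10 * D / m_seq p)
      \<and> (\<forall>p g. averaged N1 \<sigma> p g \<longrightarrow> j < p \<longrightarrow> ap g (lin a t) \<le> 10 * D / m_seq j)"

definition l1_avg :: "nat \<Rightarrow> (nat \<Rightarrow> real) \<Rightarrow> (nat \<Rightarrow> real) \<Rightarrow> bool" where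
  "l1_avg r a \<phi> \<longleftrightarrow> finite (supp a) \<and> supp a \<noteq> {} \<and> W N1 \<sigma> \<phi>
      \<and> supp \<phi> \<subseteq> (\<Union>n\<in>supp a. R n) \<and> 1 / 8 < ap \<phi> (lin a w)
      \<and> (\<forall>f. W N1 \<sigma> f \<longrightarrow> ap f (lin a t) \<le> D)
      \<and> (\<forall>p g. averaged N1 \<sigma> p g \<longrightarrow> p \<le> r \<longrightarrow> ap g (lin a t) \<le> 2 * D / m_seq p)"

lemma l1_avg_exists: "\<exists>a \<phi>. l1_avg r a \<phi> \<and> supp a \<subseteq> {n0..}"
  unfolding l1_avg_def by (rule l1_average [of n0 r]) blast

lemma l1_avg_sequence:
  assumes "0 < \<epsilon>"
  obtains a \<phi> r where "\<And>l. l1_avg (r l) (a l) (\<phi> l)" "\<And>l. supp (a l) \<subseteq> {n0..}"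
    "\<And>l. Max (supp (a l)) < Min (supp (a (Suc l)))" "\<And>l. r l < r (Suc l)"
    "\<And>l p g. averaged N1 \<sigma> p g \<Longrightarrow> r (Suc l) \<le> p \<Longrightarrow> ap g (lin (a l) t) \<le> \<epsilon>"
proof -
  let ?P = "\<lambda>(l::nat) (r, a, \<phi>). l1_avg r a \<phi> \<and> supp a \<subseteq> {n0..}"
  let ?Q = "\<lambda>(l::nat) (r, a, \<phi>) (r', a', \<phi>'). Max (supp a) < Min (supp a') \<and> r < r' \<and>
      (\<forall>p g. averaged N1 \<sigma> p g \<longrightarrow> r' \<le> p \<longrightarrow> ap g (lin a t) \<le> \<epsilon>)"
  have "\<exists>f. \<forall>l. ?P l (f l) \<and> ?Q l (f l) (f (Suc l))"
  proof (rule dependent_nat_choice)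
    show "\<exists>x. ?P 0 x" using l1_avg_exists [of 0 n0] by auto
  next
    fix x l assume x: "?P l x"
    obtain r a \<phi> where xe: "x = (r, a, \<phi>)" by (cases x) auto
    let ?b = "\<Sum>i\<in>supp (lin a t). \<bar>lin a t i\<bar>"
    obtain u :: nat where u: "?b / \<epsilon> < u" using reals_Archimedean2 by blast
    \<comment> \<open>A functional of weight m_p has coordinates of modulus at most 1/m_p, hence is
      at most \<open>?b / m_seq p\<close> on the vector already chosen. From \<open>r'\<close> on
      this is below \<epsilon>.\<close>
    define r' where "r' = Suc (max r u)"
    have small: "ap g (lin a t) \<le> \<epsilon>" if g: "averaged N1 \<sigma> p g" "r' \<le> p" for p g
    proof -
      have "u < m_seq (Suc u)" by (rule less_m_seq_Suc)
      also have "\<dots> \<le> m_seq p" using g(2) by (intro m_seq_mono) (auto simp: r'_def)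
      finally have "?b / \<epsilon> \<le> m_seq p" using u by linarith
      then have "?b / m_seq p \<le> \<epsilon>"
        using m_seq_pos [of p] assms by (simp add: field_simps)
      moreover have "lin a t \<in> c00" by (intro lin_c00 t)
      ultimately show ?thesis
        using averaged_ap_le_l1 [OF _ g(1), of "lin a t"] by linarith
    qed
    obtain a' \<phi>' where a': "l1_avg r' a' \<phi>'" "supp a' \<subseteq> {Suc (max n0 (Max (supp a)))..}"
      using l1_avg_exists by blast
    then have "Min (supp a') \<in> {Suc (max n0 (Max (supp a)))..}"
      unfolding l1_avg_def by (meson Min_in subsetD)
    moreover have "r < r'" by (simp add: r'_def)
    ultimately have "?P (Suc l) (r', a', \<phi>') \<and> ?Q l x (r', a', \<phi>')"
      using a' small by (auto simp: xe)
    then show "\<exists>y. ?P (Suc l) y \<and> ?Q l x y" by blast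
  qed
  then obtain f where f: "\<forall>l. ?P l (f l) \<and> ?Q l (f l) (f (Suc l))" by (rule exE)
  show ?thesis
  proof (rule that [of "\<lambda>l. fst (f l)" "\<lambda>l. fst (snd (f l))" "\<lambda>l. snd (snd (f l))"])
    fix l
    show "l1_avg (fst (f l)) (fst (snd (f l))) (snd (snd (f l)))" "supp (fst (snd (f l))) \<subseteq> {n0..}"
      using spec [OF f, of l] by (auto simp: case_prod_unfold)
    show "Max (supp (fst (snd (f l)))) < Min (supp (fst (snd (f (Suc l)))))"
      "fst (f l) < fst (f (Suc l))"
      "averaged N1 \<sigma> p g \<Longrightarrow> fst (f (Suc l)) \<le> p \<Longrightarrow> ap g (lin (fst (snd (f l))) t) \<le> \<epsilon>" for p g
      using spec [OF f, of l] by (auto simp: case_prod_unfold)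
  qed
qed

text \<open>The normalizations cancel: the average of weight m_{2j} of the \<open>\<phi> l\<close>,
  evaluated at m_{2j} / n_{2j} times the sum, is at least a mean of n_{2j} numbers above 1/8. For
  the upper bounds, the constant 2 D covers both the bound \<open>D\<close> and the decay 2 D / m_p
  of the l_1-averages.\<close>

lemma exact_exists:
  assumes j: "1 \<le> j"
  shows "\<exists>a \<phi>. exact (2 * j) a \<phi> \<and> supp a \<subseteq> {n0..}"
proof -
  let ?j = "2 * j" and ?n = "n_seq (2 * j)" and ?m = "real (m_seq (2 * j))"
  have m: "0 < ?m" using m_seq_pos by simp
  have n: "0 < ?n" using n_seq_ge_4 [of ?j] j by linarith
  have "0 < 2 * D * (1 / ?m\<^sup>2)" using D m by simp
  then obtain a \<phi> r where a: "\<And>l. l1_avg (r l) (a l) (\<phi> l)" "\<And>l. supp (a l) \<subseteq> {n0..}"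
    "\<And>l. Max (supp (a l)) < Min (supp (a (Suc l)))" "\<And>l. r l < r (Suc l)"
    "\<And>l p g. averaged N1 \<sigma> p g \<Longrightarrow> r (Suc l) \<le> p \<Longrightarrow> ap g (lin (a l) t) \<le> 2 * D * (1 / ?m\<^sup>2)"
    by (rule l1_avg_sequence [of _ n0]) blast
  have fin: "finite (supp (a l))" "supp (a l) \<noteq> {}" for l
    using a(1) unfolding l1_avg_def by auto
  have less: "n < n'" if "i < i'" "n \<in> supp (a i)" "n' \<in> supp (a i')" for i i' n n'
    using Max_less_Min_chain [of "\<lambda>l. supp (a l)", OF fin a(3) that] .
  have r_mono: "r i \<le> r i'" if "i \<le> i'" for i i'
    using that a(4) by (rule lift_Suc_mono_le [of r, OF less_imp_le, rotated])
  define z where "z l = lin (a l) t" for l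
  define b where "b = (\<lambda>n. ?m / ?n * vsum a {..<?n} n)"
  define fs where "fs = map \<phi> [0..<?n]"
  define g where "g = average ?j fs"
  have nz: "supp (\<phi> l) \<noteq> {}" for l
    using a(1) [of l] unfolding l1_avg_def by (intro ap_pos_imp_supp_nonempty [of _ "lin (a l) w"]) auto
  have \<phi>R: "supp (\<phi> l) \<subseteq> (\<Union>n\<in>supp (a l). R n)" for l
    using a(1) unfolding l1_avg_def by blast
  have fs: "successive fs"
  proof (rule successiveI)
    fix s assume "s < length fs"
    then show "fs ! s \<in> c00" "supp (fs ! s) \<noteq> {}"
      using a(1) [of s] nz W_c00 unfolding l1_avg_def by (auto simp: fs_def)
  next
    fix s s' x y assume s: "s < s'" "s' < length fs" "x \<in> supp (fs ! s)" "y \<in> supp (fs ! s')"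
    then have "x \<in> (\<Union>n\<in>supp (a s). R n)" "y \<in> (\<Union>n\<in>supp (a s'). R n)"
      using \<phi>R by (auto simp: fs_def)
    then show "x < y"
      using less [OF s(1)] by (rule R_Un_less [rotated])
  qed
  have g: "averaged N1 \<sigma> ?j g"
    unfolding g_def using a(1) by (intro delta j fs) (auto simp: fs_def l1_avg_def)
  have a_blocks: "blocks {..<?n} (\<lambda>l. a l)"
    unfolding blocks_def using less by blast
  have m_n: "0 < ?m / ?n" using m n by simp
  have supp_b: "supp b = (\<Union>l<?n. supp (a l))"
  proof
    show "supp b \<subseteq> (\<Union>l<?n. supp (a l))"
      unfolding b_def using supp_scale supp_vsum by blast
    show "(\<Union>l<?n. supp (a l)) \<subseteq> supp b"
    proof
      fix i assume "i \<in> (\<Union>l<?n. supp (a l))"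
      then obtain l where "l < ?n" "a l i \<noteq> 0" by (auto simp: supp_def)
      then have "vsum a {..<?n} i \<noteq> 0"
        using abs_le_abs_vsum [OF _ a_blocks, of l i] by auto
      with m n show "i \<in> supp b" by (simp add: b_def supp_def)
    qed
  qed
  have bt: "lin b t = (\<lambda>i. ?m / ?n * vsum z {..<?n} i)"
    unfolding b_def z_def by (rule lin_vsum) (use fin in auto)
  have bw: "lin b w = (\<lambda>i. ?m / ?n * vsum (\<lambda>l. lin (a l) w) {..<?n} i)"
    unfolding b_def by (rule lin_vsum) (use fin in auto)
  have w_blocks: "blocks {..<?n} (\<lambda>l. lin (a l) w)"
    by (rule lin_blocks) (use w_less less in blast)+
  have z_blocks: "blocks {..<?n} z"
    unfolding z_def by (rule lin_blocks) (use t(2) less in blast)+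
  have large: "1 / 8 \<le> ap g (lin b w)"
  proof -
    have each: "?m / ?n * (1 / 8) \<le> ap (fs ! s) (lin b w)" if s: "s < ?n" for s
    proof -
      have "1 / 8 \<le> ap (\<phi> s) (lin (a s) w)"
        using a(1) [of s] unfolding l1_avg_def by auto
      also have "\<dots> \<le> ap (\<phi> s) (vsum (\<lambda>l. lin (a l) w) {..<?n})"
        using abs_le_abs_vsum [OF _ w_blocks, of s] s a(1) [of s] W_c00 [of N1 \<sigma> "\<phi> s"]
        by (intro ap_mono) (auto simp: l1_avg_def c00_def)
      finally have "?m / ?n * (1 / 8) \<le> ?m / ?n * \<dots>"
        using m_n by (intro mult_left_mono) auto
      then show ?thesis
        using s m_n unfolding bw ap_scale by (simp add: fs_def)
    qed
    have "1 / 8 = (1 / ?m) * (\<Sum>s<?n. ?m / ?n * (1 / 8))" using m n by simp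
    also have "\<dots> \<le> (1 / ?m) * (\<Sum>s<?n. ap (fs ! s) (lin b w))"
      using each m by (intro mult_left_mono sum_mono) auto
    also have "\<dots> = ap g (lin b w)"
      unfolding g_def ap_average [OF fs] by (simp add: fs_def)
    finally show ?thesis .
  qed
  have z_bound: "ap f (z i) \<le> 2 * D" if "W N1 \<sigma> f" for f i
    using a(1) [of i] that D unfolding l1_avg_def z_def by (auto dest!: spec intro: order_trans)
  have z_light: "ap g (z i) \<le> 2 * D / m_seq p" if "averaged N1 \<sigma> p g" "p < r i" for p g i
    using a(1) [of i] that unfolding l1_avg_def z_def by auto
  have z_small: "ap g (z i) \<le> 2 * D * (1 / ?m\<^sup>2)"
    if "averaged N1 \<sigma> p g" "i < i'" "r i' \<le> p" for p g i i'
    unfolding z_def using that r_mono [of "Suc i" i'] by (intro a(5) [OF that(1)]) auto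
  have j2: "2 \<le> ?j" using j by simp
  note est = ris_average [OF j2 _ _ z_blocks _ z_bound, of N1 \<sigma> r, folded bt]
  have "exact ?j b g"
    unfolding exact_def
  proof (intro conjI allI impI)
    show "finite (supp b)" "supp b \<noteq> {}" using fin n by (auto simp: supp_b)
    have "supp g \<subseteq> (\<Union>l<?n. supp (\<phi> l))"
      unfolding g_def supp_average [OF fs] by (auto simp: fs_def)
    also have "\<dots> \<subseteq> (\<Union>l<?n. \<Union>n\<in>supp (a l). R n)"
      using \<phi>R by (intro UN_mono) auto
    also have "\<dots> = (\<Union>n\<in>supp b. R n)" unfolding supp_b by simp
    finally show "supp g \<subseteq> (\<Union>n\<in>supp b. R n)" .
    show "ap f (lin b t) \<le> 10 * D" if "W N1 \<sigma> f" for f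
      using est(3) [of f] that D z_light z_small by force
    show "ap h (lin b t) \<le> 10 * D / m_seq p" if "averaged N1 \<sigma> p h" "p < ?j" for p h
      using est(1) [of p h] that D z_light z_small by force
    show "ap h (lin b t) \<le> 10 * D / m_seq ?j" if "averaged N1 \<sigma> p h" "?j < p" for p h
      using est(2) [of p h] that D z_light z_small by force
  qed (fact g large)+
  moreover have "supp b \<subseteq> {n0..}" unfolding supp_b using a(2) by auto
  ultimately show ?thesis by blast
qed

end

section \<open>The special sequence and the contradiction\<close>

lemma successive_snoc:
  assumes xs: "successive xs" and y: "y \<in> c00" "supp y \<noteq> {}"
    and less: "\<And>x a b. x \<in> set xs \<Longrightarrow> a \<in> supp x \<Longrightarrow> b \<in> supp y \<Longrightarrow> a < b"
  shows "successive (xs @ [y])"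
proof -
  have "Max (supp x) < Min (supp y)" if "x \<in> set xs" for x
    using that xs y by (intro less [OF that] Max_in Min_in) (auto simp: successive_def c00_def)
  with xs y show ?thesis
    unfolding successive_def by (auto simp: sorted_wrt_append)
qed

lemma (in block_pair) special_exact_sequence:
  assumes N: "N1 \<union> N2 = {1..}" and \<sigma>: "coding_function N2 \<sigma>" and j0: "1 \<le> j0"
  obtains a \<phi> J where "J 0 = j0" "\<And>l. J (Suc l) = \<sigma> (map vabs (map \<phi> [0..<Suc l]))"
    "\<And>l. exact (2 * J l) (a l) (\<phi> l)" "\<And>l. successive (map \<phi> [0..<l])"
    "\<And>l. Max (supp (a l)) < Min (supp (a (Suc l)))"
proof -
  \<comment> \<open>The state keeps the list \<open>hs\<close> of all earlier functionals, since the
    next weight codes the whole history. The sets \<open>R n\<close> up to the largest index used so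
    far enclose all their supports, which places the next functional to the right of them.\<close>
  let ?P = "\<lambda>(l::nat) (hs, a, \<phi>, j). (l = 0 \<longrightarrow> j = j0 \<and> hs = []) \<and> exact (2 * j) a \<phi> \<and>
      successive (hs @ [\<phi>]) \<and> (\<forall>h\<in>set hs. W N1 \<sigma> h) \<and>
      (\<forall>h\<in>set (hs @ [\<phi>]). supp h \<subseteq> (\<Union>n\<in>{..Max (supp a)}. R n))"
  let ?Q = "\<lambda>(l::nat) (hs, a, \<phi>, j) (hs', a', \<phi>', j'). hs' = hs @ [\<phi>] \<and> j' = \<sigma> (map vabs hs') \<and>
      Max (supp a) < Min (supp a')"
  have exactD: "finite (supp a)" "supp a \<noteq> {}" "W N1 \<sigma> \<phi>" "\<phi> \<in> c00" "supp \<phi> \<noteq> {}"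
    "supp \<phi> \<subseteq> (\<Union>n\<in>supp a. R n)" "supp \<phi> \<subseteq> (\<Union>n\<in>{..Max (supp a)}. R n)"
    if "exact j a \<phi>" for j a \<phi>
  proof -
    show *: "finite (supp a)" "supp a \<noteq> {}" "supp \<phi> \<subseteq> (\<Union>n\<in>supp a. R n)" "W N1 \<sigma> \<phi>"
      using that averaged_in_W unfolding exact_def by auto
    then show "\<phi> \<in> c00" "supp \<phi> \<subseteq> (\<Union>n\<in>{..Max (supp a)}. R n)" using W_c00 by fastforce+
    show "supp \<phi> \<noteq> {}"
      using that unfolding exact_def by (intro ap_pos_imp_supp_nonempty [of _ "lin a w"]) auto
  qed
  have "\<exists>f. \<forall>l. ?P l (f l) \<and> ?Q l (f l) (f (Suc l))"
  proof (rule dependent_nat_choice)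
    obtain a \<phi> where a: "exact (2 * j0) a \<phi>"
      using exact_exists [OF j0, of 0] by (elim exE conjE)
    have "successive ([] @ [\<phi>])"
      using exactD(4,5) [OF a] by (intro successive_snoc) (auto simp: successive_def)
    then have "?P 0 ([], a, \<phi>, j0)"
      using a exactD(7) [OF a] by simp
    then show "\<exists>x. ?P 0 x" by (rule exI)
  next
    fix x l assume x: "?P l x"
    obtain hs a \<phi> j where xe: "x = (hs, a, \<phi>, j)" by (cases x) auto
    let ?hs = "hs @ [\<phi>]"
    have x': "exact (2 * j) a \<phi>" "successive ?hs" "\<forall>h\<in>set hs. W N1 \<sigma> h"
      "\<And>h. h \<in> set ?hs \<Longrightarrow> supp h \<subseteq> (\<Union>n\<in>{..Max (supp a)}. R n)"
      using x unfolding xe by auto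
    have W: "\<forall>h\<in>set ?hs. W N1 \<sigma> h" using x'(3) exactD(3) [OF x'(1)] by auto
    define j' where "j' = \<sigma> (map vabs ?hs)"
    have "map vabs (take (length ?hs) ?hs) \<in> coding_domain"
      by (rule coding_domain_take [OF x'(2) W]) auto
    then have "j' \<in> \<sigma> ` coding_domain" unfolding j'_def by simp
    then have "j' \<in> N2" using \<sigma> unfolding coding_function_def by blast
    then have "1 \<le> j'" using N by auto
    from exact_exists [OF this, of "Suc (Max (supp a))"] obtain a' \<phi>' where a': "exact (2 * j') a' \<phi>'" "supp a' \<subseteq> {Suc (Max (supp a))..}"
      by (elim exE conjE)
    have "Min (supp a') \<in> {Suc (Max (supp a))..}"
      using a'(2) exactD(1,2) [OF a'(1)] by (meson Min_in subsetD)
    then have Max_less: "Max (supp a) < Min (supp a')" by simp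
    have "Min (supp a') \<le> Max (supp a')"
      using exactD(1,2) [OF a'(1)] by simp
    then have "{..Max (supp a)} \<subseteq> {..Max (supp a')}" using Max_less by auto
    then have sub: "(\<Union>n\<in>{..Max (supp a)}. R n) \<subseteq> (\<Union>n\<in>{..Max (supp a')}. R n)"
      by (rule UN_mono) simp
    have "successive (?hs @ [\<phi>'])"
    proof (rule successive_snoc [OF x'(2) exactD(4,5) [OF a'(1)]])
      fix h s b assume h: "h \<in> set ?hs" "s \<in> supp h" "b \<in> supp \<phi>'"
      show "s < b"
      proof (rule R_Un_less)
        show "s \<in> (\<Union>n\<in>{..Max (supp a)}. R n)" by (rule subsetD [OF x'(4) [OF h(1)] h(2)])
        show "b \<in> (\<Union>n\<in>supp a'. R n)" by (rule subsetD [OF exactD(6) [OF a'(1)] h(3)])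
        show "n < n'" if "n \<in> {..Max (supp a)}" "n' \<in> supp a'" for n n'
          using that(1) subsetD [OF a'(2) that(2)] by simp
      qed
    qed
    moreover have "supp h \<subseteq> (\<Union>n\<in>{..Max (supp a')}. R n)" if "h \<in> set (?hs @ [\<phi>'])" for h
      using that x'(4) [of h] sub exactD(7) [OF a'(1)] by auto
    ultimately have "?P (Suc l) (?hs, a', \<phi>', j')"
      using a'(1) W by simp
    moreover have "?Q l x (?hs, a', \<phi>', j')"
      using Max_less by (simp add: xe j'_def)
    ultimately show "\<exists>y. ?P (Suc l) y \<and> ?Q l x y" by (intro exI conjI)
  qed
  then obtain f where f: "\<forall>l. ?P l (f l) \<and> ?Q l (f l) (f (Suc l))" by (rule exE)
  define H where "H l = fst (f l)" for l
  define a where "a l = fst (snd (f l))" for l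
  define \<phi> where "\<phi> l = fst (snd (snd (f l)))" for l
  define J where "J l = snd (snd (snd (f l)))" for l
  have eq: "f l = (H l, a l, \<phi> l, J l)" for l
    by (simp add: H_def a_def \<phi>_def J_def)
  have PQ: "(l::nat) = 0 \<longrightarrow> J l = j0 \<and> H l = []" "exact (2 * J l) (a l) (\<phi> l)" "successive (H l @ [\<phi> l])"
    "H (Suc l) = H l @ [\<phi> l]" "J (Suc l) = \<sigma> (map vabs (H (Suc l)))"
    "Max (supp (a l)) < Min (supp (a (Suc l)))" for l
    using spec [OF f, of l] unfolding eq [of l] eq [of "Suc l"] by auto
  have H: "H l = map \<phi> [0..<l]" for l
    by (induction l) (use PQ(1,4) in auto)
  show ?thesis
  proof (rule that [of J \<phi> a])
    show "J 0 = j0" using PQ(1) by blast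
    show "J (Suc l) = \<sigma> (map vabs (map \<phi> [0..<Suc l]))" for l
      using PQ(5) H by metis
    show "successive (map \<phi> [0..<l])" for l
      using PQ(3) [of l] unfolding H successive_def by (auto simp: sorted_wrt_append)
  qed (fact PQ(2,6))+
qed

lemma (in block_pair) inconsistent:
  assumes N: "N1 \<union> N2 = {1..}" "N1 \<inter> N2 = {}" "infinite N1" and \<sigma>: "coding_function N2 \<sigma>"
  shows False
proof -
  \<comment> \<open>The comparison will read n_q / (8 m_q) \<le> D * 50 D n_q / m_q^2, that is, m_q
    \<le> 400 D^2.\<close>
  obtain u :: nat where u: "400 * D\<^sup>2 < u" using reals_Archimedean2 by blast
  define k where "k = Suc u"
  define q where "q = 2 * k + 1"
  have k: "1 \<le> k" by (simp add: k_def)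
  let ?n = "n_seq q" and ?m = "real (m_seq q)"
  have n: "4 \<le> ?n" using n_seq_ge_4 [of q] by (simp add: q_def)
  have "u < m_seq q"
    using less_m_seq_Suc [of "2 * k"] by (simp add: q_def k_def)
  then have m: "400 * D\<^sup>2 < ?m" using u by linarith
  have m0: "0 < ?m" using m_seq_pos by simp
  \<comment> \<open>The first weight is not a code but comes from \<open>N1\<close>, whose
    infinitude lets it exceed n_q^2.\<close>
  obtain j0 where j0: "j0 \<in> N1" "?n ^ 2 \<le> j0"
    using N(3) by (meson infinite_nat_iff_unbounded_le)
  have j01: "1 \<le> j0" using j0(1) N(1) by auto
  have "j0 < m_seq (Suc j0)" by (rule less_m_seq_Suc)
  also have "\<dots> \<le> m_seq (2 * j0)" using j01 by (intro m_seq_mono) auto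
  finally have j02: "?n ^ 2 < m_seq (2 * j0)" using j0(2) by linarith
  obtain a \<phi> J where a: "J 0 = j0" "\<And>l. J (Suc l) = \<sigma> (map vabs (map \<phi> [0..<Suc l]))"
    "\<And>l. exact (2 * J l) (a l) (\<phi> l)" "\<And>l. successive (map \<phi> [0..<l])"
    "\<And>l. Max (supp (a l)) < Min (supp (a (Suc l)))"
    using special_exact_sequence [OF N(1) \<sigma> j01] by blast
  define fs where "fs = map \<phi> [0..<?n]"
  define js where "js = map J [0..<?n]"
  have take_fs: "take i fs = map \<phi> [0..<i]" if "i < ?n" for i
    using that by (simp add: fs_def take_map)
  interpret sf: special_family N1 N2 \<sigma> k q fs js
  proof
    show "averaged N1 \<sigma> (2 * js ! i) (fs ! i)" if "i < ?n" for i
      using a(3) [of i] that by (simp add: exact_def js_def fs_def)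
    show "js ! i = \<sigma> (map vabs (take i fs))" if i: "0 < i" "i < ?n" for i
    proof -
      obtain l where "i = Suc l" using i(1) by (cases i) auto
      with i a(2) [of l] show ?thesis unfolding take_fs [OF i(2)] by (simp add: js_def)
    qed
    show "successive fs" unfolding fs_def by (rule a(4))
    show "js ! 0 \<in> N1" "?n ^ 2 < m_seq (2 * js ! 0)"
      using j0(1) j02 a(1) n by (simp_all add: js_def)
  qed (use N \<sigma> k q_def in \<open>simp_all add: fs_def js_def\<close>)
  have fin: "finite (supp (a l))" "supp (a l) \<noteq> {}" for l
    using a(3) unfolding exact_def by auto
  have less: "n < n'" if "i < i'" "n \<in> supp (a i)" "n' \<in> supp (a i')" for i i' n n'
    using Max_less_Min_chain [of "\<lambda>l. supp (a l)", OF fin a(5) that] .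
  define v where "v l = lin (a l) t" for l
  \<comment> \<open>The factor 1 plays the role of \<open>c\<close> in
    \<open>lin_vsum\<close>.\<close>
  define b where "b = (\<lambda>n. 1 * vsum a {..<?n} n)"
  have bt: "lin b t = vsum v {..<?n}"
    unfolding b_def v_def by (subst lin_vsum) (use fin in auto)
  have bw: "lin b w = vsum (\<lambda>l. lin (a l) w) {..<?n}"
    unfolding b_def by (subst lin_vsum) (use fin in auto)
  have w_blocks: "blocks {..<?n} (\<lambda>l. lin (a l) w)"
    by (rule lin_blocks) (use w_less less in blast)+
  have v_blocks: "blocks {..<?n} v"
    unfolding v_def by (rule lin_blocks) (use t(2) less in blast)+
  have supp_b: "finite (supp b)"
    using finite_subset [OF supp_vsum, of a "{..<?n}"] fin unfolding b_def by simp
  have "ap f (lin b t) \<le> 5 * (10 * D) * ?n / ?m\<^sup>2" if f: "W N1 \<sigma> f" for f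
  proof -
    have "ap f (vsum v {..<?n}) \<le> 5 * (10 * D) * ?n / m_seq q ^ 2"
    proof (rule sf.special_sum_estimate [OF _ v_blocks _ _ _ _ f])
      show "0 \<le> 10 * D" using D by simp
      show "ap f (v i) \<le> 10 * D" if "W N1 \<sigma> f" for f i
        using a(3) [of i] that unfolding exact_def v_def by blast
      show "ap g (v i) \<le> 10 * D / m_seq p"
        if "averaged N1 \<sigma> p g" "i < ?n" "p < 2 * js ! i" for p g i
        using a(3) [of i] that unfolding exact_def v_def js_def by simp
      show "ap g (v i) \<le> 10 * D / m_seq (2 * js ! i)"
        if "averaged N1 \<sigma> p g" "i < ?n" "2 * js ! i < p" for p g i
        using a(3) [of i] that unfolding exact_def v_def js_def by simp
      show "supp (fs ! i) \<inter> supp (v i') = {}" if "i < ?n" for i i'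
      proof -
        have "supp (fs ! i) \<subseteq> (\<Union>n\<in>supp (a i). R n)"
          using a(3) [of i] that unfolding exact_def fs_def by simp
        then show ?thesis
          unfolding v_def using supp_lin [of "a i'" t] disjoint by blast
      qed
    qed
    then show ?thesis unfolding bt by simp
  qed
  then have t_small: "nrm (lin b t) \<le> 5 * (10 * D) * ?n / ?m\<^sup>2"
    by (rule W_norm_le)
  have "1 / 8 \<le> ap (fs ! s) (lin b w)" if s: "s < ?n" for s
  proof -
    have "1 / 8 \<le> ap (\<phi> s) (lin (a s) w)"
      using a(3) [of s] unfolding exact_def by auto
    also have "\<dots> \<le> ap (\<phi> s) (lin b w)"
      unfolding bw using abs_le_abs_vsum [OF _ w_blocks, of s] s W_basic(2) a(3) [of s]
      by (intro ap_mono) (auto simp: exact_def c00_def)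
    finally show ?thesis using s by (simp add: fs_def)
  qed
  then have "(\<Sum>s<?n. 1 / 8) \<le> (\<Sum>s<?n. ap (fs ! s) (lin b w))"
    by (intro sum_mono) auto
  then have "(1 / ?m) * (?n / 8) \<le> (1 / ?m) * (\<Sum>s<?n. ap (fs ! s) (lin b w))"
    by (intro mult_left_mono) auto
  also have "\<dots> = ap (average q fs) (lin b w)"
    unfolding ap_average [OF sf.fs(1)] by (simp add: fs_def)
  also have "\<dots> \<le> nrm (lin b w)"
    by (intro ap_le_W_norm lin_c00 w sf.average_W)
  also have "\<dots> \<le> D * nrm (lin b t)"
    by (rule lower [OF supp_b])
  also have "\<dots> \<le> D * (5 * (10 * D) * ?n / ?m\<^sup>2)"
    using D by (intro mult_left_mono t_small) auto
  finally have "?m \<le> 400 * D\<^sup>2"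
    using n m0 by (simp add: field_simps power2_eq_square)
  with m show False by linarith
qed

section \<open>The completion and its basis\<close>

text \<open>The set F consists of the \<open>l n\<close> and the \<open>Suc (h n)\<close>, so that
  S_F retains exactly the intervals [l n, h n + 1). The gap between the intervals makes these
  \<open>2 * card B\<close> points distinct, and (zeta) asks the least of them to be at least their
  number. As F must be nonempty, an empty \<open>B\<close> is handled by restriction to the empty
  interval.\<close>

lemma zeta_intervals:
  fixes l h :: "nat \<Rightarrow> nat"
  assumes lh: "\<And>n. l n \<le> h n" "\<And>n n'. n < n' \<Longrightarrow> Suc (h n) < l n'"
    and B: "finite B" "\<And>n. n \<in> B \<Longrightarrow> 2 * card B \<le> l n" and f: "W N1 \<sigma> f"
  shows "W N1 \<sigma> (\<lambda>i. 1 / 2 * restr (\<Union>n\<in>B. {l n..h n}) f i)"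
proof (cases "B = {}")
  case True
  have "W N1 \<sigma> (restr {} f)"
    by (intro gamma f) (simp add: nat_interval_def)
  moreover have "restr {} f = (\<lambda>i. 1 / 2 * restr (\<Union>n\<in>B. {l n..h n}) f i)"
    using True by (simp add: restr_def)
  ultimately show ?thesis by simp
next
  case False
  define xs where "xs = sorted_list_of_set B"
  define q where "q = length xs"
  have xs: "set xs = B" "q = card B" using B(1) by (simp_all add: xs_def q_def)
  have xs_less: "xs ! i < xs ! i'" if "i < i'" "i' < q" for i i'
    using that strict_sorted_list_of_set [of B]
    unfolding xs_def [symmetric] q_def sorted_wrt_iff_nth_less by blast
  define ys where "ys = map (\<lambda>i. if even i then l (xs ! (i div 2)) else Suc (h (xs ! (i div 2)))) [0..<2 * q]"
  have len: "length ys = 2 * q" by (simp add: ys_def)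
  have ys_even: "ys ! (2 * p) = l (xs ! p)" and ys_odd: "ys ! (2 * p + 1) = Suc (h (xs ! p))" if "p < q" for p
    using that by (simp_all add: ys_def)
  have ys_ge: "l (xs ! (i div 2)) \<le> ys ! i" "ys ! i \<le> Suc (h (xs ! (i div 2)))" if "i < 2 * q" for i
    using that lh(1) [of "xs ! (i div 2)"] by (simp_all add: ys_def)
  have sorted: "sorted_wrt (<) ys"
    unfolding sorted_wrt_iff_nth_less len
  proof (intro allI impI)
    fix i i' assume i: "i < i'" "i' < 2 * q"
    show "ys ! i < ys ! i'"
    proof (cases "i div 2 = i' div 2")
      case True
      then have "even i" "odd i'" using i(1) by presburger+
      then have "ys ! i = l (xs ! (i div 2))" "ys ! i' = Suc (h (xs ! (i div 2)))"
        using i True by (simp_all add: ys_def)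
      with lh(1) show ?thesis by (simp add: le_imp_less_Suc)
    next
      case False
      then have "i div 2 < i' div 2" using i(1) by presburger
      moreover have "i' div 2 < q" using i(2) by presburger
      ultimately have "Suc (h (xs ! (i div 2))) < l (xs ! (i' div 2))"
        by (intro lh(2) xs_less)
      with ys_ge [of i] ys_ge [of i'] i show ?thesis by linarith
    qed
  qed
  have F: "sorted_list_of_set (set ys) = ys"
    by (metis sorted strict_sorted_equal finite_set set_sorted_list_of_set strict_sorted_list_of_set)
  have card: "card (set ys) = 2 * q"
    using sorted len by (simp add: distinct_card strict_sorted_iff)
  have q0: "0 < q" using xs(2) False B(1) by (simp add: card_gt_0_iff)
  have "2 * q \<le> y" if y: "y \<in> set ys" for y
  proof -
    obtain i where i: "i < 2 * q" "y = ys ! i" using y len by (metis in_set_conv_nth)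
    have "i div 2 < q" using i(1) by presburger
    then have "xs ! (i div 2) \<in> B" using xs(1) q_def by (metis nth_mem)
    then have "2 * q \<le> l (xs ! (i div 2))" using B(2) xs(2) by simp
    with ys_ge(1) [OF i(1)] i(2) show ?thesis by simp
  qed
  moreover have ne: "set ys \<noteq> {}" using card q0 by auto
  ultimately have Min: "2 * q \<le> Min (set ys)" by simp
  have "(\<Union>p<card (set ys) div 2. {ys ! (2 * p)..<ys ! (2 * p + 1)}) = (\<Union>p<q. {l (xs ! p)..h (xs ! p)})"
    unfolding card using ys_even ys_odd by (intro SUP_cong) auto
  also have "\<dots> = (\<Union>n\<in>set xs. {l n..h n})"
    unfolding set_conv_nth q_def by auto
  finally have "S_op (set ys) f = restr (\<Union>n\<in>B. {l n..h n}) f"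
    unfolding S_op_def F xs(1) by simp
  with zeta [OF f finite_set ne card Min] show ?thesis by simp
qed

section \<open>The unit vectors as an unconditional basis of the completion\<close>

lemma c00_diff: "u \<in> c00 \<Longrightarrow> v \<in> c00 \<Longrightarrow> (\<lambda>i. u i - v i) \<in> c00"
proof -
  assume "u \<in> c00" "v \<in> c00"
  moreover have "supp (\<lambda>i. u i - v i) \<subseteq> supp u \<union> supp v" by (auto simp: supp_def)
  ultimately show ?thesis
    by (auto simp: c00_def intro: finite_subset)
qed

lemma subspace_closure:
  fixes S :: "'a::real_normed_vector set"
  assumes "subspace S"
  shows "subspace (closure S)"
proof (rule subspaceI)
  show "0 \<in> closure S"
    using closure_subset subspace_0 [OF assms] by blast
  fix x y c assume "x \<in> closure S"
  then obtain f where f: "\<forall>n. f n \<in> S" "f \<longlonglongrightarrow> x"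
    unfolding closure_sequential by blast
  have "(\<lambda>n. c *\<^sub>R f n) \<longlonglongrightarrow> c *\<^sub>R x"
    by (intro tendsto_intros f)
  with f(1) show "c *\<^sub>R x \<in> closure S"
    unfolding closure_sequential
    by (intro exI [of _ "\<lambda>n. c *\<^sub>R f n"] conjI allI subspace_scale [OF assms]) auto
  assume "y \<in> closure S"
  then obtain g where g: "\<forall>n. g n \<in> S" "g \<longlonglongrightarrow> y"
    unfolding closure_sequential by blast
  have "(\<lambda>n. f n + g n) \<longlonglongrightarrow> x + y"
    by (intro tendsto_intros f g)
  with f(1) g(1) show "x + y \<in> closure S"
    unfolding closure_sequential
    by (intro exI [of _ "\<lambda>n. f n + g n"] conjI allI subspace_add [OF assms]) auto
qed

locale W_completion =
  fixes N1 :: "nat set" and \<sigma> :: "(nat \<Rightarrow> real) list \<Rightarrow> nat"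
    and \<iota> :: "(nat \<Rightarrow> real) \<Rightarrow> 'a::banach" and X :: "'a set"
  assumes completion: "is_completion (W_norm N1 \<sigma>) \<iota> X"
begin

definition e :: "nat \<Rightarrow> 'a" where "e n = \<iota> (unit_vec n)"

lemma iota_add: "x \<in> c00 \<Longrightarrow> y \<in> c00 \<Longrightarrow> \<iota> (\<lambda>i. x i + y i) = \<iota> x + \<iota> y"
  and iota_scale: "x \<in> c00 \<Longrightarrow> \<iota> (\<lambda>i. c * x i) = c *\<^sub>R \<iota> x"
  and norm_iota: "x \<in> c00 \<Longrightarrow> norm (\<iota> x) = W_norm N1 \<sigma> x"
  and X_eq: "X = closure (\<iota> ` c00)"
  using completion unfolding is_completion_def by auto

lemma iota_zero: "\<iota> (\<lambda>i. 0) = 0"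
  using iota_scale [of "\<lambda>i. 0" 0] by (simp add: c00_def supp_def)

lemma iota_diff: "x \<in> c00 \<Longrightarrow> y \<in> c00 \<Longrightarrow> \<iota> (\<lambda>i. x i - y i) = \<iota> x - \<iota> y"
  using iota_add [of x "\<lambda>i. -1 * y i"] iota_scale [of y "-1"] c00_scale [of y "-1"] by simp

lemma iota_vsum: "finite J \<Longrightarrow> (\<And>k. k \<in> J \<Longrightarrow> z k \<in> c00) \<Longrightarrow> \<iota> (vsum z J) = (\<Sum>k\<in>J. \<iota> (z k))"
proof (induction J rule: finite_induct)
  case (insert k J)
  have "vsum z (insert k J) = (\<lambda>i. z k i + vsum z J i)"
    using insert by (simp add: vsum_def)
  then show ?case
    using insert c00_vsum [of J z] by (simp add: iota_add)
qed (simp add: vsum_def iota_zero)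

lemma iota_lin:
  assumes "finite (supp a)" "\<And>n. w n \<in> c00"
  shows "\<iota> (lin a w) = (\<Sum>n\<in>supp a. a n *\<^sub>R \<iota> (w n))"
  unfolding lin_def using assms by (simp add: iota_vsum iota_scale c00_scale)

lemma norm_iota_mono:
  assumes "z \<in> c00" "z' \<in> c00" "\<And>i. \<bar>z i\<bar> \<le> \<bar>z' i\<bar>"
  shows "norm (\<iota> z) \<le> norm (\<iota> z')"
  using assms by (simp add: norm_iota W_norm_mono)

lemma coord_le_norm_iota:
  assumes "z \<in> c00" shows "\<bar>z i\<bar> \<le> norm (\<iota> z)"
proof (cases "i = 0")
  case False
  then show ?thesis
    using ap_le_W_norm [OF assms beta_pos, of i N1 \<sigma>] assms by (simp add: norm_iota ap_unit_vec)
qed (use assms in \<open>simp add: c00_def\<close>)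

lemma unit_vec_c00: "1 \<le> n \<Longrightarrow> unit_vec n \<in> c00"
  using W_c00 beta_pos by blast

lemma norm_e: "1 \<le> n \<Longrightarrow> norm (e n) \<le> 1"
proof -
  assume n: "1 \<le> n"
  have "W_norm N1 \<sigma> (unit_vec n) \<le> 1"
  proof (rule W_norm_le)
    fix f assume f: "W N1 \<sigma> f"
    have "ap f (unit_vec n) \<le> (\<Sum>i\<in>supp (unit_vec n). \<bar>unit_vec n i\<bar>)"
      by (rule W_ap_le_l1 [OF unit_vec_c00 [OF n] f])
    also have "supp (unit_vec n) = {n}" by (auto simp: supp_def unit_vec_def)
    finally show "ap f (unit_vec n) \<le> 1" by (simp add: unit_vec_def)
  qed
  then show ?thesis using n by (simp add: e_def norm_iota unit_vec_c00)
qed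

lemma restr_c00: "finite E \<Longrightarrow> a 0 = 0 \<Longrightarrow> restr E a \<in> c00"
  unfolding c00_def supp_def restr_def by (auto elim: rev_finite_subset)

lemma iota_restr:
  assumes "finite E" "a 0 = 0"
  shows "\<iota> (restr E a) = (\<Sum>n\<in>E. a n *\<^sub>R e n)"
proof -
  let ?z = "\<lambda>n i. a n * unit_vec n i"
  have z: "?z n \<in> c00" for n
  proof (cases "n = 0")
    case True
    then show ?thesis using assms(2) by (simp add: c00_def supp_def)
  qed (simp add: unit_vec_c00 c00_scale)
  have "restr E a = vsum ?z E"
  proof
    fix i show "restr E a i = vsum ?z E i"
      using assms(1) unfolding vsum_def unit_vec_def restr_def
      by (simp add: if_distrib [of "\<lambda>x. _ * x"] cong: if_cong)
  qed
  then have "\<iota> (restr E a) = (\<Sum>n\<in>E. \<iota> (?z n))"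
    using assms(1) z by (simp add: iota_vsum)
  also have "\<dots> = (\<Sum>n\<in>E. a n *\<^sub>R e n)"
  proof (rule sum.cong)
    fix n
    show "\<iota> (?z n) = a n *\<^sub>R e n"
      using assms(2) by (cases "n = 0") (simp_all add: iota_zero iota_scale unit_vec_c00 e_def)
  qed simp
  finally show ?thesis .
qed

lemma expansion_iff: "expansion e x a \<longleftrightarrow> a 0 = 0 \<and> (\<lambda>N. \<iota> (restr {1..N} a)) \<longlonglongrightarrow> x"
  unfolding expansion_def using iota_restr by (auto cong: conj_cong)

text \<open>Unconditionality with constant 1: the norm on \<open>c00\<close> is monotone in absolute
  values, so late partial sums dominate every finite restriction. Bounded coordinates and uniqueness
  of expansions follow.\<close>

lemma expansion_norm_restr:
  assumes x: "expansion e x a" and E: "finite E"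
  shows "norm (\<iota> (restr E a)) \<le> norm x"
proof (rule LIMSEQ_le_const)
  have a0: "a 0 = 0" and lim: "(\<lambda>N. \<iota> (restr {1..N} a)) \<longlonglongrightarrow> x"
    using x by (auto simp: expansion_iff)
  show "(\<lambda>N. norm (\<iota> (restr {1..N} a))) \<longlonglongrightarrow> norm x"
    by (rule tendsto_norm [OF lim])
  show "\<exists>M. \<forall>N\<ge>M. norm (\<iota> (restr E a)) \<le> norm (\<iota> (restr {1..N} a))"
  proof (intro exI allI impI norm_iota_mono restr_c00 E a0)
    fix N i assume N: "Max (insert 0 E) \<le> N"
    have "i \<le> N" if "i \<in> E" using N E that by (simp add: Max_ge order_trans)
    then show "\<bar>restr E a i\<bar> \<le> \<bar>restr {1..N} a i\<bar>"
      using a0 by (cases "i = 0") (auto simp: restr_def)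
  qed simp
qed

lemma expansion_coord_le:
  assumes "expansion e x a" shows "\<bar>a i\<bar> \<le> norm x"
proof -
  have "a 0 = 0" using assms by (simp add: expansion_iff)
  then have "\<bar>restr {i} a i\<bar> \<le> norm (\<iota> (restr {i} a))"
    by (intro coord_le_norm_iota restr_c00) auto
  with expansion_norm_restr [OF assms, of "{i}"] show ?thesis by (simp add: restr_def)
qed

lemma expansion_diff:
  assumes "expansion e x a" "expansion e y b"
  shows "expansion e (x - y) (\<lambda>i. a i - b i)"
  using assms tendsto_diff unfolding expansion_def
  by (auto simp: scaleR_diff_left sum_subtractf)

lemma expansion_scale: "expansion e x a \<Longrightarrow> expansion e (c *\<^sub>R x) (\<lambda>i. c * a i)"
  unfolding expansion_def
  using tendsto_scaleR [OF tendsto_const] by (force simp: scaleR_sum_right)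

lemma expansion_unique:
  assumes "expansion e x a" "expansion e x b" shows "a = b"
  using expansion_coord_le [OF expansion_diff [OF assms]] by auto

lemma expansion_iota: "z \<in> c00 \<Longrightarrow> expansion e (\<iota> z) z"
proof -
  assume z: "z \<in> c00"
  have "restr {1..N} z = z" if "Max (insert 0 (supp z)) \<le> N" for N
  proof
    fix i
    have "i \<le> N" if "z i \<noteq> 0"
      using \<open>Max (insert 0 (supp z)) \<le> N\<close> z that by (simp add: c00_def supp_def)
    then show "restr {1..N} z i = z i"
      using z by (cases "i = 0") (auto simp: restr_def c00_def)
  qed
  then have "eventually (\<lambda>N. \<iota> (restr {1..N} z) = \<iota> z) sequentially"
    unfolding eventually_sequentially by metis
  then show ?thesis
    unfolding expansion_iff using z by (auto simp: c00_def intro: tendsto_eventually)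
qed

lemma expansion_exists:
  assumes "x \<in> X" shows "\<exists>a. expansion e x a"
proof -
  obtain s where s: "\<And>k. s k \<in> \<iota> ` c00" "s \<longlonglongrightarrow> x"
    using assms unfolding X_eq closure_sequential by blast
  have "\<exists>z. \<forall>k. z k \<in> c00 \<and> s k = \<iota> (z k)"
    using s(1) by (intro choice) (auto elim: imageE)
  then obtain z where z: "\<And>k. z k \<in> c00" "\<And>k. s k = \<iota> (z k)" by blast
  have "s = (\<lambda>k. \<iota> (z k))" using z(2) by (rule ext)
  with s(2) have lim: "(\<lambda>k. \<iota> (z k)) \<longlonglongrightarrow> x" by simp
  have Cauchy: "Cauchy (\<lambda>k. z k n)" for n
    unfolding Cauchy_def
  proof (intro allI impI)
    fix r :: real assume "0 < r"
    then obtain M where "\<forall>k\<ge>M. \<forall>l\<ge>M. dist (\<iota> (z k)) (\<iota> (z l)) < r"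
      using LIMSEQ_imp_Cauchy [OF lim] unfolding Cauchy_def by blast
    moreover have "dist (z k n) (z l n) \<le> dist (\<iota> (z k)) (\<iota> (z l))" for k l
      using coord_le_norm_iota [of "\<lambda>i. z k i - z l i" n] z(1)
      by (simp add: dist_norm iota_diff c00_diff)
    ultimately show "\<exists>M. \<forall>k\<ge>M. \<forall>l\<ge>M. dist (z k n) (z l n) < r"
      by (meson le_less_trans)
  qed
  define a where "a n = lim (\<lambda>k. z k n)" for n
  have a: "(\<lambda>k. z k n) \<longlonglongrightarrow> a n" for n
    unfolding a_def by (intro convergent_LIMSEQ_iff [THEN iffD1] Cauchy_convergent Cauchy)
  have a0: "a 0 = 0"
    using a [of 0] z(1) by (simp add: c00_def LIMSEQ_const_iff)
  \<comment> \<open>Removing the first \<open>N\<close> coordinates does not increase the norm of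
    z_k - z_l. Letting l tend to infinity bounds the remainder of \<open>x\<close> after
    \<open>N\<close> terms by that of \<open>z k\<close>, uniformly in \<open>N\<close>.\<close>
  have tail: "norm ((\<iota> (z k) - \<iota> (restr {1..N} (z k))) - (x - \<iota> (restr {1..N} a))) \<le> norm (\<iota> (z k) - x)" for k N
  proof (rule LIMSEQ_le)
    have "(\<lambda>l. \<Sum>n=1..N. z l n *\<^sub>R e n) \<longlonglongrightarrow> (\<Sum>n=1..N. a n *\<^sub>R e n)"
      by (intro tendsto_intros a)
    then have "(\<lambda>l. \<iota> (restr {1..N} (z l))) \<longlonglongrightarrow> \<iota> (restr {1..N} a)"
      using z(1) a0 by (simp add: iota_restr c00_def)
    then show "(\<lambda>l. norm ((\<iota> (z k) - \<iota> (restr {1..N} (z k))) - (\<iota> (z l) - \<iota> (restr {1..N} (z l))))) \<longlonglongrightarrow>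
        norm ((\<iota> (z k) - \<iota> (restr {1..N} (z k))) - (x - \<iota> (restr {1..N} a)))"
      by (intro tendsto_intros lim)
    show "(\<lambda>l. norm (\<iota> (z k) - \<iota> (z l))) \<longlonglongrightarrow> norm (\<iota> (z k) - x)"
      by (intro tendsto_intros lim)
    have "norm ((\<iota> (z k) - \<iota> (restr {1..N} (z k))) - (\<iota> (z l) - \<iota> (restr {1..N} (z l)))) \<le>
        norm (\<iota> (z k) - \<iota> (z l))" for l
    proof -
      let ?c = "\<lambda>v i. v i - restr {1..N} v i :: real"
      have r: "restr {1..N} (z k) \<in> c00" for k using z(1) by (intro restr_c00) (auto simp: c00_def)
      have c: "?c (z k) \<in> c00" for k by (rule c00_subset [OF z(1) [of k]]) (simp add: restr_def)
      have "(\<iota> (z k) - \<iota> (restr {1..N} (z k))) - (\<iota> (z l) - \<iota> (restr {1..N} (z l))) =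
          \<iota> (\<lambda>i. ?c (z k) i - ?c (z l) i)"
        using z(1) r c by (simp add: iota_diff)
      also have "norm \<dots> \<le> norm (\<iota> (\<lambda>i. z k i - z l i))"
        using z(1) r by (intro norm_iota_mono c00_diff) (auto simp: restr_def)
      also have "\<iota> (\<lambda>i. z k i - z l i) = \<iota> (z k) - \<iota> (z l)" using z(1) by (simp add: iota_diff)
      finally show ?thesis .
    qed
    then show "\<exists>M. \<forall>l\<ge>M. norm ((\<iota> (z k) - \<iota> (restr {1..N} (z k))) - (\<iota> (z l) - \<iota> (restr {1..N} (z l)))) \<le>
        norm (\<iota> (z k) - \<iota> (z l))" by blast
  qed
  have "(\<lambda>N. \<iota> (restr {1..N} a)) \<longlonglongrightarrow> x"
  proof (rule LIMSEQ_I)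
    fix r :: real assume r: "0 < r"
    then obtain k where k: "norm (\<iota> (z k) - x) < r / 2"
      using LIMSEQ_D [OF lim, of "r / 2"] by auto
    have "(\<lambda>N. \<iota> (restr {1..N} (z k))) \<longlonglongrightarrow> \<iota> (z k)"
      using expansion_iota [OF z(1) [of k]] by (simp add: expansion_iff)
    then obtain M where M: "\<And>N. M \<le> N \<Longrightarrow> norm (\<iota> (restr {1..N} (z k)) - \<iota> (z k)) < r / 2"
      using LIMSEQ_D [of _ _ "r / 2"] r by (metis half_gt_zero)
    show "\<exists>M. \<forall>N\<ge>M. norm (\<iota> (restr {1..N} a) - x) < r"
    proof (intro exI allI impI)
      fix N assume "M \<le> N"
      have eq: "\<iota> (restr {1..N} a) - x = ((\<iota> (z k) - \<iota> (restr {1..N} (z k))) - (x - \<iota> (restr {1..N} a)))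
          + (\<iota> (restr {1..N} (z k)) - \<iota> (z k))" by simp
      have "norm (\<iota> (restr {1..N} a) - x) \<le> norm (\<iota> (z k) - x) + norm (\<iota> (restr {1..N} (z k)) - \<iota> (z k))"
        unfolding eq by (intro norm_triangle_le add_right_mono tail)
      then show "norm (\<iota> (restr {1..N} a) - x) < r" using k M [OF \<open>M \<le> N\<close>] by linarith
    qed
  qed
  then show ?thesis using a0 by (auto simp: expansion_iff)
qed

lemma subspace_X: "subspace X"
proof -
  have "subspace (\<iota> ` c00)"
    unfolding subspace_def
  proof (intro conjI ballI allI)
    show "0 \<in> \<iota> ` c00"
      using iota_zero by (intro image_eqI [of _ _ "\<lambda>i. 0"]) (auto simp: c00_def supp_def)
    show "x + y \<in> \<iota> ` c00" if xy: "x \<in> \<iota> ` c00" "y \<in> \<iota> ` c00" for x y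
    proof -
      obtain u v where "u \<in> c00" "v \<in> c00" "x = \<iota> u" "y = \<iota> v" using xy by blast
      then have "x + y = \<iota> (\<lambda>i. u i + v i)" "(\<lambda>i. u i + v i) \<in> c00"
        using c00_diff [of u "\<lambda>i. -1 * v i"] c00_scale [of v "-1"] by (simp_all add: iota_add)
      then show ?thesis by blast
    qed
    show "c *\<^sub>R x \<in> \<iota> ` c00" if "x \<in> \<iota> ` c00" for c x
      using that iota_scale c00_scale by (metis image_iff)
  qed
  then show ?thesis unfolding X_eq by (rule subspace_closure)
qed

lemma schauder: "schauder_basis X e"
  unfolding schauder_basis_def
proof (intro conjI subspace_X allI impI ballI)
  show "closed X" by (simp add: X_eq)
  show "e n \<in> X" if "1 \<le> n" for n
    unfolding X_eq e_def by (intro subsetD [OF closure_subset] imageI unit_vec_c00 that)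
  show "\<exists>!a. expansion e x a" if "x \<in> X" for x
    using expansion_exists [OF that] expansion_unique by blast
qed

lemma coords_eq: "expansion e x a \<Longrightarrow> coords e x = a"
  unfolding coords_def using expansion_unique by blast

lemma expansion_coords: "x \<in> X \<Longrightarrow> expansion e x (coords e x)"
  using expansion_exists coords_eq by metis

lemma iota_coords:
  assumes "x \<in> X" "finite (support e x)"
  shows "coords e x \<in> c00" "\<iota> (coords e x) = x"
proof -
  have x: "expansion e x (coords e x)" by (rule expansion_coords [OF assms(1)])
  then show c: "coords e x \<in> c00"
    using assms(2) by (simp add: c00_def support_def expansion_iff)
  show "\<iota> (coords e x) = x"
    using expansion_iota [OF c] x LIMSEQ_unique unfolding expansion_iff by blast
qed

end

section \<open>The gliding hump\<close>

text \<open>Pigeonhole on one coordinate at a time, with the cells of a grid of mesh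
  \<epsilon>.\<close>

lemma infinite_subset_close:
  fixes \<beta> :: "nat \<Rightarrow> nat \<Rightarrow> real"
  assumes \<beta>: "\<And>n i. \<bar>\<beta> n i\<bar> \<le> K" and \<epsilon>: "0 < \<epsilon>"
  shows "\<exists>A. infinite A \<and> (\<forall>a\<in>A. \<forall>b\<in>A. \<forall>i<N. \<bar>\<beta> a i - \<beta> b i\<bar> \<le> \<epsilon>)"
proof (induction N)
  case 0
  show ?case by (intro exI [of _ UNIV]) simp
next
  case (Suc N)
  then obtain A where A: "infinite A" "\<And>a b i. a \<in> A \<Longrightarrow> b \<in> A \<Longrightarrow> i < N \<Longrightarrow> \<bar>\<beta> a i - \<beta> b i\<bar> \<le> \<epsilon>"
    by blast
  define f where "f n = \<lfloor>\<beta> n N / \<epsilon>\<rfloor>" for n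
  have "f ` A \<subseteq> {\<lfloor>- K / \<epsilon>\<rfloor>..\<lfloor>K / \<epsilon>\<rfloor>}"
  proof (intro image_subsetI)
    fix n
    have "- K / \<epsilon> \<le> \<beta> n N / \<epsilon>" "\<beta> n N / \<epsilon> \<le> K / \<epsilon>"
      using \<beta> [of n N] \<epsilon> by (intro divide_right_mono; linarith)+
    then show "f n \<in> {\<lfloor>- K / \<epsilon>\<rfloor>..\<lfloor>K / \<epsilon>\<rfloor>}"
      unfolding f_def by (simp add: floor_mono)
  qed
  then have "finite (f ` A)" by (rule finite_subset) simp
  then obtain a0 where a0: "a0 \<in> A" "infinite {a \<in> A. f a = f a0}"
    using pigeonhole_infinite [OF A(1)] by blast
  have "\<bar>\<beta> a i - \<beta> b i\<bar> \<le> \<epsilon>"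
    if ab: "a \<in> A" "f a = f a0" "b \<in> A" "f b = f a0" and i: "i < Suc N" for a b i
  proof (cases "i < N")
    case False
    then have [simp]: "i = N" using i by simp
    have "\<bar>\<beta> a N / \<epsilon> - \<beta> b N / \<epsilon>\<bar> \<le> 1"
      using ab floor_correct [of "\<beta> a N / \<epsilon>"] floor_correct [of "\<beta> b N / \<epsilon>"]
      unfolding f_def by linarith
    then show ?thesis
      using \<epsilon> by (simp add: diff_divide_distrib [symmetric])
  qed (use A(2) ab in auto)
  then show ?case
    using a0(2) by (intro exI [of _ "{a \<in> A. f a = f a0}"]) auto
qed

context W_completion
begin

text \<open>Passing to differences makes the first coordinates small without any weak convergence of
  the sequence \<open>y\<close>.\<close>

lemma hump:
  fixes y :: "nat \<Rightarrow> 'a"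
  assumes y: "\<And>n. y n \<in> X" "\<And>n. norm (y n) \<le> K" and \<epsilon>: "0 < \<epsilon>"
  shows "\<exists>a b u'. n0 \<le> a \<and> a < b \<and>
    norm ((1 / 2) *\<^sub>R (y a - y b) - \<iota> (restr {u<..u'} (coords e ((1 / 2) *\<^sub>R (y a - y b))))) \<le> \<epsilon>"
proof -
  \<comment> \<open>The first \<open>u\<close> coordinates of half the difference contribute at most
    \<delta>/2 each, as unit vectors have norm at most 1. The 1 in the denominator covers
    \<open>u = 0\<close>.\<close>
  define \<delta> where "\<delta> = \<epsilon> / (real u + 1)"
  have \<delta>: "0 < \<delta>" "real u * \<delta> \<le> \<epsilon>" using \<epsilon> by (simp_all add: \<delta>_def field_simps)
  have exp: "expansion e (y n) (coords e (y n))" for n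
    by (intro expansion_coords y)
  have "\<bar>coords e (y n) i\<bar> \<le> K" for n i
    using expansion_coord_le [OF exp, of n i] y(2) [of n] by linarith
  from infinite_subset_close [of "\<lambda>n. coords e (y n)", OF this \<delta>(1), of "Suc u"]
  obtain A where A: "infinite A"
    "\<And>a b i. a \<in> A \<Longrightarrow> b \<in> A \<Longrightarrow> i \<le> u \<Longrightarrow> \<bar>coords e (y a) i - coords e (y b) i\<bar> \<le> \<delta>"
    by (auto simp: less_Suc_eq_le)
  obtain a where a: "a \<in> A" "n0 \<le> a" using A(1) by (meson infinite_nat_iff_unbounded_le)
  obtain b where b: "b \<in> A" "a < b" using A(1) by (meson infinite_nat_iff_unbounded)
  define g where "g = (1 / 2) *\<^sub>R (y a - y b)"
  define \<gamma> where "\<gamma> = (\<lambda>i. 1 / 2 * (coords e (y a) i - coords e (y b) i))"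
  have g: "expansion e g \<gamma>"
    unfolding g_def \<gamma>_def by (intro expansion_scale expansion_diff exp)
  then have \<gamma>0: "\<gamma> 0 = 0" and lim: "(\<lambda>N. \<iota> (restr {1..N} \<gamma>)) \<longlonglongrightarrow> g" by (simp_all add: expansion_iff)
  obtain M where M: "\<And>N. M \<le> N \<Longrightarrow> norm (\<iota> (restr {1..N} \<gamma>) - g) < \<epsilon> / 2"
    using LIMSEQ_D [OF lim, of "\<epsilon> / 2"] \<epsilon> by auto
  define u' where "u' = max M u"
  have "norm (\<iota> (restr {1..u} \<gamma>)) \<le> (\<Sum>n=1..u. norm (\<gamma> n *\<^sub>R e n))"
    using iota_restr [of "{1..u}" \<gamma>] \<gamma>0 by (simp only: finite_atLeastAtMost norm_sum)
  also have "\<dots> \<le> (\<Sum>n=1..u. \<delta> / 2)"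
  proof (rule sum_mono)
    fix n assume n: "n \<in> {1..u}"
    have "\<bar>\<gamma> n\<bar> * norm (e n) \<le> \<delta> / 2 * 1"
      using A(2) [of a b n] a b n norm_e [of n] \<delta>(1) by (intro mult_mono) (auto simp: \<gamma>_def abs_mult)
    then show "norm (\<gamma> n *\<^sub>R e n) \<le> \<delta> / 2" by simp
  qed
  also have "\<dots> \<le> \<epsilon> / 2" using \<delta>(2) by simp
  finally have head: "norm (\<iota> (restr {1..u} \<gamma>)) \<le> \<epsilon> / 2" .
  have "\<iota> (restr {1..u'} \<gamma>) = \<iota> (restr {1..u} \<gamma>) + \<iota> (restr {u<..u'} \<gamma>)"
  proof -
    have "{1..u'} = {1..u} \<union> {u<..u'}" "{1..u} \<inter> {u<..u'} = {}" by (auto simp: u'_def)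
    then have "(\<Sum>n=1..u'. \<gamma> n *\<^sub>R e n) = (\<Sum>n=1..u. \<gamma> n *\<^sub>R e n) + (\<Sum>n\<in>{u<..u'}. \<gamma> n *\<^sub>R e n)"
      by (simp only: sum.union_disjoint finite_atLeastAtMost finite_greaterThanAtMost)
    then show ?thesis using \<gamma>0 by (simp only: iota_restr finite_atLeastAtMost finite_greaterThanAtMost)
  qed
  then have eq: "g - \<iota> (restr {u<..u'} \<gamma>) = \<iota> (restr {1..u} \<gamma>) - (\<iota> (restr {1..u'} \<gamma>) - g)"
    by simp
  have "norm (g - \<iota> (restr {u<..u'} \<gamma>)) \<le> norm (\<iota> (restr {1..u} \<gamma>)) + norm (\<iota> (restr {1..u'} \<gamma>) - g)"
    unfolding eq by (rule norm_triangle_ineq4)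
  also have "\<dots> \<le> \<epsilon>" using head M [of u', OF max.cobounded1 [of M u, folded u'_def]] by linarith
  finally show ?thesis
    using a(2) b(2) coords_eq [OF g] unfolding g_def by (intro exI [of _ a] exI [of _ b] exI [of _ u']) simp
qed

lemma hump_sequence:
  fixes y :: "nat \<Rightarrow> 'a"
  assumes y: "\<And>n. y n \<in> X" "\<And>n. norm (y n) \<le> K" and \<epsilon>: "\<And>k. 0 < \<epsilon> k"
  obtains a b u u' where "\<And>k. a k < b k" "\<And>k. b k < a (Suc k)" "\<And>k. u k \<le> u' k" "\<And>k. u' k \<le> u (Suc k)"
    "\<And>k. norm ((1 / 2) *\<^sub>R (y (a k) - y (b k)) -
      \<iota> (restr {u k<..u' k} (coords e ((1 / 2) *\<^sub>R (y (a k) - y (b k)))))) \<le> \<epsilon> k"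
proof -
  let ?P = "\<lambda>(k::nat) (a, b, u, u'). a < b \<and> u \<le> u' \<and>
    norm ((1 / 2) *\<^sub>R (y a - y b) - \<iota> (restr {u<..u'} (coords e ((1 / 2) *\<^sub>R (y a - y b))))) \<le> \<epsilon> k"
  let ?Q = "\<lambda>(k::nat) (a, b, u::nat, u') (a'::nat, b'::nat, v, v'::nat). b < a' \<and> u' \<le> v"
  have ex: "\<exists>x. ?P k x \<and> n0 \<le> fst x \<and> fst (snd (snd x)) = u" for k n0 u
  proof -
    obtain a b u' where h: "n0 \<le> a" "a < b"
      "norm ((1 / 2) *\<^sub>R (y a - y b) - \<iota> (restr {u<..u'} (coords e ((1 / 2) *\<^sub>R (y a - y b))))) \<le> \<epsilon> k"
      using hump [where y = y and K = K and \<epsilon> = "\<epsilon> k" and ?n0.0 = n0 and u = u, OF y \<epsilon>]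
      by (elim exE conjE)
    \<comment> \<open>If \<open>u' < u\<close> the truncation is empty, so raising \<open>u'\<close>
      to the maximum does not change it and secures the order of the endpoints.\<close>
    have "{u<..u'} = {u<..max u u'}" by auto
    with h show ?thesis
      by (intro exI [of _ "(a, b, u, max u u')"]) simp
  qed
  have "\<exists>f. \<forall>k. ?P k (f k) \<and> ?Q k (f k) (f (Suc k))"
  proof (rule dependent_nat_choice)
    show "\<exists>x. ?P 0 x" using ex [of 0 0 0] by (elim exE conjE) (rule exI)
  next
    fix x k assume "?P k x"
    obtain z where "?P (Suc k) z \<and> Suc (fst (snd x)) \<le> fst z \<and> fst (snd (snd z)) = snd (snd (snd x))"
      using ex [of "Suc k" "Suc (fst (snd x))" "snd (snd (snd x))"] by (elim exE)
    then show "\<exists>z. ?P (Suc k) z \<and> ?Q k x z"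
      by (intro exI [of _ z]) (auto simp: case_prod_unfold)
  qed
  then obtain f where f: "\<forall>k. ?P k (f k) \<and> ?Q k (f k) (f (Suc k))" by (rule exE)
  show ?thesis
    by (rule that [of "\<lambda>k. fst (f k)" "\<lambda>k. fst (snd (f k))" "\<lambda>k. fst (snd (snd (f k)))" "\<lambda>k. snd (snd (snd (f k)))"])
      (use f in \<open>auto simp: case_prod_unfold\<close>)
qed

lemma no_embedding:
  fixes c :: "nat \<Rightarrow> nat \<Rightarrow> real" and l h :: "nat \<Rightarrow> nat" and T :: "'a \<Rightarrow> 'a" and K :: real
  assumes c: "\<And>n. c n \<in> c00" "\<And>n. supp (c n) \<subseteq> {l n..h n}" "\<And>n. norm (\<iota> (c n)) = 1"
    and lh: "\<And>n. l n \<le> h n" "\<And>n n'. n < n' \<Longrightarrow> Suc (h n) < l n'"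
    and Y: "subspace Y" "\<And>n. \<iota> (c n) \<in> Y"
    and T: "\<And>x y. x \<in> Y \<Longrightarrow> y \<in> Y \<Longrightarrow> T (x + y) = T x + T y" "\<And>r x. x \<in> Y \<Longrightarrow> T (r *\<^sub>R x) = r *\<^sub>R T x"
    and K: "1 \<le> K" "\<And>x. x \<in> Y \<Longrightarrow> norm (T x) \<le> K * norm x" "\<And>x. x \<in> Y \<Longrightarrow> norm x \<le> K * norm (T x)"
    and Z: "subspace Z" "Z \<subseteq> X" "\<And>x. x \<in> Y \<Longrightarrow> T x \<in> Z" "\<And>z n. z \<in> Z \<Longrightarrow> support e z \<inter> {l n..h n} = {}"
    and N: "N1 \<union> N2 = {1..}" "N1 \<inter> N2 = {}" "infinite N1" and \<sigma>: "coding_function N2 \<sigma>"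
  shows False
proof -
  define p where "p n = \<iota> (c n)" for n
  define y where "y n = T (p n)" for n
  define I where "I n = {l n..h n}" for n
  have pY: "p n \<in> Y" for n using Y(2) by (simp add: p_def)
  have yZ: "y n \<in> Z" for n using Z(3) pY by (simp add: y_def)
  have yX: "y n \<in> X" for n using yZ Z(2) by (rule rev_subsetD)
  have yK: "norm (y n) \<le> K" for n
    using K(2) [OF pY [of n]] c(3) [of n] by (simp add: y_def p_def)
  \<comment> \<open>The truncation errors will sum to 4 \<eta> times the norm of the combination: a
    factor 2 comes from \<open>coef\<close> and another from the geometric series. As 4 \<eta> K =
    1/2, half of that norm remains in the lower estimate, and K becomes 2 K.\<close>
  define \<eta> where "\<eta> = 1 / (8 * K)"
  have \<eta>: "0 < \<eta>" "4 * \<eta> * K = 1 / 2" "4 * \<eta> \<le> K" using K(1) order_trans [of "1 / K" 1 K] by (simp_all add: \<eta>_def divide_simps)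
  have \<epsilon>0: "0 < \<eta> * (1 / 2) ^ k" for k :: nat using \<eta>(1) by simp
  obtain a b u u' where hs: "\<And>k. a k < b k" "\<And>k. b k < a (Suc k)" "\<And>k. u k \<le> u' k" "\<And>k. u' k \<le> u (Suc k)"
    "\<And>k. norm ((1 / 2) *\<^sub>R (y (a k) - y (b k)) -
      \<iota> (restr {u k<..u' k} (coords e ((1 / 2) *\<^sub>R (y (a k) - y (b k)))))) \<le> \<eta> * (1 / 2) ^ k"
    by (rule hump_sequence [of y K "\<lambda>k. \<eta> * (1 / 2) ^ k", OF yX yK \<epsilon>0]) (rule that; blast)
  define g where "g k = (1 / 2) *\<^sub>R (y (a k) - y (b k))" for k
  define \<gamma> where "\<gamma> k = coords e (g k)" for k
  define t where "t k = restr {u k<..u' k} (\<gamma> k)" for k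
  define w where "w k = (\<lambda>i. 1 / 2 * (c (a k) i - c (b k) i))" for k
  define R where "R k = I (a k) \<union> I (b k)" for k
  have gt: "norm (g k - \<iota> (t k)) \<le> \<eta> * (1 / 2) ^ k" for k
    using hs(5) [of k] by (simp add: g_def \<gamma>_def t_def)
  have gZ: "g k \<in> Z" for k
    unfolding g_def by (intro subspace_scale subspace_diff Z(1) yZ)
  have \<gamma>: "expansion e (g k) (\<gamma> k)" for k
    unfolding \<gamma>_def using gZ [of k] Z(2) by (intro expansion_coords) auto
  then have \<gamma>0: "\<gamma> k 0 = 0" for k by (simp add: expansion_iff)
  have b_less: "b k < a k'" if "k < k'" for k k'
  proof -
    obtain m where m: "k' = Suc m" "k \<le> m" using \<open>k < k'\<close> by (cases k') auto
    have "b k < b (Suc k)" for k using hs(1,2) less_trans by blast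
    then have "b k \<le> b m" using m(2) by (rule lift_Suc_mono_le [OF less_imp_le])
    with hs(2) [of m] m(1) show ?thesis by simp
  qed
  have u_le: "u' k \<le> u k'" if "k < k'" for k k'
  proof -
    obtain m where m: "k' = Suc m" "k \<le> m" using \<open>k < k'\<close> by (cases k') auto
    have "u' k \<le> u' (Suc k)" for k using hs(3,4) order_trans by blast
    then have "u' k \<le> u' m" using m(2) by (rule lift_Suc_mono_le)
    with hs(4) [of m] m(1) show ?thesis by simp
  qed
  have a_ge: "k \<le> a k" for k
  proof (induction k)
    case (Suc k)
    with hs(1,2) [of k] show ?case by linarith
  qed simp
  have l_ge: "n \<le> l n" for n
  proof (induction n)
    case (Suc n)
    with lh(1) [of n] lh(2) [of n "Suc n"] show ?case by simp
  qed simp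
  have I_less: "x < x'" if "n < n'" "x \<in> I n" "x' \<in> I n'" for n n' x x'
    using that lh(2) [OF that(1)] by (simp add: I_def)
  have R_less: "x < x'" if k: "k < k'" and x: "x \<in> R k" "x' \<in> R k'" for k k' x x'
  proof -
    have "a k < a k'" "a k < b k'" "b k < a k'" "b k < b k'"
      using b_less [OF k] hs(1) [of k] hs(1) [of k'] by auto
    with x show ?thesis unfolding R_def using I_less by blast
  qed
  have w_c00: "w k \<in> c00" for k
    unfolding w_def by (intro c00_scale c00_diff c)
  have supp_w: "supp (w k) \<subseteq> R k" for k
  proof -
    have "supp (w k) \<subseteq> supp (c (a k)) \<union> supp (c (b k))" by (auto simp: w_def supp_def)
    then show ?thesis using c(2) [of "a k"] c(2) [of "b k"] unfolding R_def I_def by blast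
  qed
  have iota_w: "\<iota> (w k) = (1 / 2) *\<^sub>R (p (a k) - p (b k))" for k
    unfolding w_def p_def by (simp only: iota_scale iota_diff c00_diff c(1))
  have wY: "\<iota> (w k) \<in> Y" for k
    unfolding iota_w by (intro subspace_scale subspace_diff Y(1) pY)
  have Tw: "T (\<iota> (w k)) = g k" for k
  proof -
    have "T (p (a k) + (-1) *\<^sub>R p (b k)) = T (p (a k)) + (-1) *\<^sub>R T (p (b k))"
      using T(1) [OF pY subspace_scale [OF Y(1) pY]] T(2) [OF pY] by metis
    then have "T (p (a k) - p (b k)) = y (a k) - y (b k)" by (simp add: y_def)
    then show ?thesis
      unfolding iota_w g_def using T(2) [OF subspace_diff [OF Y(1) pY pY]] by simp
  qed
  have w_le: "norm (\<iota> (w k)) \<le> 1" for k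
    unfolding iota_w using norm_triangle_ineq4 [of "p (a k)" "p (b k)"] c(3) by (simp add: p_def)
  have w_ge: "1 / 2 \<le> norm (\<iota> (w k))" for k
  proof -
    have "norm (\<iota> (\<lambda>i. 1 / 2 * c (a k) i)) \<le> norm (\<iota> (w k))"
    proof (intro norm_iota_mono c00_scale c w_c00)
      fix i
      have "c (a k) i = 0 \<or> c (b k) i = 0"
      proof (rule ccontr)
        assume "\<not> ?thesis"
        then have "i \<in> I (a k)" "i \<in> I (b k)"
          using subsetD [OF c(2) [of "a k"], of i] subsetD [OF c(2) [of "b k"], of i]
          unfolding I_def by (simp_all add: supp_def)
        then show False using I_less [OF hs(1) [of k], of i i] by blast
      qed
      then show "\<bar>1 / 2 * c (a k) i\<bar> \<le> \<bar>w k i\<bar>" by (auto simp: w_def)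
    qed
    then show ?thesis unfolding iota_scale [OF c(1)] norm_scaleR c(3) by simp
  qed
  have t_c00: "t k \<in> c00" for k
    unfolding t_def by (intro restr_c00 \<gamma>0) simp
  have supp_t: "supp (t k) \<subseteq> {u k<..u' k}" "supp (t k) \<subseteq> support e (g k)" for k
    by (auto simp: t_def restr_def supp_def support_def \<gamma>_def split: if_splits)
  \<comment> \<open>By unconditionality a single term is dominated by the whole sum; the 2 is the
    inverse of the lower bound 1/2 for the norm of \<open>w k\<close>.\<close>
  have coef: "\<bar>\<alpha> k\<bar> \<le> 2 * norm (\<iota> (lin \<alpha> w))" if fin: "finite (supp \<alpha>)" and k: "k \<in> supp \<alpha>" for \<alpha> k
  proof -
    have "blocks (supp \<alpha>) (\<lambda>n i. \<alpha> n * w n i)"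
      unfolding blocks_def
    proof (intro ballI impI)
      fix n n' x x' assume n: "n < n'" and "x \<in> supp (\<lambda>i. \<alpha> n * w n i)" "x' \<in> supp (\<lambda>i. \<alpha> n' * w n' i)"
      then have "x \<in> supp (w n)" "x' \<in> supp (w n')" by (simp_all add: supp_def)
      then show "x < x'" by (intro R_less [OF n] subsetD [OF supp_w])
    qed
    then have "norm (\<iota> (\<lambda>i. \<alpha> k * w k i)) \<le> norm (\<iota> (lin \<alpha> w))"
      using abs_le_abs_vsum [OF fin _ k, of "\<lambda>n i. \<alpha> n * w n i"]
      by (intro norm_iota_mono c00_scale lin_c00 w_c00) (simp add: lin_def)
    then have "\<bar>\<alpha> k\<bar> * norm (\<iota> (w k)) \<le> norm (\<iota> (lin \<alpha> w))"
      by (simp add: iota_scale w_c00)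
    moreover have "\<bar>\<alpha> k\<bar> * (1 / 2) \<le> \<bar>\<alpha> k\<bar> * norm (\<iota> (w k))"
      using w_ge by (rule mult_left_mono) simp
    ultimately show ?thesis by linarith
  qed
  have sumY: "(\<Sum>k\<in>S. \<alpha> k *\<^sub>R \<iota> (w k)) \<in> Y \<and> T (\<Sum>k\<in>S. \<alpha> k *\<^sub>R \<iota> (w k)) = (\<Sum>k\<in>S. \<alpha> k *\<^sub>R g k)"
    if "finite S" for S \<alpha>
    using that
  proof (induction S rule: finite_induct)
    case empty
    show ?case using T(2) [OF subspace_0 [OF Y(1)], of 0] subspace_0 [OF Y(1)] by simp
  next
    case (insert k S)
    have 1: "\<alpha> k *\<^sub>R \<iota> (w k) \<in> Y" by (intro subspace_scale Y(1) wY)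
    with insert show ?case
      using T(1) [OF 1] T(2) [OF wY] Tw subspace_add [OF Y(1) 1] by simp
  qed
  have close: "\<iota> (lin \<alpha> w) \<in> Y" "norm (T (\<iota> (lin \<alpha> w)) - \<iota> (lin \<alpha> t)) \<le> 4 * \<eta> * norm (\<iota> (lin \<alpha> w))"
    if fin: "finite (supp \<alpha>)" for \<alpha>
  proof -
    let ?v = "norm (\<iota> (lin \<alpha> w))"
    have eqw: "\<iota> (lin \<alpha> w) = (\<Sum>k\<in>supp \<alpha>. \<alpha> k *\<^sub>R \<iota> (w k))"
      by (rule iota_lin [OF fin w_c00])
    have eqt: "\<iota> (lin \<alpha> t) = (\<Sum>k\<in>supp \<alpha>. \<alpha> k *\<^sub>R \<iota> (t k))"
      by (rule iota_lin [OF fin t_c00])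
    show "\<iota> (lin \<alpha> w) \<in> Y" unfolding eqw using sumY [OF fin, of \<alpha>] by blast
    have Tv: "T (\<iota> (lin \<alpha> w)) = (\<Sum>k\<in>supp \<alpha>. \<alpha> k *\<^sub>R g k)"
      unfolding eqw using sumY [OF fin, of \<alpha>] by blast
    have diff: "T (\<iota> (lin \<alpha> w)) - \<iota> (lin \<alpha> t) = (\<Sum>k\<in>supp \<alpha>. \<alpha> k *\<^sub>R (g k - \<iota> (t k)))"
      unfolding Tv eqt by (simp add: sum_subtractf scaleR_diff_right)
    have "norm (T (\<iota> (lin \<alpha> w)) - \<iota> (lin \<alpha> t)) \<le> (\<Sum>k\<in>supp \<alpha>. norm (\<alpha> k *\<^sub>R (g k - \<iota> (t k))))"
      unfolding diff by (rule norm_sum)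
    also have "\<dots> \<le> (\<Sum>k\<in>supp \<alpha>. 2 * ?v * (\<eta> * (1 / 2) ^ k))"
    proof (rule sum_mono)
      fix k assume "k \<in> supp \<alpha>"
      then show "norm (\<alpha> k *\<^sub>R (g k - \<iota> (t k))) \<le> 2 * ?v * (\<eta> * (1 / 2) ^ k)"
        unfolding norm_scaleR by (intro mult_mono coef fin gt) auto
    qed
    also have "\<dots> = 2 * ?v * \<eta> * (\<Sum>k\<in>supp \<alpha>. (1 / 2) ^ k)"
      by (simp add: sum_distrib_left mult_ac)
    also have "\<dots> \<le> 2 * ?v * \<eta> * 2"
    proof (rule mult_left_mono)
      have "(\<Sum>k\<in>supp \<alpha>. (1 / 2 :: real) ^ k) \<le> (\<Sum>k. (1 / 2) ^ k)"
        using fin by (intro sum_le_suminf summable_geometric) auto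
      also have "\<dots> = 2" by (simp add: suminf_geometric)
      finally show "(\<Sum>k\<in>supp \<alpha>. (1 / 2 :: real) ^ k) \<le> 2" .
    qed (use \<eta>(1) in simp)
    finally show "norm (T (\<iota> (lin \<alpha> w)) - \<iota> (lin \<alpha> t)) \<le> 4 * \<eta> * ?v" by (simp add: mult_ac)
  qed
  interpret block_pair N1 \<sigma> w t R "2 * K"
  proof
    show "1 / 2 \<le> W_norm N1 \<sigma> (w n)" "W_norm N1 \<sigma> (w n) \<le> 1" for n
      using w_ge [of n] w_le [of n] by (simp_all add: norm_iota w_c00)
    show "x < x'" if "n < n'" "x \<in> supp (t n)" "x' \<in> supp (t n')" for n n' x x'
      using u_le [OF that(1)] subsetD [OF supp_t(1) that(2)] subsetD [OF supp_t(1) that(3)] by simp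
    show "supp (t n) \<inter> R n' = {}" for n n'
      using supp_t(2) [of n] Z(4) [OF gZ [of n], of "a n'"] Z(4) [OF gZ [of n], of "b n'"]
      unfolding R_def I_def by blast
    show "0 < 2 * K" using K(1) by simp
    \<comment> \<open>Each \<open>R n\<close> consists of two intervals, so \<open>m\<close> of them
      give (zeta) at most 4 m endpoints. Since a and l are at least the identity, indices from
      \<open>4 * m\<close> on have all their intervals starting late enough.\<close>
    show "\<exists>n0. \<forall>A f. finite A \<and> card A \<le> m \<and> A \<subseteq> {n0..} \<and> W N1 \<sigma> f \<longrightarrow>
      W N1 \<sigma> (\<lambda>i. 1 / 2 * restr (\<Union>n\<in>A. R n) f i)" for m
    proof (intro exI [of _ "4 * m"] allI impI, elim conjE)
      fix A f assume A: "finite A" "card A \<le> m" "A \<subseteq> {4 * m..}" and f: "W N1 \<sigma> f"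
      define B where "B = a ` A \<union> b ` A"
      have fin: "finite B" using A(1) by (simp add: B_def)
      have "card B \<le> card (a ` A) + card (b ` A)"
        unfolding B_def by (rule card_Un_le)
      also have "\<dots> \<le> 2 * m"
        using card_image_le [OF A(1), of a] card_image_le [OF A(1), of b] A(2) by linarith
      finally have card: "card B \<le> 2 * m" .
      have "2 * card B \<le> l n" if n: "n \<in> B" for n
      proof -
        obtain k where k: "k \<in> A" "n = a k \<or> n = b k" using n unfolding B_def by blast
        then have "k \<le> n" using a_ge [of k] hs(1) [of k] by auto
        moreover have "4 * m \<le> k" using k(1) A(3) by auto
        ultimately show ?thesis using card l_ge [of n] by linarith
      qed
      then have "W N1 \<sigma> (\<lambda>i. 1 / 2 * restr (\<Union>n\<in>B. {l n..h n}) f i)"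
        by (intro zeta_intervals lh fin f)
      moreover have "(\<Union>n\<in>B. {l n..h n}) = (\<Union>n\<in>A. R n)"
        by (auto simp: B_def R_def I_def)
      ultimately show "W N1 \<sigma> (\<lambda>i. 1 / 2 * restr (\<Union>n\<in>A. R n) f i)" by simp
    qed
    fix \<alpha> :: "nat \<Rightarrow> real" assume fin: "finite (supp \<alpha>)"
    let ?w = "\<iota> (lin \<alpha> w)" and ?t = "\<iota> (lin \<alpha> t)"
    have n: "W_norm N1 \<sigma> (lin \<alpha> w) = norm ?w" "W_norm N1 \<sigma> (lin \<alpha> t) = norm ?t"
      by (simp_all add: norm_iota lin_c00 w_c00 t_c00)
    have tri: "norm ?t \<le> norm (T ?w) + norm (T ?w - ?t)" "norm (T ?w) \<le> norm ?t + norm (T ?w - ?t)"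
      using norm_triangle_ineq4 [of "T ?w" "T ?w - ?t"] norm_triangle_ineq [of ?t "T ?w - ?t"] by simp_all
    have "norm ?t \<le> K * norm ?w + 4 * \<eta> * norm ?w"
      using tri(1) K(2) [OF close(1) [OF fin]] close(2) [OF fin] by linarith
    also have "\<dots> \<le> K * norm ?w + K * norm ?w"
      using \<eta>(3) by (intro add_left_mono mult_right_mono) auto
    finally show "W_norm N1 \<sigma> (lin \<alpha> t) \<le> 2 * K * W_norm N1 \<sigma> (lin \<alpha> w)"
      unfolding n by simp
    have "norm ?w \<le> K * norm (T ?w)" by (rule K(3) [OF close(1) [OF fin]])
    also have "\<dots> \<le> K * (norm ?t + 4 * \<eta> * norm ?w)"
      using tri(2) close(2) [OF fin] K(1) by (intro mult_left_mono) auto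
    also have "\<dots> = K * norm ?t + (4 * \<eta> * K) * norm ?w" by (simp add: algebra_simps)
    finally show "W_norm N1 \<sigma> (lin \<alpha> w) \<le> 2 * K * W_norm N1 \<sigma> (lin \<alpha> t)"
      unfolding n \<eta>(2) by simp
  qed (fact w_c00 supp_w R_less t_c00)+
  show False by (rule inconsistent [OF N \<sigma>])
qed

end

lemma linear_continuous_bound:
  fixes T :: "'a::real_normed_vector \<Rightarrow> 'b::real_normed_vector"
  assumes Y: "subspace Y" and T: "continuous_on Y T" "\<And>r x. x \<in> Y \<Longrightarrow> T (r *\<^sub>R x) = r *\<^sub>R T x"
  obtains K where "1 \<le> K" "\<And>x. x \<in> Y \<Longrightarrow> norm (T x) \<le> K * norm x"
proof -
  have 0: "0 \<in> Y" using Y by (rule subspace_0)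
  then have T0: "T 0 = 0" using T(2) [of 0 0] by simp
  obtain \<delta> where \<delta>: "0 < \<delta>" "\<And>x. x \<in> Y \<Longrightarrow> norm x < \<delta> \<Longrightarrow> norm (T x) < 1"
    using T(1) 0 T0 unfolding continuous_on_iff by (metis dist_0_norm dist_commute zero_less_one)
  have "norm (T x) \<le> max 1 (2 / \<delta>) * norm x" if x: "x \<in> Y" for x
  proof (cases "x = 0")
    case False
    define r where "r = \<delta> / (2 * norm x)"
    have r: "0 < r" "r * norm x = \<delta> / 2" using \<delta>(1) False by (simp_all add: r_def)
    have "norm (T (r *\<^sub>R x)) < 1"
      using r \<delta>(1) by (intro \<delta>(2) subspace_scale Y x) simp
    then have "norm (T x) < 1 / r" using r(1) by (simp add: T(2) x field_simps)
    also have "1 / r = 2 / \<delta> * norm x" by (simp add: r_def)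
    also have "\<dots> \<le> max 1 (2 / \<delta>) * norm x" by (intro mult_right_mono) auto
    finally show ?thesis by simp
  qed (simp add: T0)
  with max.cobounded1 show ?thesis by (rule that)
qed

section \<open>Tightness by range\<close>

context W_completion
begin

lemma block_sequence_coords:
  assumes "block_sequence X e x"
  shows "coords e (x n) \<in> c00" "\<iota> (coords e (x n)) = x n"
    "finite (support e (x n))" "support e (x n) \<noteq> {}"
    "n < n' \<Longrightarrow> Max (support e (x n)) < Min (support e (x n'))"
proof -
  have x: "x n \<in> X" "x n \<noteq> 0" "finite (support e (x n))" for n
    using assms unfolding block_sequence_def by auto
  have step: "Max (support e (x n)) < Min (support e (x (Suc n)))" for n
    using assms unfolding block_sequence_def by auto
  show fin: "finite (support e (x n))" for n by (rule x)
  show "coords e (x n) \<in> c00" and eq: "\<iota> (coords e (x n)) = x n" for n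
    by (intro iota_coords x)+
  show ne: "support e (x n) \<noteq> {}" for n
  proof
    assume "support e (x n) = {}"
    then have "coords e (x n) = (\<lambda>i. 0)" by (auto simp: support_def supp_def)
    then show False using eq [of n] iota_zero x(2) [of n] by simp
  qed
  assume "n < n'"
  then show "Max (support e (x n)) < Min (support e (x n'))"
    using Max_less_Min_chain [of "\<lambda>n. support e (x n)", OF fin ne step]
    by (meson Max_in Min_in fin ne)
qed

lemma infinite_dimensional_block:
  assumes x: "block_sequence X e x" and Y: "range x \<subseteq> Y"
  shows "infinite_dimensional Y"
proof -
  note xc = block_sequence_coords [OF x]
  define c where "c n = coords e (x n)" for n
  have c: "c n \<in> c00" "\<iota> (c n) = x n" for n
    using xc by (simp_all add: c_def)
  have supp_less: "i < i'" if n: "n < n'" and i: "i \<in> supp (c n)" "i' \<in> supp (c n')" for n n' i i'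
  proof -
    have "i \<le> Max (support e (x n))" "Min (support e (x n')) \<le> i'"
      using i xc(3) by (simp_all add: c_def support_def)
    with xc(5) [OF n] show ?thesis by linarith
  qed
  have coef: "\<alpha> n = 0" if K: "finite K" "n \<in> K" and 0: "(\<Sum>k\<in>K. \<alpha> k *\<^sub>R x k) = 0" for K \<alpha> n
  proof -
    let ?z = "\<lambda>k i. \<alpha> k * c k i"
    have blk: "blocks K ?z"
      unfolding blocks_def
    proof (intro ballI impI)
      fix k k' i i' assume k: "k < k'" and "i \<in> supp (?z k)" "i' \<in> supp (?z k')"
      then have "i \<in> supp (c k)" "i' \<in> supp (c k')" by (simp_all add: supp_def)
      then show "i < i'" by (rule supp_less [OF k])
    qed
    have "\<iota> (vsum ?z K) = 0"
      using K(1) 0 by (simp add: iota_vsum c00_scale iota_scale c)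
    moreover have "vsum ?z K \<in> c00" by (intro c00_vsum c00_scale c)
    ultimately have "vsum ?z K i = 0" for i
      using coord_le_norm_iota [of "vsum ?z K" i] by simp
    then have "\<alpha> n * c n i = 0" for i
      using abs_le_abs_vsum [OF K(1) blk K(2), of i] by simp
    moreover obtain i where "c n i \<noteq> 0"
      using xc(4) [of n] by (auto simp: support_def supp_def c_def)
    ultimately show ?thesis by (metis mult_eq_0_iff)
  qed
  have inj: "inj x"
  proof (rule injI)
    fix n n' assume eq: "x n = x n'"
    show "n = n'"
    proof (rule ccontr)
      assume "n \<noteq> n'"
      then have "(1::real) = 0"
        using coef [of "{n, n'}" n "\<lambda>k. if k = n then 1 else -1"] eq by simp
      then show False by simp
    qed
  qed
  have "independent (range x)"
    unfolding real_vector.independent_explicit_finite_subsets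
  proof (intro allI impI ballI)
    fix S u v assume S: "S \<subseteq> range x" "finite S" and 0: "(\<Sum>v\<in>S. u v *\<^sub>R v) = 0" and v: "v \<in> S"
    define K where "K = x -` S"
    have K: "finite K" "x ` K = S"
      using S finite_vimageI [OF S(2) inj] by (auto simp: K_def)
    obtain n where n: "n \<in> K" "v = x n" using v K(2) by blast
    have "(\<Sum>k\<in>K. u (x k) *\<^sub>R x k) = 0"
      using 0 unfolding K(2) [symmetric] by (simp add: sum.reindex inj_on_subset [OF inj])
    then show "u v = 0" using coef [OF K(1) n(1), of "\<lambda>k. u (x k)"] n(2) by simp
  qed
  moreover have "infinite (range x)" using inj by (simp add: finite_image_iff)
  ultimately show ?thesis
    unfolding infinite_dimensional_def using independent_span_bound Y by (meson subset_trans)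
qed

lemma tight_by_range_e:
  assumes N: "N1 \<union> N2 = {1..}" "N1 \<inter> N2 = {}" "infinite N1" and \<sigma>: "coding_function N2 \<sigma>"
  shows "tight_by_range X e"
  unfolding tight_by_range_def
proof (intro conjI schauder allI impI)
  fix x assume x: "block_sequence X e x"
  let ?Y = "closure (span (range x))"
  note xc = block_sequence_coords [OF x]
  have xX: "x n \<in> X" "x n \<noteq> 0" for n using x unfolding block_sequence_def by auto
  have xY: "range x \<subseteq> ?Y"
    using closure_subset span_superset by (rule subset_trans [rotated])
  have Y: "subspace ?Y" by (intro subspace_closure subspace_span)
  have "span (range x) \<subseteq> X"
    using xX by (intro span_minimal subspace_X) auto
  then have YX: "?Y \<subseteq> X" by (rule closure_minimal) (simp add: X_eq)
  define l where "l n = Min (support e (x n))" for n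
  define h where "h n = Max (support e (x n))" for n
  have range_eq: "range_of e (x n) = {l n..h n}" for n
    by (simp add: range_of_def l_def h_def)
  have lh: "l n \<le> h n" "n < n' \<Longrightarrow> h n < l n'" for n n'
    using xc by (simp_all add: l_def h_def)
  show "tight_witnessed X e ?Y (\<lambda>n. range_of e (x n))"
    unfolding tight_witnessed_def
  proof (intro conjI allI impI ballI; (elim conjE)?)
    show "banach_subspace X ?Y"
      unfolding banach_subspace_def
      using Y YX infinite_dimensional_block [OF x xY] by simp
    show "range_of e (x n) \<noteq> {}" for n
      using lh(1) [of n] by (simp add: range_eq)
    show "i < j" if "i \<in> range_of e (x n)" "j \<in> range_of e (x (Suc n))" for n i j
      using that lh(2) [of n "Suc n"] by (simp add: range_eq)
  next
    fix Z assume Z: "banach_subspace X Z" and iso: "isomorphic ?Y Z"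
    let ?D = "{n. (\<Union>z\<in>Z. support e z) \<inter> range_of e (x n) = {}}"
    show "finite ?D"
    proof (rule ccontr)
      assume inf: "infinite ?D"
      have Z': "subspace Z" "Z \<subseteq> X" using Z unfolding banach_subspace_def by auto
      obtain T S where TS: "homeomorphism ?Y Z T S"
        and T_add: "\<And>x y. x \<in> ?Y \<Longrightarrow> y \<in> ?Y \<Longrightarrow> T (x + y) = T x + T y"
        and T_scale: "\<And>r x. x \<in> ?Y \<Longrightarrow> T (r *\<^sub>R x) = r *\<^sub>R T x"
        using iso unfolding isomorphic_def by blast
      have cont: "continuous_on ?Y T" "continuous_on Z S"
        and TZ: "\<And>x. x \<in> ?Y \<Longrightarrow> T x \<in> Z" and SY: "\<And>z. z \<in> Z \<Longrightarrow> S z \<in> ?Y"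
        and ST: "\<And>x. x \<in> ?Y \<Longrightarrow> S (T x) = x" and TS': "\<And>z. z \<in> Z \<Longrightarrow> T (S z) = z"
        using TS unfolding homeomorphism_def by auto
      \<comment> \<open>Continuity of the inverse turns into the lower estimate for \<open>T\<close>
        once its homogeneity is derived from that of \<open>T\<close>.\<close>
      have S_scale: "S (r *\<^sub>R z) = r *\<^sub>R S z" if "z \<in> Z" for r z
        using ST [OF subspace_scale [OF Y SY [OF that]], of r] T_scale [OF SY [OF that], of r] TS' [OF that]
        by simp
      obtain K1 where K1: "1 \<le> K1" "\<And>x. x \<in> ?Y \<Longrightarrow> norm (T x) \<le> K1 * norm x"
        using linear_continuous_bound [OF Y cont(1) T_scale] by blast
      obtain K2 where K2: "1 \<le> K2" "\<And>z. z \<in> Z \<Longrightarrow> norm (S z) \<le> K2 * norm z"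
        using linear_continuous_bound [OF Z'(1) cont(2) S_scale] by blast
      define K where "K = max K1 K2"
      have K: "1 \<le> K" "norm (T x) \<le> K * norm x" "norm x \<le> K * norm (T x)" if "x \<in> ?Y" for x
      proof -
        show "1 \<le> K" using K1(1) by (simp add: K_def)
        have "K1 * norm x \<le> K * norm x" "K2 * norm (T x) \<le> K * norm (T x)"
          by (intro mult_right_mono; simp add: K_def)+
        with K1(2) [OF that] K2(2) [OF TZ [OF that]] ST [OF that]
        show "norm (T x) \<le> K * norm x" "norm x \<le> K * norm (T x)" by simp_all
      qed
      \<comment> \<open>Only every second missed range is used. The ranges skipped leave an integer
        between consecutive intervals, without which the right endpoint of one and the left endpoint
        of the next could coincide in (zeta).\<close>
      define d where "d n = enumerate ?D (2 * n)" for n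
      have dD: "d n \<in> ?D" for n unfolding d_def by (rule enumerate_in_set [OF inf])
      have d_gap: "Suc (d n) < d n'" if "n < n'" for n n'
      proof -
        have "d n < enumerate ?D (Suc (2 * n))" "enumerate ?D (Suc (2 * n)) < d n'"
          unfolding d_def using that by (intro enumerate_mono inf; simp)+
        then show ?thesis by linarith
      qed
      define c where "c n = (\<lambda>i. 1 / norm (x (d n)) * coords e (x (d n)) i)" for n
      have \<iota>c: "\<iota> (c n) = (1 / norm (x (d n))) *\<^sub>R x (d n)" for n
        unfolding c_def iota_scale [OF xc(1)] xc(2) ..
      show False
      proof (rule no_embedding [of c "\<lambda>n. l (d n)" "\<lambda>n. h (d n)" ?Y T K Z N2])
        show "c n \<in> c00" for n unfolding c_def by (intro c00_scale xc)
        show "supp (c n) \<subseteq> {l (d n)..h (d n)}" for n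
        proof
          fix i assume "i \<in> supp (c n)"
          then have "i \<in> support e (x (d n))" by (simp add: c_def supp_def support_def)
          then show "i \<in> {l (d n)..h (d n)}" using xc(3) by (simp add: l_def h_def)
        qed
        show "norm (\<iota> (c n)) = 1" for n
          using xX(2) by (simp add: \<iota>c)
        show "l (d n) \<le> h (d n)" for n by (rule lh)
        show "Suc (h (d n)) < l (d n')" if "n < n'" for n n'
          using lh(2) [of "d n" "Suc (d n)"] lh(1) [of "Suc (d n)"] lh(2) [OF d_gap [OF that]] by simp
        show "\<iota> (c n) \<in> ?Y" for n
          unfolding \<iota>c using xY by (intro subspace_scale Y) auto
        show "support e z \<inter> {l (d n)..h (d n)} = {}" if "z \<in> Z" for z n
          using dD [of n] that by (auto simp: range_eq)
        show "1 \<le> K" using K1(1) by (simp add: K_def)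
      qed (fact Y T_add T_scale K(2,3) Z' TZ N \<sigma>)+
    qed
  qed
qed

end

theorem theorem4p1:
  fixes N1 N2 :: "nat set" and \<sigma> :: "(nat \<Rightarrow> real) list \<Rightarrow> nat"
    and \<iota> :: "(nat \<Rightarrow> real) \<Rightarrow> 'a::banach" and X :: "'a set"
  assumes "N1 \<union> N2 = {1..}" and "N1 \<inter> N2 = {}" and "infinite N1" and "infinite N2"
    and "coding_function N2 \<sigma>"
    and "is_completion (W_norm N1 \<sigma>) \<iota> X"
  shows "tight_by_range X (\<lambda>n. \<iota> (unit_vec n))"
proof -
  interpret W_completion N1 \<sigma> \<iota> X
    by unfold_locales (rule assms(6))
  have "e = (\<lambda>n. \<iota> (unit_vec n))"
    by (rule ext) (rule e_def)
  with tight_by_range_e [OF assms(1-3,5)] show ?thesis by simp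
qed

end
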